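(* Let $A$ and $B$ be C$^*$-algebras with $A$ separable. Let $\phi,\psi:(A,\alpha,\mathfrak u)\to(B,\beta,\mathfrak v)$ be two $G$-coherent morphisms between anomalous actions of a countable discrete group $G$. Then: (i) If $B$ is either stable or has almost stable rank one, then $\phi$ and $\psi$ are approximately Murray--von Neumann equivalent if and only if they are proper approximately unitarily equivalent. (ii) If $B$ is stable, then $\phi$ and $\psi$ are asymptotically Murray--von Neumann equivalent if and only if they are proper asymptotically unitarily equivalent.
   Context: $\mathcal M(A)$ is the multiplier algebra of $A$; $B^\dagger$ is the forced unitisation of $B$ (a new unit $\mathbf 1$ is added even if $B$ is unital); $\mathcal U(\mathbf 1+B)$ is the group of unitaries $u\in B^\dagger$ with $u-\mathbf 1\in B$. $B$ is stable if $B\cong B\otimes\mathbb K$; $B$ has almost stable rank one if $B\subset\overline{GL(B^\dagger)}$. An anomalous action $(A,\alpha,\mathfrak u)$ of $G$ consists of maps $\alpha:G\to\mathrm{Aut}(A)$, $\mathfrak u:G\times G\to\mathcal U(\mathcal M(A))$ such that for all $g,h,k\in G$: $\alpha_g\alpha_h=\mathrm{Ad}(\mathfrak u_{g,h})\alpha_{gh}$; $\alpha_g(\mathfrak u_{h,k})\mathfrak u_{g,hk}\mathfrak u_{gh,k}^*\mathfrak u_{g,h}^*\in\mathbb T\mathbf 1_{\mathcal M(A)}$ (this defines the anomaly, a normalised 3-cocycle in $Z^3(G,\mathbb T)$; the two anomalous actions between which equivalences of $G$-coherent morphisms are considered have the same anomaly); $\mathfrak u_{g,1}=\mathfrak u_{1,g}=\mathbf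 1$. A $G$-coherent morphism $\phi:(A,\alpha,\mathfrak u)\to(B,\beta,\mathfrak v)$ is a tuple of linear maps $(\phi_g:A\to B)_{g\in G}$ with $\phi_g(a)^*\phi_g(b)=\phi_1(a^*b)$ and $\phi_{gh}(\mathfrak u_{g,h}^*\alpha_g(a)b)=\mathfrak v_{g,h}^*\beta_g(\phi_h(a))\phi_g(b)$ for all $g,h\in G$, $a,b\in A$. Let $\phi,\psi:(A,\alpha,\mathfrak u)\to(B,\beta,\mathfrak v)$ be $G$-coherent morphisms. - Approximately Murray--von Neumann equivalent: for all $\varepsilon>0$ and finite sets $K\subset G$, $F\subset A$ there is $v\in B$ with $\|\beta_g(v^* )\phi_g(a)v-\psi_g(a)\|<\varepsilon$ and $\|\beta_g(v)\psi_g(a)v^*-\phi_g(a)\|<\varepsilon$ for all $g\in K$, $a\in F$. - Asymptotically Murray--von Neumann equivalent: there is a norm-continuous path $v:[0,\infty)\to B$ with $\lim_{t\to\infty}\beta_g(v_t^* )\phi_g(a)v_t=\psi_g(a)$ and $\lim_{t\to\infty}\beta_g(v_t)\psi_g(a)v_t^*=\phi_g(a)$ for all $g\in G$, $a\in A$. - Proper approximately unitarily equivalent: there is a sequence $u_n\in\mathcal U(\mathbf 1+B)$ with $\lim_{n\to\infty}\beta_g(u_n)\phi_g(a)u_n^*=\psi_g(a)$ for all $g\in G$, $a\in A$. - Proper asymptotically unitarily equivalent: there is a norm-continuous path $u:[0,\infty)\to\mathcal U(\mathbf 1+B)$ with $\lim_{t\to\infty}\beta_g(u_t)\phi_g(a)u_t^*=\psi_g(a)$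 for all $g\in G$, $a\in A$. *)

theory Defs
  imports "HOL-Analysis.Analysis"
begin

section \<open>C*-algebras\<close>

class scaleC = scaleR +
  fixes scaleC :: "complex \<Rightarrow> 'a \<Rightarrow> 'a"  (infixr \<open>*\<^sub>C\<close> 75)
  assumes scaleR_scaleC: "r *\<^sub>R x = complex_of_real r *\<^sub>C x"

class complex_vector = scaleC + ab_group_add +
  assumes scaleC_add_right: "a *\<^sub>C (x + y) = a *\<^sub>C x + a *\<^sub>C y"
    and scaleC_add_left: "(a + b) *\<^sub>C x = a *\<^sub>C x + b *\<^sub>C x"
    and scaleC_scaleC: "a *\<^sub>C b *\<^sub>C x = (a * b) *\<^sub>C x"
    and scaleC_one: "1 *\<^sub>C x = x"
begin

subclass real_vector
  by standard (simp_all add: scaleR_scaleC scaleC_add_right scaleC_add_left scaleC_scaleC scaleC_one)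

lemma scaleC_zero_left [simp]: "0 *\<^sub>C x = 0"
  using scaleC_add_left[of 0 0 x] by simp

lemma scaleC_zero_right [simp]: "a *\<^sub>C 0 = 0"
  using scaleC_add_right[of a 0 0] by simp

lemma scaleC_minus_left: "(- a) *\<^sub>C x = - (a *\<^sub>C x)"
  using scaleC_add_left[of "- a" a x] by (simp add: eq_neg_iff_add_eq_0)

lemma scaleC_minus_right: "a *\<^sub>C (- x) = - (a *\<^sub>C x)"
  using scaleC_add_right[of a "- x" x] by (simp add: eq_neg_iff_add_eq_0)

end

class complex_algebra = complex_vector + ring +
  assumes mult_scaleC_left [simp]: "(a *\<^sub>C x) * y = a *\<^sub>C (x * y)"
    and mult_scaleC_right [simp]: "x * (a *\<^sub>C y) = a *\<^sub>C (x * y)"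
begin

subclass real_algebra
  by standard (simp_all add: scaleR_scaleC)

end

class star_algebra = complex_algebra +
  fixes star :: "'a \<Rightarrow> 'a"
  assumes star_add: "star (x + y) = star x + star y"
    and star_scaleC: "star (a *\<^sub>C x) = cnj a *\<^sub>C star x"
    and star_mult: "star (x * y) = star y * star x"
    and star_star [simp]: "star (star x) = x"
begin

lemma star_zero [simp]: "star 0 = 0"
  using star_add[of 0 0] by simp

lemma star_minus: "star (- x) = - star x"
  using star_add[of "- x" x] by (simp add: eq_neg_iff_add_eq_0)

lemma star_diff: "star (x - y) = star x - star y"
  using star_add[of x "- y"] by (simp add: star_minus)

lemma star_eq_iff [simp]: "star x = star y \<longleftrightarrow> x = y"
  by (metis star_star)

end

class cstar_algebra = star_algebra + real_normed_algebra + banach +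
  assumes norm_scaleC: "norm (a *\<^sub>C x) = cmod a * norm x"
    and cstar_identity: "norm (star x * x) = (norm x)\<^sup>2"

lemma norm_star [simp]: "norm (star x) = norm (x :: 'a::cstar_algebra)"
proof -
  have le: "norm y \<le> norm (star y)" for y :: 'a
  proof (cases "norm y = 0")
    case False
    have "(norm y)\<^sup>2 \<le> norm (star y) * norm y"
      by (metis cstar_identity norm_mult_ineq)
    then show ?thesis
      using False by (simp add: power2_eq_square)
  qed simp
  from le[of x] le[of "star x"] show ?thesis by simp
qed

definition clinear :: "('a::complex_vector \<Rightarrow> 'b::complex_vector) \<Rightarrow> bool" where
  "clinear f \<longleftrightarrow> (\<forall>x y. f (x + y) = f x + f y) \<and> (\<forall>c x. f (c *\<^sub>C x) = c *\<^sub>C f x)"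

definition star_automorphism :: "('a::star_algebra \<Rightarrow> 'a) \<Rightarrow> bool" where
  "star_automorphism f \<longleftrightarrow> clinear f \<and> bij f
     \<and> (\<forall>x y. f (x * y) = f x * f y) \<and> (\<forall>x. f (star x) = star (f x))"

text \<open>The sort of the next two notions asks for a unit but not for \<^prop>\<open>0 \<noteq> 1\<close>:
  the multiplier algebra of the zero algebra is zero.\<close>

definition unitary :: "'a::{star_algebra, monoid_mult} \<Rightarrow> bool" where
  "unitary w \<longleftrightarrow> star w * w = 1 \<and> w * star w = 1"

definition general_linear :: "'a::{star_algebra, monoid_mult} set" where
  "general_linear = {x. \<exists>y. x * y = 1 \<and> y * x = 1}"


section \<open>The multiplier algebra\<close>

text \<open>Multipliers are double centralisers in the sense of Busby: linearity and boundedness of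
  the two maps, as well as \<open>L (x * y) = L x * y\<close> and \<open>R (x * y) = x * R y\<close>, follow from
  the defining identity. The pair \<open>(L, R)\<close> stands for the multiplier \<open>m\<close> with
  \<open>L x = m x\<close> and \<open>R x = x m\<close>.\<close>

typedef (overloaded) 'a multiplier =
  "{p :: ('a::cstar_algebra \<Rightarrow> 'a) \<times> ('a \<Rightarrow> 'a). \<forall>x y. x * fst p y = snd p x * y}"
  by (rule exI[of _ "(\<lambda>x. x, \<lambda>x. x)"]) simp

definition lmul :: "'a::cstar_algebra multiplier \<Rightarrow> 'a \<Rightarrow> 'a"  (infixr \<open>\<rhd>\<close> 72) where
  "m \<rhd> x = fst (Rep_multiplier m) x"

definition rmul :: "'a::cstar_algebra \<Rightarrow> 'a multiplier \<Rightarrow> 'a"  (infixl \<open>\<lhd>\<close> 71) where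
  "x \<lhd> m = snd (Rep_multiplier m) x"

definition mk_multiplier ::
    "('a::cstar_algebra \<Rightarrow> 'a) \<Rightarrow> ('a \<Rightarrow> 'a) \<Rightarrow> 'a multiplier" where
  "mk_multiplier L R = Abs_multiplier (L, R)"

lemma centraliser: "x * (m \<rhd> y) = (x \<lhd> m) * y"
  using Rep_multiplier[of m] by (auto simp: lmul_def rmul_def)

lemma
  assumes "\<And>x y. x * L y = R x * y"
  shows lmul_mk: "mk_multiplier L R \<rhd> a = L a"
    and rmul_mk: "a \<lhd> mk_multiplier L R = R a"
  using assms by (simp_all add: lmul_def rmul_def mk_multiplier_def Abs_multiplier_inverse)

lemma multiplier_eqI:
  assumes "\<And>x. m \<rhd> x = n \<rhd> x" and "\<And>x. x \<lhd> m = x \<lhd> n"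
  shows "m = n"
proof -
  have "fst (Rep_multiplier m) = fst (Rep_multiplier n)"
    "snd (Rep_multiplier m) = snd (Rep_multiplier n)"
    using assms by (auto simp: lmul_def rmul_def)
  then show ?thesis by (metis Rep_multiplier_inject prod.expand)
qed

lemma left_nondegenerate:
  fixes a b :: "'a::cstar_algebra"
  assumes "\<And>x. x * a = x * b"
  shows "a = b"
proof -
  have "star (a - b) * (a - b) = 0" by (simp add: assms right_diff_distrib)
  then show ?thesis using cstar_identity[of "a - b"] by simp
qed

lemma right_nondegenerate:
  fixes a b :: "'a::cstar_algebra"
  assumes "\<And>x. a * x = b * x"
  shows "a = b"
proof -
  have "star a = star b"
    by (rule left_nondegenerate) (metis assms star_mult star_star)
  then show ?thesis by simp
qed

lemma lmul_add: "m \<rhd> (x + y) = m \<rhd> x + m \<rhd> y"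
  by (rule left_nondegenerate) (simp add: centraliser distrib_left)

lemma lmul_scaleC: "m \<rhd> (c *\<^sub>C x) = c *\<^sub>C (m \<rhd> x)"
  by (rule left_nondegenerate) (simp add: centraliser)

lemma lmul_mult: "m \<rhd> (x * y) = (m \<rhd> x) * y"
  by (rule left_nondegenerate) (simp add: centraliser flip: mult.assoc)

lemma rmul_add: "(x + y) \<lhd> m = (x \<lhd> m) + (y \<lhd> m)"
  by (rule right_nondegenerate) (simp add: centraliser[symmetric] distrib_right)

lemma rmul_scaleC: "(c *\<^sub>C x) \<lhd> m = c *\<^sub>C (x \<lhd> m)"
  by (rule right_nondegenerate) (simp add: centraliser[symmetric])

lemma rmul_mult: "(x * y) \<lhd> m = x * (y \<lhd> m)"
  by (rule right_nondegenerate) (simp add: centraliser[symmetric] mult.assoc)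

instantiation multiplier :: (cstar_algebra) "{star_algebra, monoid_mult}"
begin

definition zero_multiplier_def: "0 = mk_multiplier (\<lambda>x. 0) (\<lambda>x. 0)"
definition one_multiplier_def: "1 = mk_multiplier (\<lambda>x. x) (\<lambda>x. x)"
definition plus_multiplier_def:
  "m + n = mk_multiplier (\<lambda>x. m \<rhd> x + n \<rhd> x) (\<lambda>x. (x \<lhd> m) + (x \<lhd> n))"
definition minus_multiplier_def:
  "m - n = mk_multiplier (\<lambda>x. m \<rhd> x - n \<rhd> x) (\<lambda>x. (x \<lhd> m) - (x \<lhd> n))"
definition uminus_multiplier_def:
  "- m = mk_multiplier (\<lambda>x. - (m \<rhd> x)) (\<lambda>x. - (x \<lhd> m))"
definition times_multiplier_def:
  "m * n = mk_multiplier (\<lambda>x. m \<rhd> n \<rhd> x) (\<lambda>x. x \<lhd> m \<lhd> n)"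
definition scaleC_multiplier_def:
  "c *\<^sub>C m = mk_multiplier (\<lambda>x. c *\<^sub>C (m \<rhd> x)) (\<lambda>x. c *\<^sub>C (x \<lhd> m))"
definition scaleR_multiplier_def:
  "r *\<^sub>R m = complex_of_real r *\<^sub>C (m :: 'a multiplier)"
definition star_multiplier_def:
  "star m = mk_multiplier (\<lambda>x. star (star x \<lhd> m)) (\<lambda>x. star (m \<rhd> star x))"

lemma multiplier_actions [simp]:
  fixes m n :: "'a multiplier" and x :: 'a
  shows "0 \<rhd> x = 0" "x \<lhd> 0 = 0" "1 \<rhd> x = x" "x \<lhd> 1 = x"
    "(m + n) \<rhd> x = m \<rhd> x + n \<rhd> x" "x \<lhd> (m + n) = (x \<lhd> m) + (x \<lhd> n)"
    "(m - n) \<rhd> x = m \<rhd> x - n \<rhd> x" "x \<lhd> (m - n) = (x \<lhd> m) - (x \<lhd> n)"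
    "(- m) \<rhd> x = - (m \<rhd> x)" "x \<lhd> (- m) = - (x \<lhd> m)"
    "(m * n) \<rhd> x = m \<rhd> n \<rhd> x" "x \<lhd> (m * n) = x \<lhd> m \<lhd> n"
    "(c *\<^sub>C m) \<rhd> x = c *\<^sub>C (m \<rhd> x)" "x \<lhd> (c *\<^sub>C m) = c *\<^sub>C (x \<lhd> m)"
    "star m \<rhd> x = star (star x \<lhd> m)" "x \<lhd> star m = star (m \<rhd> star x)"
proof -
  have st: "y * star (star z \<lhd> m) = star (m \<rhd> star y) * z" for y z
  proof -
    have "y * star (star z \<lhd> m) = star ((star z \<lhd> m) * star y)" by (simp add: star_mult)
    also have "\<dots> = star (m \<rhd> star y) * z" by (simp add: star_mult flip: centraliser)
    finally show ?thesis .
  qed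
  show "0 \<rhd> x = 0" "x \<lhd> 0 = 0" "1 \<rhd> x = x" "x \<lhd> 1 = x"
    "(m + n) \<rhd> x = m \<rhd> x + n \<rhd> x" "x \<lhd> (m + n) = (x \<lhd> m) + (x \<lhd> n)"
    "(m - n) \<rhd> x = m \<rhd> x - n \<rhd> x" "x \<lhd> (m - n) = (x \<lhd> m) - (x \<lhd> n)"
    "(- m) \<rhd> x = - (m \<rhd> x)" "x \<lhd> (- m) = - (x \<lhd> m)"
    "(m * n) \<rhd> x = m \<rhd> n \<rhd> x" "x \<lhd> (m * n) = x \<lhd> m \<lhd> n"
    "(c *\<^sub>C m) \<rhd> x = c *\<^sub>C (m \<rhd> x)" "x \<lhd> (c *\<^sub>C m) = c *\<^sub>C (x \<lhd> m)"
    unfolding zero_multiplier_def one_multiplier_def plus_multiplier_def minus_multiplier_def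
      uminus_multiplier_def times_multiplier_def scaleC_multiplier_def
    by (rule lmul_mk rmul_mk; simp add: centraliser distrib_left distrib_right
      left_diff_distrib right_diff_distrib)+
  show "star m \<rhd> x = star (star x \<lhd> m)" "x \<lhd> star m = star (m \<rhd> star x)"
    by (simp_all add: star_multiplier_def lmul_mk rmul_mk st)
qed

instance
  by standard
    ((rule multiplier_eqI; simp add: scaleR_multiplier_def lmul_add rmul_add lmul_scaleC
      rmul_scaleC scaleC_add_right scaleC_add_left scaleC_scaleC scaleC_one star_add star_scaleC
      ac_simps)+)

end

text \<open>The extension of an automorphism of the algebra to its multiplier algebra.\<close>

definition multiplier_ext ::
    "('a::cstar_algebra \<Rightarrow> 'a) \<Rightarrow> 'a multiplier \<Rightarrow> 'a multiplier" where
  "multiplier_ext f m = mk_multiplier (\<lambda>x. f (m \<rhd> inv f x)) (\<lambda>x. f (inv f x \<lhd> m))"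

lemma
  assumes "star_automorphism f"
  shows multiplier_ext_lmul: "multiplier_ext f m \<rhd> x = f (m \<rhd> inv f x)"
    and multiplier_ext_rmul: "x \<lhd> multiplier_ext f m = f (inv f x \<lhd> m)"
proof -
  have f: "f (inv f y) = y" "f (y * z) = f y * f z" for y z
    using assms by (auto simp: star_automorphism_def bij_is_surj surj_f_inv_f)
  have "y * f (m \<rhd> inv f z) = f (inv f y \<lhd> m) * z" for y z
  proof -
    have "y * f (m \<rhd> inv f z) = f (inv f y * (m \<rhd> inv f z))" by (simp add: f)
    also have "\<dots> = f (inv f y \<lhd> m) * z" by (simp add: centraliser f)
    finally show ?thesis .
  qed
  then show "multiplier_ext f m \<rhd> x = f (m \<rhd> inv f x)"
    "x \<lhd> multiplier_ext f m = f (inv f x \<lhd> m)"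
    by (simp_all add: multiplier_ext_def lmul_mk rmul_mk)
qed

definition Ad :: "'a::cstar_algebra multiplier \<Rightarrow> 'a \<Rightarrow> 'a" where
  "Ad w x = w \<rhd> x \<lhd> star w"


section \<open>The forced unitisation\<close>

text \<open>\<open>Unitization b z\<close> stands for \<open>b + z 1\<close>, where \<open>1\<close> is a new unit, even if the algebra
  already has one. The norm below is the unique C*-norm: left multiplication on the algebra
  alone does not see the new direction if the algebra is unital, the scalar part does.\<close>

datatype 'a unitization = Unitization (alg_part: 'a) (scalar_part: complex)

definition unit_lmul :: "'a::cstar_algebra unitization \<Rightarrow> 'a \<Rightarrow> 'a" where
  "unit_lmul p x = alg_part p * x + scalar_part p *\<^sub>C x"

instantiation unitization :: (cstar_algebra) "{star_algebra, monoid_mult}"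
begin

definition zero_unitization_def: "0 = Unitization 0 0"
definition one_unitization_def: "1 = Unitization 0 1"
definition plus_unitization_def:
  "p + q = Unitization (alg_part p + alg_part q) (scalar_part p + scalar_part q)"
definition minus_unitization_def:
  "p - q = Unitization (alg_part p - alg_part q) (scalar_part p - scalar_part q)"
definition uminus_unitization_def: "- p = Unitization (- alg_part p) (- scalar_part p)"
definition times_unitization_def:
  "p * q = Unitization
     (alg_part p * alg_part q + scalar_part q *\<^sub>C alg_part p + scalar_part p *\<^sub>C alg_part q)
     (scalar_part p * scalar_part q)"
definition scaleC_unitization_def:
  "c *\<^sub>C p = Unitization (c *\<^sub>C alg_part p) (c * scalar_part p)"
definition scaleR_unitization_def:
  "r *\<^sub>R p = complex_of_real r *\<^sub>C (p :: 'a unitization)"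
definition star_unitization_def: "star p = Unitization (star (alg_part p)) (cnj (scalar_part p))"

lemmas unitization_ops = zero_unitization_def one_unitization_def plus_unitization_def
  minus_unitization_def uminus_unitization_def times_unitization_def scaleC_unitization_def
  scaleR_unitization_def star_unitization_def

instance
  by standard
    (auto simp: unitization_ops scaleC_add_right scaleC_add_left scaleC_scaleC scaleC_one
      star_add star_scaleC star_mult algebra_simps)

end

lemma bounded_linear_scaleC: "bounded_linear (\<lambda>x::'a::cstar_algebra. z *\<^sub>C x)"
  by (rule bounded_linear_intro[where K = "cmod z"])
    (simp_all add: scaleC_add_right scaleR_scaleC scaleC_scaleC norm_scaleC mult.commute)

lemma bounded_linear_unit_lmul: "bounded_linear (unit_lmul p)"
  unfolding unit_lmul_def
  by (intro bounded_linear_add bounded_linear_mult_right bounded_linear_scaleC)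

lemma unit_lmul_add: "unit_lmul (p + q) = (\<lambda>x. unit_lmul p x + unit_lmul q x)"
  by (auto simp: unit_lmul_def unitization_ops scaleC_add_left algebra_simps)

lemma unit_lmul_mult: "unit_lmul (p * q) = unit_lmul p \<circ> unit_lmul q"
  by (auto simp: unit_lmul_def unitization_ops scaleC_add_right scaleC_scaleC algebra_simps)

lemma unit_lmul_scaleC: "unit_lmul (c *\<^sub>C p) x = c *\<^sub>C unit_lmul p x"
  by (auto simp: unit_lmul_def unitization_ops scaleC_add_right scaleC_scaleC)

lemma norm_unit_lmul: "norm (unit_lmul p x) \<le> onorm (unit_lmul p) * norm x"
  by (rule onorm[OF bounded_linear_unit_lmul])

lemma onorm_unit_lmul_scaleC: "onorm (unit_lmul (c *\<^sub>C p)) = cmod c * onorm (unit_lmul p)"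
proof (rule antisym)
  show le: "onorm (unit_lmul (c *\<^sub>C p)) \<le> cmod c * onorm (unit_lmul p)" for c p
    by (rule onorm_bound)
      (auto simp: unit_lmul_scaleC norm_scaleC mult.assoc bounded_linear_unit_lmul
        intro!: mult_left_mono norm_unit_lmul mult_nonneg_nonneg onorm_pos_le)
  show "cmod c * onorm (unit_lmul p) \<le> onorm (unit_lmul (c *\<^sub>C p))"
  proof (cases "c = 0")
    case True
    then show ?thesis by (simp add: onorm_pos_le bounded_linear_unit_lmul)
  next
    case False
    have "onorm (unit_lmul p) = onorm (unit_lmul (inverse c *\<^sub>C c *\<^sub>C p))"
      using False by (simp add: scaleC_scaleC scaleC_one)
    also have "\<dots> \<le> cmod (inverse c) * onorm (unit_lmul (c *\<^sub>C p))" by (rule le)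
    finally show ?thesis using False by (simp add: norm_inverse norm_divide field_simps)
  qed
qed

lemma onorm_unit_lmul_Unitization: "onorm (unit_lmul (Unitization b 0)) = norm b"
proof (rule antisym)
  show "onorm (unit_lmul (Unitization b 0)) \<le> norm b"
    by (rule onorm_bound) (auto simp: unit_lmul_def norm_mult_ineq)
  have "norm b * norm b = norm (unit_lmul (Unitization b 0) (star b))"
    using cstar_identity[of "star b"] by (simp add: unit_lmul_def power2_eq_square)
  also have "\<dots> \<le> onorm (unit_lmul (Unitization b 0)) * norm b"
    using norm_unit_lmul[of _ "star b"] by simp
  finally show "norm b \<le> onorm (unit_lmul (Unitization b 0))"
    by (cases "b = 0") (simp_all add: onorm_pos_le bounded_linear_unit_lmul)
qed

lemma onorm_unit_lmul_star:
  "(onorm (unit_lmul p))\<^sup>2 \<le> onorm (unit_lmul (star p * p))"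
proof -
  let ?N = "onorm (unit_lmul (star p * p))"
  have N: "?N \<ge> 0" by (simp add: onorm_pos_le bounded_linear_unit_lmul)
  have "norm (unit_lmul p x) \<le> sqrt ?N * norm x" for x
  proof -
    have "star (unit_lmul p x) * unit_lmul p x = star x * unit_lmul (star p * p) x"
      by (simp add: unit_lmul_def unitization_ops star_add star_mult star_scaleC
          scaleC_add_right scaleC_scaleC algebra_simps)
    then have "(norm (unit_lmul p x))\<^sup>2 = norm (star x * unit_lmul (star p * p) x)"
      by (metis cstar_identity)
    also have "\<dots> \<le> norm x * norm (unit_lmul (star p * p) x)"
      using norm_mult_ineq[of "star x"] by simp
    also have "\<dots> \<le> norm x * (?N * norm x)"
      by (intro mult_left_mono norm_unit_lmul) simp
    also have "\<dots> = (sqrt ?N * norm x)\<^sup>2"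
      using N by (simp add: power_mult_distrib power2_eq_square)
    finally show ?thesis
      by (rule power2_le_imp_le) (simp add: N)
  qed
  then have "onorm (unit_lmul p) \<le> sqrt ?N"
    by (intro onorm_bound) (auto simp: N)
  then show ?thesis
    using N by (metis bounded_linear_unit_lmul onorm_pos_le power_mono real_sqrt_pow2)
qed

lemma onorm_unit_lmul_mult:
  "onorm (unit_lmul (p * q)) \<le> onorm (unit_lmul p) * onorm (unit_lmul q)"
  unfolding unit_lmul_mult by (intro onorm_compose bounded_linear_unit_lmul)

lemma onorm_unit_lmul_nonneg: "onorm (unit_lmul p) \<ge> 0"
  by (simp add: onorm_pos_le bounded_linear_unit_lmul)

instantiation unitization :: (cstar_algebra) real_normed_algebra
begin

definition norm_unitization_def: "norm p = max (cmod (scalar_part p)) (onorm (unit_lmul p))"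
definition sgn_unitization_def: "sgn p = p /\<^sub>R norm (p :: 'a unitization)"
definition dist_unitization_def: "dist p q = norm (p - q :: 'a unitization)"
definition uniformity_unitization_def [code del]:
  "uniformity = (INF e\<in>{0<..}. principal {(x :: 'a unitization, y). dist x y < e})"
definition open_unitization_def [code del]:
  "open (U :: 'a unitization set) \<longleftrightarrow>
     (\<forall>x\<in>U. eventually (\<lambda>(x', y). x' = x \<longrightarrow> y \<in> U) uniformity)"

lemma norm_alg_part_le: "norm (alg_part p) \<le> 2 * norm (p :: 'a unitization)"
proof -
  have eq: "Unitization (alg_part p) 0 = p + (- scalar_part p) *\<^sub>C 1"
    by (simp add: unitization_ops)
  have "onorm (unit_lmul (1::'a unitization)) \<le> 1"
    by (rule onorm_bound) (auto simp: unit_lmul_def unitization_ops scaleC_one)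
  then have one: "onorm (unit_lmul ((- scalar_part p) *\<^sub>C (1::'a unitization))) \<le> cmod (scalar_part p)"
    by (simp only: onorm_unit_lmul_scaleC norm_minus_cancel) (simp add: mult_left_le)
  have "norm (alg_part p) = onorm (unit_lmul (p + (- scalar_part p) *\<^sub>C 1))"
    by (metis eq onorm_unit_lmul_Unitization)
  also have "\<dots> \<le> onorm (unit_lmul p) + onorm (unit_lmul ((- scalar_part p) *\<^sub>C (1::'a unitization)))"
    unfolding unit_lmul_add by (intro onorm_triangle bounded_linear_unit_lmul)
  also have "\<dots> \<le> norm p + norm p"
    using one by (simp add: norm_unitization_def)
  finally show ?thesis by simp
qed

lemma norm_unitization_le:
  "norm (p :: 'a unitization) \<le> norm (alg_part p) + cmod (scalar_part p)"
proof -
  have "norm (unit_lmul p x) \<le> (norm (alg_part p) + cmod (scalar_part p)) * norm x" for x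
    unfolding unit_lmul_def distrib_right
    by (intro order_trans[OF norm_triangle_ineq] add_mono norm_mult_ineq) (simp add: norm_scaleC)
  then have "onorm (unit_lmul p) \<le> norm (alg_part p) + cmod (scalar_part p)"
    by (intro onorm_bound) auto
  then show ?thesis by (simp add: norm_unitization_def)
qed

lemma norm_unitization_scaleC: "norm (c *\<^sub>C p) = cmod c * norm (p :: 'a unitization)"
  by (simp add: norm_unitization_def onorm_unit_lmul_scaleC max_mult_distrib_left)
    (simp add: scaleC_unitization_def norm_mult)

instance
proof
  fix p q :: "'a unitization" and r :: real
  show "dist p q = norm (p - q)" by (rule dist_unitization_def)
  show "sgn p = p /\<^sub>R norm p" by (rule sgn_unitization_def)
  show "uniformity = (INF e\<in>{0<..}. principal {(x :: 'a unitization, y). dist x y < e})"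
    by (rule uniformity_unitization_def)
  show "open U \<longleftrightarrow> (\<forall>x\<in>U. eventually (\<lambda>(x', y). x' = x \<longrightarrow> y \<in> U) uniformity)"
    for U :: "'a unitization set"
    by (rule open_unitization_def)
  show "norm p = 0 \<longleftrightarrow> p = 0"
  proof
    assume p: "norm p = 0"
    then have "cmod (scalar_part p) \<le> 0"
      unfolding norm_unitization_def by linarith
    then have "alg_part p = 0" "scalar_part p = 0"
      using norm_alg_part_le[of p] p by simp_all
    then show "p = 0" by (simp add: unitization_ops unitization.expand)
  next
    assume "p = 0"
    then show "norm p = 0"
      using onorm_unit_lmul_Unitization[of "0::'a"]
      by (simp add: norm_unitization_def zero_unitization_def)
  qed
  show "norm (p + q) \<le> norm p + norm q"
  proof -
    have "onorm (unit_lmul (p + q)) \<le> onorm (unit_lmul p) + onorm (unit_lmul q)"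
      unfolding unit_lmul_add by (intro onorm_triangle bounded_linear_unit_lmul)
    moreover have "cmod (scalar_part (p + q)) \<le> cmod (scalar_part p) + cmod (scalar_part q)"
      by (simp add: plus_unitization_def norm_triangle_ineq)
    ultimately show ?thesis unfolding norm_unitization_def by linarith
  qed
  show "norm (r *\<^sub>R p) = \<bar>r\<bar> * norm p"
    by (simp add: scaleR_unitization_def norm_unitization_scaleC)
  show "norm (p * q) \<le> norm p * norm q"
  proof -
    have "cmod (scalar_part (p * q)) = cmod (scalar_part p) * cmod (scalar_part q)"
      by (simp add: times_unitization_def norm_mult)
    also have "\<dots> \<le> norm p * norm q"
      by (intro mult_mono) (auto simp: norm_unitization_def le_max_iff_disj)
    finally have "cmod (scalar_part (p * q)) \<le> norm p * norm q" .
    moreover have "onorm (unit_lmul p) * onorm (unit_lmul q) \<le> norm p * norm q"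
      by (intro mult_mono) (auto simp: norm_unitization_def le_max_iff_disj onorm_unit_lmul_nonneg)
    ultimately show ?thesis
      using onorm_unit_lmul_mult[of p q] by (simp add: norm_unitization_def[of "p * q"])
  qed
qed

end

instance unitization :: (cstar_algebra) cstar_algebra
proof
  fix p :: "'a unitization" and c :: complex
  show "norm (c *\<^sub>C p) = cmod c * norm p" by (rule norm_unitization_scaleC)
  show "norm (star p * p) = (norm p)\<^sup>2"
  proof -
    have le: "onorm (unit_lmul p) \<le> onorm (unit_lmul (star p))" for p :: "'a unitization"
    proof (cases "onorm (unit_lmul p) = 0")
      case False
      with onorm_unit_lmul_nonneg[of p] have "onorm (unit_lmul p) > 0" by simp
      moreover have "(onorm (unit_lmul p))\<^sup>2 \<le> onorm (unit_lmul (star p)) * onorm (unit_lmul p)"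
        using onorm_unit_lmul_star[of p] onorm_unit_lmul_mult[of "star p" p] by linarith
      ultimately show ?thesis by (simp add: power2_eq_square)
    qed (simp add: onorm_unit_lmul_nonneg)
    have "onorm (unit_lmul (star p)) = onorm (unit_lmul p)"
      using le[of p] le[of "star p"] by simp
    then have 1: "onorm (unit_lmul (star p * p)) = (onorm (unit_lmul p))\<^sup>2"
      using onorm_unit_lmul_star[of p] onorm_unit_lmul_mult[of "star p" p] by (simp add: power2_eq_square)
    have 2: "cmod (scalar_part (star p * p)) = (cmod (scalar_part p))\<^sup>2"
      by (simp add: unitization_ops norm_mult power2_eq_square)
    show ?thesis
      unfolding norm_unitization_def 1 2
      using onorm_unit_lmul_nonneg[of p] by (auto simp: max_def power_mono not_le intro: antisym)
  qed
next
  fix X :: "nat \<Rightarrow> 'a unitization"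
  assume X: "Cauchy X"
  have d: "norm (alg_part p - alg_part q) \<le> 2 * norm (p - q)"
    "norm (scalar_part p - scalar_part q) \<le> norm (p - q)" for p q :: "'a unitization"
    using norm_alg_part_le[of "p - q"]
    by (simp_all add: minus_unitization_def norm_unitization_def)
  have "Cauchy (\<lambda>n. alg_part (X n))"
  proof (rule CauchyI)
    fix e :: real assume "e > 0"
    then obtain M where "\<forall>m\<ge>M. \<forall>n\<ge>M. norm (X m - X n) < e / 2"
      using CauchyD[OF X, of "e / 2"] by auto
    then have "\<forall>m\<ge>M. \<forall>n\<ge>M. norm (alg_part (X m) - alg_part (X n)) < e"
      using d(1) by (smt (verit) field_sum_of_halves)
    then show "\<exists>M. \<forall>m\<ge>M. \<forall>n\<ge>M. norm (alg_part (X m) - alg_part (X n)) < e" by blast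
  qed
  then obtain b where b: "(\<lambda>n. alg_part (X n)) \<longlonglongrightarrow> b"
    using Cauchy_convergent convergentD by blast
  have "Cauchy (\<lambda>n. scalar_part (X n))"
  proof (rule CauchyI)
    fix e :: real assume "e > 0"
    then show "\<exists>M. \<forall>m\<ge>M. \<forall>n\<ge>M. norm (scalar_part (X m) - scalar_part (X n)) < e"
      using CauchyD[OF X] d(2) by (meson order_le_less_trans)
  qed
  then obtain z where z: "(\<lambda>n. scalar_part (X n)) \<longlonglongrightarrow> z"
    using Cauchy_convergent convergentD by blast
  have "(\<lambda>n. norm (alg_part (X n) - b) + norm (scalar_part (X n) - z)) \<longlonglongrightarrow> 0"
    using tendsto_add[OF tendsto_norm_zero[OF LIM_zero[OF b]] tendsto_norm_zero[OF LIM_zero[OF z]]]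
    by simp
  then have "(\<lambda>n. norm (X n - Unitization b z)) \<longlonglongrightarrow> 0"
    by (rule Lim_null_comparison[rotated])
      (use norm_unitization_le[of "X _ - Unitization b z"] in
        \<open>simp add: minus_unitization_def\<close>)
  then show "convergent X"
    by (auto simp: convergent_def intro: LIM_zero_cancel tendsto_norm_zero_cancel)
qed

definition unit_emb :: "'a::cstar_algebra \<Rightarrow> 'a unitization" where
  "unit_emb b = Unitization b 0"

text \<open>The unital extension of a map of the algebra to its forced unitisation.\<close>

definition unit_ext :: "('a \<Rightarrow> 'a) \<Rightarrow> 'a unitization \<Rightarrow> 'a unitization" where
  "unit_ext f p = Unitization (f (alg_part p)) (scalar_part p)"

definition unitary_group_one_plus :: "'a::cstar_algebra unitization set" where
  "unitary_group_one_plus = {w. unitary w \<and> w - 1 \<in> range unit_emb}"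


section \<open>The compact operators on a separable infinite-dimensional Hilbert space\<close>

typedef ell2 = "{f :: nat \<Rightarrow> complex. summable (\<lambda>n. (cmod (f n))\<^sup>2)}"
  by (rule exI[of _ "\<lambda>_. 0"]) simp

definition ell2_nth :: "ell2 \<Rightarrow> nat \<Rightarrow> complex" where
  "ell2_nth = Rep_ell2"

lemma ell2_summable: "summable (\<lambda>n. (cmod (ell2_nth x n))\<^sup>2)"
  using Rep_ell2[of x] by (simp add: ell2_nth_def)

lemma ell2_nth_Abs: "summable (\<lambda>n. (cmod (f n))\<^sup>2) \<Longrightarrow> ell2_nth (Abs_ell2 f) = f"
  by (simp add: ell2_nth_def Abs_ell2_inverse)

lemma ell2_eqI: "(\<And>n. ell2_nth x n = ell2_nth y n) \<Longrightarrow> x = y"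
  by (metis Rep_ell2_inject ell2_nth_def ext)

lemma summable_ell2_add:
  assumes "summable (\<lambda>n. (cmod (f n))\<^sup>2)" "summable (\<lambda>n. (cmod (g n))\<^sup>2)"
  shows "summable (\<lambda>n. (cmod (f n + g n))\<^sup>2)"
proof (rule summable_comparison_test')
  show "summable (\<lambda>n. 2 * (cmod (f n))\<^sup>2 + 2 * (cmod (g n))\<^sup>2)"
    by (intro summable_add summable_mult assms)
  fix n :: nat assume "n \<ge> 0"
  have "(cmod (f n + g n))\<^sup>2 \<le> (cmod (f n) + cmod (g n))\<^sup>2"
    by (intro power_mono norm_triangle_ineq) simp
  also have "\<dots> \<le> 2 * (cmod (f n))\<^sup>2 + 2 * (cmod (g n))\<^sup>2"
    using sum_squares_bound[of "cmod (f n)" "cmod (g n)"] by (simp add: power2_sum)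
  finally show "norm ((cmod (f n + g n))\<^sup>2) \<le> 2 * (cmod (f n))\<^sup>2 + 2 * (cmod (g n))\<^sup>2"
    by simp
qed

lemma summable_ell2_scale:
  "summable (\<lambda>n. (cmod (f n))\<^sup>2) \<Longrightarrow> summable (\<lambda>n. (cmod (c * f n))\<^sup>2)"
  by (simp add: norm_mult power_mult_distrib summable_mult)

lemma summable_ell2_inner: "summable (\<lambda>n. Re (cnj (ell2_nth x n) * ell2_nth y n))"
proof (rule summable_comparison_test')
  show "summable (\<lambda>n. (cmod (ell2_nth x n))\<^sup>2 + (cmod (ell2_nth y n))\<^sup>2)"
    by (intro summable_add ell2_summable)
  fix n :: nat assume "n \<ge> 0"
  have "\<bar>Re (cnj (ell2_nth x n) * ell2_nth y n)\<bar> \<le> cmod (ell2_nth x n) * cmod (ell2_nth y n)"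
    by (metis abs_Re_le_cmod complex_mod_cnj norm_mult)
  also have "\<dots> \<le> (cmod (ell2_nth x n))\<^sup>2 + (cmod (ell2_nth y n))\<^sup>2"
  proof -
    have "a * b \<le> a\<^sup>2 + b\<^sup>2" if "a \<ge> 0" "b \<ge> 0" for a b :: real
      using sum_squares_bound[of a b] mult_nonneg_nonneg[OF that] by simp
    then show ?thesis by simp
  qed
  finally show "norm (Re (cnj (ell2_nth x n) * ell2_nth y n))
      \<le> (cmod (ell2_nth x n))\<^sup>2 + (cmod (ell2_nth y n))\<^sup>2"
    by simp
qed

instantiation ell2 :: complex_vector
begin

definition zero_ell2_def: "0 = Abs_ell2 (\<lambda>n. 0)"
definition scaleC_ell2_def: "c *\<^sub>C x = Abs_ell2 (\<lambda>n. c * ell2_nth x n)"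
definition scaleR_ell2_def: "r *\<^sub>R (x::ell2) = complex_of_real r *\<^sub>C x"
definition plus_ell2_def: "x + y = Abs_ell2 (\<lambda>n. ell2_nth x n + ell2_nth y n)"
definition uminus_ell2_def: "- x = Abs_ell2 (\<lambda>n. - ell2_nth x n)"
definition minus_ell2_def: "(x::ell2) - y = x + (- y)"

lemma ell2_nth_ops [simp]:
  "ell2_nth 0 n = 0"
  "ell2_nth (c *\<^sub>C x) n = c * ell2_nth x n"
  "ell2_nth (r *\<^sub>R x) n = complex_of_real r * ell2_nth x n"
  "ell2_nth (x + y) n = ell2_nth x n + ell2_nth y n"
  "ell2_nth (- x) n = - ell2_nth x n"
  "ell2_nth (x - y) n = ell2_nth x n - ell2_nth y n"
proof -
  show add: "ell2_nth (x + y) n = ell2_nth x n + ell2_nth y n" for x y n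
    by (simp add: plus_ell2_def ell2_nth_Abs summable_ell2_add ell2_summable)
  show minus: "ell2_nth (- x) n = - ell2_nth x n" for x n
    by (simp add: uminus_ell2_def ell2_nth_Abs ell2_summable)
  show "ell2_nth (x - y) n = ell2_nth x n - ell2_nth y n"
    unfolding minus_ell2_def by (simp add: add minus)
  show scale: "ell2_nth (c *\<^sub>C x) n = c * ell2_nth x n" for c x n
    unfolding scaleC_ell2_def
    by (subst ell2_nth_Abs[OF summable_ell2_scale[OF ell2_summable]]) (rule refl)
  show "ell2_nth (r *\<^sub>R x) n = complex_of_real r * ell2_nth x n"
    unfolding scaleR_ell2_def by (rule scale)
qed (simp add: zero_ell2_def ell2_nth_Abs)

instance
  by standard (rule ell2_eqI; simp add: algebra_simps; fail)+

end

text \<open>The norm comes from the complex inner product, conjugate-linear in the first variable;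
  the class \<^class>\<open>real_inner\<close> asks for its real part.\<close>

instantiation ell2 :: real_inner
begin

definition inner_ell2_def: "inner x y = (\<Sum>n. Re (cnj (ell2_nth x n) * ell2_nth y n))"
definition norm_ell2_def: "norm (x::ell2) = sqrt (inner x x)"
definition sgn_ell2_def: "sgn (x::ell2) = x /\<^sub>R norm x"
definition dist_ell2_def: "dist (x::ell2) y = norm (x - y)"
definition uniformity_ell2_def [code del]:
  "uniformity = (INF e\<in>{0<..}. principal {(x :: ell2, y). dist x y < e})"
definition open_ell2_def [code del]:
  "open (U :: ell2 set) \<longleftrightarrow> (\<forall>x\<in>U. eventually (\<lambda>(x', y). x' = x \<longrightarrow> y \<in> U) uniformity)"

lemma inner_ell2_self: "inner x x = (\<Sum>n. (cmod (ell2_nth x n))\<^sup>2)"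
  by (simp add: inner_ell2_def cmod_power2) (simp add: power2_eq_square)

instance
proof
  fix x y z :: ell2 and r :: real
  show "dist x y = norm (x - y)" by (rule dist_ell2_def)
  show "sgn x = x /\<^sub>R norm x" by (rule sgn_ell2_def)
  show "uniformity = (INF e\<in>{0<..}. principal {(x :: ell2, y). dist x y < e})"
    by (rule uniformity_ell2_def)
  show "open U \<longleftrightarrow> (\<forall>x\<in>U. eventually (\<lambda>(x', y). x' = x \<longrightarrow> y \<in> U) uniformity)"
    for U :: "ell2 set"
    by (rule open_ell2_def)
  show "norm x = sqrt (inner x x)" by (rule norm_ell2_def)
  show "inner x y = inner y x"
    by (simp add: inner_ell2_def mult.commute)
  show "inner (x + y) z = inner x z + inner y z"
    using suminf_add[OF summable_ell2_inner[of x z] summable_ell2_inner[of y z]]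
    by (simp add: inner_ell2_def algebra_simps)
  show "inner (r *\<^sub>R x) y = r * inner x y"
    using suminf_mult[OF summable_ell2_inner[of x y], of r]
    by (simp add: inner_ell2_def algebra_simps)
  show "0 \<le> inner x x"
    unfolding inner_ell2_self by (intro suminf_nonneg ell2_summable) simp
  show "inner x x = 0 \<longleftrightarrow> x = 0"
    unfolding inner_ell2_self by (subst suminf_eq_zero_iff[OF ell2_summable]) (auto intro: ell2_eqI)
qed

end

lemma norm_ell2_sq: "(norm x)\<^sup>2 = (\<Sum>n. (cmod (ell2_nth x n))\<^sup>2)"
  by (simp add: power2_norm_eq_inner inner_ell2_self)

lemma norm_ell2_partial: "(\<Sum>n<N. (cmod (ell2_nth x n))\<^sup>2) \<le> (norm x)\<^sup>2"
  unfolding norm_ell2_sq by (intro sum_le_suminf ell2_summable) auto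

lemma norm_ell2_nth: "cmod (ell2_nth x n) \<le> norm x"
proof (rule power2_le_imp_le)
  have "(cmod (ell2_nth x n))\<^sup>2 \<le> (\<Sum>k<Suc n. (cmod (ell2_nth x k))\<^sup>2)"
    by (simp add: sum_nonneg)
  then show "(cmod (ell2_nth x n))\<^sup>2 \<le> (norm x)\<^sup>2"
    using norm_ell2_partial order_trans by blast
qed simp

lemma inner_ell2_scaleC: "inner (c *\<^sub>C x) y = inner x (cnj c *\<^sub>C (y::ell2))"
  by (simp add: inner_ell2_def algebra_simps)

lemma norm_ell2_scaleC: "norm (c *\<^sub>C x) = cmod c * norm (x::ell2)"
proof -
  have "(norm (c *\<^sub>C x))\<^sup>2 = (cmod c * norm x)\<^sup>2"
    using suminf_mult[OF ell2_summable[of x], of "(cmod c)\<^sup>2"]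
    by (simp add: norm_ell2_sq norm_mult power_mult_distrib)
  then show ?thesis by (simp add: power2_eq_iff_nonneg)
qed

instance ell2 :: banach
proof
  fix X :: "nat \<Rightarrow> ell2"
  assume X: "Cauchy X"
  have "Cauchy (\<lambda>n. ell2_nth (X n) k)" for k
  proof (rule CauchyI)
    fix e :: real assume "e > 0"
    then obtain M where "\<forall>m\<ge>M. \<forall>n\<ge>M. norm (X m - X n) < e"
      using CauchyD[OF X] by blast
    then have "\<forall>m\<ge>M. \<forall>n\<ge>M. norm (ell2_nth (X m) k - ell2_nth (X n) k) < e"
      using norm_ell2_nth by (metis ell2_nth_ops(6) order_le_less_trans)
    then show "\<exists>M. \<forall>m\<ge>M. \<forall>n\<ge>M. norm (ell2_nth (X m) k - ell2_nth (X n) k) < e" by blast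
  qed
  then have "\<exists>l. (\<lambda>n. ell2_nth (X n) k) \<longlonglongrightarrow> l" for k
    using Cauchy_convergent convergentD by blast
  then obtain f where f: "\<And>k. (\<lambda>n. ell2_nth (X n) k) \<longlonglongrightarrow> f k" by metis
  have key: "\<exists>M. \<forall>n\<ge>M. \<forall>N. (\<Sum>k<N. (cmod (ell2_nth (X n) k - f k))\<^sup>2) \<le> e\<^sup>2"
    if e: "e > 0" for e :: real
  proof -
    obtain M where M: "\<forall>m\<ge>M. \<forall>n\<ge>M. norm (X m - X n) < e"
      using CauchyD[OF X e] by blast
    have "(\<Sum>k<N. (cmod (ell2_nth (X n) k - f k))\<^sup>2) \<le> e\<^sup>2" if n: "n \<ge> M" for n N
    proof (rule tendsto_upperbound)
      show "(\<lambda>m. \<Sum>k<N. (cmod (ell2_nth (X n) k - ell2_nth (X m) k))\<^sup>2)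
          \<longlonglongrightarrow> (\<Sum>k<N. (cmod (ell2_nth (X n) k - f k))\<^sup>2)"
        by (intro tendsto_intros f)
      have "(\<Sum>k<N. (cmod (ell2_nth (X n) k - ell2_nth (X m) k))\<^sup>2) \<le> e\<^sup>2" if "m \<ge> M" for m
      proof -
        have "(\<Sum>k<N. (cmod (ell2_nth (X n) k - ell2_nth (X m) k))\<^sup>2) \<le> (norm (X n - X m))\<^sup>2"
          using norm_ell2_partial[of "X n - X m" N] by simp
        also have "\<dots> \<le> e\<^sup>2"
          using M n that by (intro power_mono) (auto intro: less_imp_le)
        finally show ?thesis .
      qed
      then show "\<forall>\<^sub>F m in sequentially. (\<Sum>k<N. (cmod (ell2_nth (X n) k - ell2_nth (X m) k))\<^sup>2) \<le> e\<^sup>2"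
        using eventually_sequentially by blast
    qed simp
    then show ?thesis by blast
  qed
  have diff: "summable (\<lambda>k. (cmod (ell2_nth (X n) k - f k))\<^sup>2)"
    if "\<forall>N. (\<Sum>k<N. (cmod (ell2_nth (X n) k - f k))\<^sup>2) \<le> e\<^sup>2" for n and e :: real
    by (rule summableI_nonneg_bounded[where x = "e\<^sup>2"]) (use that in auto)
  obtain M where "\<forall>n\<ge>M. \<forall>N. (\<Sum>k<N. (cmod (ell2_nth (X n) k - f k))\<^sup>2) \<le> 1\<^sup>2"
    using key[of 1] by auto
  then have "summable (\<lambda>k. (cmod (ell2_nth (X M) k - f k))\<^sup>2)"
    by (intro diff[where e = 1]) blast
  from summable_ell2_add[OF summable_ell2_scale[OF this, of "-1"] ell2_summable[of "X M"]]
  have "summable (\<lambda>k. (cmod (f k))\<^sup>2)" by simp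
  then have l: "ell2_nth (Abs_ell2 f) = f" by (rule ell2_nth_Abs)
  have "X \<longlonglongrightarrow> Abs_ell2 f"
  proof (rule LIMSEQ_I)
    fix e :: real assume e: "e > 0"
    then obtain M where M: "\<forall>n\<ge>M. \<forall>N. (\<Sum>k<N. (cmod (ell2_nth (X n) k - f k))\<^sup>2) \<le> (e/2)\<^sup>2"
      using key[of "e / 2"] by auto
    have "norm (X n - Abs_ell2 f) < e" if "n \<ge> M" for n
    proof -
      have "(norm (X n - Abs_ell2 f))\<^sup>2 \<le> (e/2)\<^sup>2"
        unfolding norm_ell2_sq
        by (rule suminf_le_const[OF ell2_summable]) (use M that in \<open>simp add: l\<close>)
      then have "norm (X n - Abs_ell2 f) \<le> e/2"
        by (rule power2_le_imp_le) (use e in simp)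
      then show ?thesis using e by simp
    qed
    then show "\<exists>M. \<forall>n\<ge>M. norm (X n - Abs_ell2 f) < e" by blast
  qed
  then show "convergent X" by (rule convergentI)
qed

lemma riesz_representation:
  fixes f :: "'a::{real_inner, complete_space} \<Rightarrow> real"
  assumes "bounded_linear f"
  shows "\<exists>y. \<forall>x. f x = inner x y"
proof -
  interpret f: bounded_linear f by fact
  define J where "J x = (norm x)\<^sup>2 - 2 * f x" for x
  have bdd: "bdd_below (range J)"
  proof (rule bdd_belowI2)
    fix x
    have "f x \<le> onorm f * norm x"
      using onorm[OF assms, of x] by simp
    moreover have "0 \<le> (norm x - onorm f)\<^sup>2" by simp
    ultimately show "- (onorm f)\<^sup>2 \<le> J x"
      unfolding J_def power2_diff by (simp add: mult.commute)
  qed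
  define I where "I = Inf (range J)"
  have I_le: "I \<le> J x" for x
    unfolding I_def by (intro cInf_lower bdd) auto
  have "\<exists>x. J x < I + e" if "e > 0" for e
    using cInf_lessD[of "range J" "I + e"] that unfolding I_def by auto
  then have "\<exists>x. J x < I + 1 / (real n + 1)" for n :: nat by simp
  then obtain X where X: "\<And>n. J (X n) < I + 1 / (real n + 1)" by metis
  have par: "(norm (x - y))\<^sup>2 \<le> 2 * (J x - I) + 2 * (J y - I)" for x y
  proof -
    have "(norm (x - y))\<^sup>2 = 2 * J x + 2 * J y - 4 * J ((1/2) *\<^sub>R (x + y))"
      unfolding J_def power2_norm_eq_inner f.add f.scaleR inner_simps
      using inner_commute[of x y] by (simp add: field_simps)
    moreover have "4 * I \<le> 4 * J ((1/2) *\<^sub>R (x + y))"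
      using I_le by simp
    ultimately show ?thesis by argo
  qed
  have "Cauchy X"
  proof (rule CauchyI)
    fix e :: real assume e: "e > 0"
    obtain M :: nat where M: "4 / e\<^sup>2 < real M" using reals_Archimedean2 by blast
    have "norm (X m - X n) < e" if "m \<ge> M" "n \<ge> M" for m n
    proof (rule power2_less_imp_less)
      have small: "1 / (real k + 1) < e\<^sup>2 / 4" if "k \<ge> M" for k
      proof -
        have "4 / e\<^sup>2 < real k + 1" using M that by linarith
        then show ?thesis using e by (simp add: field_simps)
      qed
      show "(norm (X m - X n))\<^sup>2 < e\<^sup>2"
        using par[of "X m" "X n"] X[of m] X[of n] small[OF that(1)] small[OF that(2)] by argo
    qed (use e in simp)
    then show "\<exists>M. \<forall>m\<ge>M. \<forall>n\<ge>M. norm (X m - X n) < e" by blast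
  qed
  then obtain y where y: "X \<longlonglongrightarrow> y"
    using Cauchy_convergent convergentD by blast
  have "(\<lambda>n. J (X n)) \<longlonglongrightarrow> J y"
    unfolding J_def by (intro tendsto_intros y f.tendsto)
  moreover have "(\<lambda>n. I + 1 / (real n + 1)) \<longlonglongrightarrow> I + 0"
    by (intro tendsto_add tendsto_const) (use LIMSEQ_inverse_real_of_nat in \<open>simp add: inverse_eq_divide add.commute\<close>)
  ultimately have "J y \<le> I + 0"
    by (rule LIMSEQ_le) (use X less_imp_le in blast)
  then have min: "J y \<le> J x" for x using I_le[of x] by simp
  have "f x = inner x y" for x
  proof (cases "x = 0")
    case False
    define d where "d = f x - inner x y"
    define t where "t = d / (norm x)\<^sup>2"
    have n: "(norm x)\<^sup>2 > 0" using False by simp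
    have "J (y + t *\<^sub>R x) = J y + t\<^sup>2 * (norm x)\<^sup>2 - 2 * t * d"
      unfolding J_def d_def power2_norm_eq_inner f.add f.scaleR inner_simps
      using inner_commute[of x y] by (simp add: power2_eq_square algebra_simps)
    also have "\<dots> = J y - d\<^sup>2 / (norm x)\<^sup>2"
      unfolding t_def using n by (simp add: power2_eq_square field_simps)
    finally have "d\<^sup>2 / (norm x)\<^sup>2 \<le> 0" using min[of "y + t *\<^sub>R x"] by simp
    then have "d = 0" using n by (simp add: divide_le_0_iff)
    then show ?thesis by (simp add: d_def)
  qed simp
  then show ?thesis by blast
qed

text \<open>Adjoints may be taken for the real part of the inner product, since the operators are
  complex-linear.\<close>

lemma ex_adjoint:
  fixes T :: "'a::{real_inner, complete_space} \<Rightarrow>\<^sub>L 'b::real_inner"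
  shows "\<exists>S. \<forall>x y. inner (T x) y = inner x (blinfun_apply S y)"
proof -
  have "\<exists>z. \<forall>x. inner (T x) y = inner x z" for y
    by (intro riesz_representation bounded_linear_compose[OF bounded_linear_inner_left]
      blinfun.bounded_linear_right)
  then obtain s where s: "\<And>x y. inner (T x) y = inner x (s y)" by metis
  have "bounded_linear s"
  proof (rule bounded_linear_intro[where K = "norm T"])
    show "s (x + y) = s x + s y" for x y
      by (metis (no_types) s inner_add_right vector_eq_ldot)
    show "s (r *\<^sub>R x) = r *\<^sub>R s x" for r x
      by (metis (no_types) s inner_scaleR_right vector_eq_ldot)
    show "norm (s y) \<le> norm y * norm T" for y
    proof (cases "s y = 0")
      case False
      have "norm (s y) * norm (s y) = inner (T (s y)) y"
        by (simp add: s power2_norm_eq_inner flip: power2_eq_square)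
      also have "\<dots> \<le> norm T * norm (s y) * norm y"
        by (intro order_trans[OF norm_cauchy_schwarz] mult_right_mono norm_blinfun) simp
      finally show ?thesis using False by (simp add: mult.commute mult.left_commute)
    qed simp
  qed
  then show ?thesis using s by (intro exI[of _ "Blinfun s"]) (simp add: bounded_linear_Blinfun_apply)
qed

definition ell2_adjoint :: "(ell2 \<Rightarrow>\<^sub>L ell2) \<Rightarrow> (ell2 \<Rightarrow>\<^sub>L ell2)" where
  "ell2_adjoint T = (SOME S. \<forall>x y. inner (T x) y = inner x (blinfun_apply S y))"

lemma ell2_adjoint: "inner (blinfun_apply T x) y = inner x (ell2_adjoint T y)"
  using someI_ex[OF ex_adjoint[of T]] unfolding ell2_adjoint_def by blast

lemma ell2_adjoint_eqI:
  assumes "\<And>x y. inner (blinfun_apply T x) y = inner x (blinfun_apply S y)"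
  shows "ell2_adjoint T = S"
  by (intro blinfun_eqI) (metis (no_types) assms ell2_adjoint vector_eq_ldot)

lemma compact_closure_iff:
  fixes S :: "'a::{real_normed_vector, complete_space} set"
  shows "compact (closure S) \<longleftrightarrow> (\<forall>e>0. \<exists>F. finite F \<and> (\<forall>x\<in>S. \<exists>y\<in>F. dist x y < e))"
    (is "_ \<longleftrightarrow> ?tb")
proof
  assume "compact (closure S)"
  then have "\<forall>e>0. \<exists>F. finite F \<and> closure S \<subseteq> (\<Union>x\<in>F. ball x e)"
    by (simp add: compact_eq_totally_bounded)
  then show ?tb
    using closure_subset[of S] by (fastforce simp: dist_commute)
next
  assume tb: ?tb
  have "\<exists>F. finite F \<and> closure S \<subseteq> (\<Union>x\<in>F. ball x e)" if e: "e > 0" for e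
  proof -
    obtain F where F: "finite F" "\<forall>x\<in>S. \<exists>y\<in>F. dist x y < e / 2"
      using tb e by (meson half_gt_zero)
    have "S \<subseteq> (\<Union>x\<in>F. cball x (e / 2))"
    proof
      fix x assume "x \<in> S"
      then obtain y where "y \<in> F" "dist x y < e / 2" using F(2) by blast
      then show "x \<in> (\<Union>x\<in>F. cball x (e / 2))"
        by (intro UN_I[of y]) (simp_all add: dist_commute)
    qed
    then have "closure S \<subseteq> (\<Union>x\<in>F. cball x (e / 2))"
      using F(1) by (intro closure_minimal closed_UN) auto
    also have "\<dots> \<subseteq> (\<Union>x\<in>F. ball x e)"
      using e by (intro UN_mono) auto
    finally show ?thesis using F(1) by blast
  qed
  then show "compact (closure S)"
    by (auto simp: compact_eq_totally_bounded complete_eq_closed)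
qed

definition is_compact_op :: "(ell2 \<Rightarrow>\<^sub>L ell2) \<Rightarrow> bool" where
  "is_compact_op T \<longleftrightarrow> clinear (blinfun_apply T) \<and> compact (closure (blinfun_apply T ` ball 0 1))"

lemma is_compact_op_iff:
  "is_compact_op T \<longleftrightarrow> clinear (blinfun_apply T)
     \<and> (\<forall>e>0. \<exists>F. finite F \<and> (\<forall>x. norm x < 1 \<longrightarrow> (\<exists>y\<in>F. dist (blinfun_apply T x) y < e)))"
proof -
  have im: "(\<forall>y\<in>blinfun_apply T ` ball 0 1. P y) \<longleftrightarrow> (\<forall>x. norm x < 1 \<longrightarrow> P (blinfun_apply T x))" for P
    by auto
  then show ?thesis by (simp only: is_compact_op_def compact_closure_iff im)
qed

lemma is_compact_op_zero: "is_compact_op 0"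
  by (auto simp: is_compact_op_iff clinear_def intro!: exI[of _ "{0}"])

lemma is_compact_op_add:
  assumes "is_compact_op S" "is_compact_op T"
  shows "is_compact_op (S + T)"
  unfolding is_compact_op_iff
proof (intro conjI allI impI)
  show "clinear (blinfun_apply (S + T))"
    using assms by (auto simp: is_compact_op_def clinear_def blinfun.add_left scaleC_add_right)
  fix e :: real assume "e > 0"
  then have "e / 2 > 0" by simp
  then obtain F G where F: "finite F" "\<And>x. norm x < 1 \<Longrightarrow> \<exists>y\<in>F. dist (blinfun_apply S x) y < e / 2"
    and G: "finite G" "\<And>x. norm x < 1 \<Longrightarrow> \<exists>y\<in>G. dist (blinfun_apply T x) y < e / 2"
    using assms unfolding is_compact_op_iff by meson
  show "\<exists>F. finite F \<and> (\<forall>x. norm x < 1 \<longrightarrow> (\<exists>y\<in>F. dist (blinfun_apply (S + T) x) y < e))"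
  proof (intro exI[of _ "(\<lambda>(a, b). a + b) ` (F \<times> G)"] conjI allI impI)
    show "finite ((\<lambda>(a, b). a + b) ` (F \<times> G))" using F(1) G(1) by simp
    fix x :: ell2 assume "norm x < 1"
    then obtain a b where ab: "a \<in> F" "dist (blinfun_apply S x) a < e / 2"
      "b \<in> G" "dist (blinfun_apply T x) b < e / 2"
      using F(2) G(2) by meson
    have "dist (blinfun_apply (S + T) x) (a + b) < e"
      using ab dist_triangle_add[of "blinfun_apply S x" "blinfun_apply T x" a b]
      by (simp add: blinfun.add_left)
    then show "\<exists>y\<in>(\<lambda>(a, b). a + b) ` (F \<times> G). dist (blinfun_apply (S + T) x) y < e"
      using ab by force
  qed
qed

lemma is_compact_op_comp_left:
  assumes "is_compact_op T" and "clinear (blinfun_apply S)"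
  shows "is_compact_op (S o\<^sub>L T)"
  unfolding is_compact_op_iff
proof (intro conjI allI impI)
  show "clinear (blinfun_apply (S o\<^sub>L T))"
    using assms by (auto simp: is_compact_op_def clinear_def)
  fix e :: real assume e: "e > 0"
  define r where "r = norm S + 1"
  have r: "r > 0" unfolding r_def by (smt (verit) norm_ge_zero)
  then obtain F where F: "finite F" "\<And>x. norm x < 1 \<Longrightarrow> \<exists>y\<in>F. dist (blinfun_apply T x) y < e / r"
    using assms e unfolding is_compact_op_iff by (meson divide_pos_pos)
  have "\<exists>y\<in>blinfun_apply S ` F. dist (blinfun_apply (S o\<^sub>L T) x) y < e" if x: "norm x < 1" for x
  proof -
    obtain y where y: "y \<in> F" "dist (blinfun_apply T x) y < e / r" using F(2)[OF x] by blast
    have "dist (blinfun_apply S (blinfun_apply T x)) (blinfun_apply S y)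
        \<le> norm S * dist (blinfun_apply T x) y"
      by (metis blinfun.diff_right dist_norm norm_blinfun)
    also have "\<dots> \<le> r * dist (blinfun_apply T x) y"
      unfolding r_def by (intro mult_right_mono) auto
    also have "\<dots> < e" using y(2) r by (simp add: field_simps)
    finally show ?thesis using y(1) by auto
  qed
  then show "\<exists>F. finite F \<and> (\<forall>x. norm x < 1 \<longrightarrow> (\<exists>y\<in>F. dist (blinfun_apply (S o\<^sub>L T) x) y < e))"
    using F(1) by (intro exI[of _ "blinfun_apply S ` F"]) auto
qed

lemma is_compact_op_comp_right:
  assumes "is_compact_op T" and "clinear (blinfun_apply S)"
  shows "is_compact_op (T o\<^sub>L S)"
  unfolding is_compact_op_iff
proof (intro conjI allI impI)
  show "clinear (blinfun_apply (T o\<^sub>L S))"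
    using assms by (auto simp: is_compact_op_def clinear_def)
  fix e :: real assume e: "e > 0"
  define r where "r = norm S + 1"
  have r: "r > 0" unfolding r_def by (smt (verit) norm_ge_zero)
  then obtain F where F: "finite F" "\<And>x. norm x < 1 \<Longrightarrow> \<exists>y\<in>F. dist (blinfun_apply T x) y < e / r"
    using assms e unfolding is_compact_op_iff by (meson divide_pos_pos)
  have "\<exists>y\<in>(\<lambda>y. r *\<^sub>R y) ` F. dist (blinfun_apply (T o\<^sub>L S) x) y < e" if x: "norm x < 1" for x
  proof -
    have "norm (blinfun_apply S x) \<le> norm S * norm x" by (rule norm_blinfun)
    also have "\<dots> \<le> norm S * 1" using x by (intro mult_left_mono) auto
    finally have "norm (blinfun_apply S x) < r" unfolding r_def by simp
    then have "norm (blinfun_apply S x /\<^sub>R r) < 1" using r by (simp add: field_simps)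
    then obtain y where y: "y \<in> F" "dist (blinfun_apply T (blinfun_apply S x /\<^sub>R r)) y < e / r"
      using F(2) by blast
    have eq: "blinfun_apply T (blinfun_apply S x) = r *\<^sub>R blinfun_apply T (blinfun_apply S x /\<^sub>R r)"
      using r by (simp add: blinfun.scaleR_right)
    have "dist (blinfun_apply T (blinfun_apply S x)) (r *\<^sub>R y)
        = r * dist (blinfun_apply T (blinfun_apply S x /\<^sub>R r)) y"
      unfolding eq using r by (simp add: dist_norm flip: scaleR_diff_right)
    also have "\<dots> < e" using y(2) r by (simp add: field_simps)
    finally show ?thesis using y(1) by auto
  qed
  then show "\<exists>F. finite F \<and> (\<forall>x. norm x < 1 \<longrightarrow> (\<exists>y\<in>F. dist (blinfun_apply (T o\<^sub>L S) x) y < e))"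
    using F(1) by (intro exI[of _ "(\<lambda>y. r *\<^sub>R y) ` F"]) auto
qed

lemma clinear_ell2_adjoint:
  assumes "clinear (blinfun_apply T)"
  shows "clinear (blinfun_apply (ell2_adjoint T))"
proof -
  have "ell2_adjoint T (c *\<^sub>C y) = c *\<^sub>C ell2_adjoint T y" for c y
  proof -
    have "inner x (ell2_adjoint T (c *\<^sub>C y)) = inner x (c *\<^sub>C ell2_adjoint T y)" for x
    proof -
      have "inner x (ell2_adjoint T (c *\<^sub>C y)) = inner (cnj c *\<^sub>C blinfun_apply T x) y"
        by (simp add: ell2_adjoint[symmetric] inner_ell2_scaleC)
      also have "\<dots> = inner (blinfun_apply T (cnj c *\<^sub>C x)) y"
        using assms by (simp add: clinear_def)
      also have "\<dots> = inner x (c *\<^sub>C ell2_adjoint T y)"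
        by (simp add: ell2_adjoint inner_ell2_scaleC)
      finally show ?thesis .
    qed
    then show ?thesis by (metis vector_eq_ldot)
  qed
  then show ?thesis by (simp add: clinear_def blinfun.add_right)
qed

lemma is_compact_op_adjoint:
  assumes T: "is_compact_op T"
  shows "is_compact_op (ell2_adjoint T)"
  unfolding is_compact_op_iff
proof (intro conjI allI impI)
  let ?S = "ell2_adjoint T"
  show lin: "clinear (blinfun_apply ?S)"
    using T by (intro clinear_ell2_adjoint) (simp add: is_compact_op_def)
  fix e :: real assume e: "e > 0"
  have "is_compact_op (T o\<^sub>L ?S)" by (rule is_compact_op_comp_right[OF T lin])
  moreover have "e\<^sup>2 / 4 > 0" using e by simp
  ultimately obtain F where F: "finite F"
    "\<And>x. norm x < 1 \<Longrightarrow> \<exists>y\<in>F. dist (blinfun_apply (T o\<^sub>L ?S) x) y < e\<^sup>2 / 4"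
    unfolding is_compact_op_iff by meson
  define P where "P y x \<longleftrightarrow> norm x < 1 \<and> dist (blinfun_apply (T o\<^sub>L ?S) x) y < e\<^sup>2 / 4" for y x
  define g where "g y = (SOME x. P y x)" for y
  have "\<exists>z\<in>(\<lambda>y. blinfun_apply ?S (g y)) ` F. dist (blinfun_apply ?S x) z < e" if x: "norm x < 1" for x
  proof -
    obtain y where y: "y \<in> F" "P y x" using F(2)[OF x] x by (auto simp: P_def)
    then have g: "P y (g y)" unfolding g_def by (metis someI)
    define d where "d = x - g y"
    have nd: "norm d < 2"
      using norm_triangle_ineq4[of x "g y"] g x by (simp add: P_def d_def)
    have "norm (blinfun_apply (T o\<^sub>L ?S) d) < e\<^sup>2 / 2"
    proof -
      have "norm (blinfun_apply (T o\<^sub>L ?S) d)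
          = dist (blinfun_apply (T o\<^sub>L ?S) x) (blinfun_apply (T o\<^sub>L ?S) (g y))"
        by (simp only: d_def blinfun.diff_right dist_norm)
      also have "\<dots> \<le> dist (blinfun_apply (T o\<^sub>L ?S) x) y + dist (blinfun_apply (T o\<^sub>L ?S) (g y)) y"
        by (rule dist_triangle2)
      also have "\<dots> < e\<^sup>2 / 2"
        using y(2) g unfolding P_def by linarith
      finally show ?thesis .
    qed
    then have "norm (blinfun_apply (T o\<^sub>L ?S) d) * norm d < e\<^sup>2 / 2 * 2"
      using nd by (intro mult_strict_mono) auto
    moreover have "(norm (blinfun_apply ?S d))\<^sup>2 = inner (blinfun_apply (T o\<^sub>L ?S) d) d"
      by (simp add: power2_norm_eq_inner ell2_adjoint)
    ultimately have "(norm (blinfun_apply ?S d))\<^sup>2 < e\<^sup>2"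
      using norm_cauchy_schwarz[of "blinfun_apply (T o\<^sub>L ?S) d" d] by simp
    then have "norm (blinfun_apply ?S d) < e"
      by (rule power2_less_imp_less) (use e in simp)
    then have "dist (blinfun_apply ?S x) (blinfun_apply ?S (g y)) < e"
      by (simp add: d_def blinfun.diff_right dist_norm)
    then show ?thesis using y(1) by blast
  qed
  then show "\<exists>F. finite F \<and> (\<forall>x. norm x < 1 \<longrightarrow> (\<exists>y\<in>F. dist (blinfun_apply ?S x) y < e))"
    using F(1) by (intro exI[of _ "(\<lambda>y. blinfun_apply ?S (g y)) ` F"]) auto
qed

lemma is_compact_op_limit:
  assumes X: "\<And>n. is_compact_op (X n)" and lim: "X \<longlonglongrightarrow> T"
  shows "is_compact_op T"
  unfolding is_compact_op_iff
proof (intro conjI allI impI)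
  have app: "(\<lambda>n. blinfun_apply (X n) x) \<longlonglongrightarrow> blinfun_apply T x" for x
    by (intro blinfun.tendsto lim tendsto_const)
  have lipschitz: "bounded_linear (\<lambda>x::ell2. c *\<^sub>C x)" for c
    by (rule bounded_linear_intro[where K = "cmod c"])
      (simp_all add: scaleC_add_right scaleR_scaleC scaleC_scaleC norm_ell2_scaleC mult.commute)
  have "blinfun_apply T (c *\<^sub>C x) = c *\<^sub>C blinfun_apply T x" for c x
  proof (rule LIMSEQ_unique[OF app])
    have "(\<lambda>n. c *\<^sub>C blinfun_apply (X n) x) \<longlonglongrightarrow> c *\<^sub>C blinfun_apply T x"
      by (intro bounded_linear.tendsto[OF lipschitz] app)
    then show "(\<lambda>n. blinfun_apply (X n) (c *\<^sub>C x)) \<longlonglongrightarrow> c *\<^sub>C blinfun_apply T x"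
      using X by (simp add: is_compact_op_def clinear_def)
  qed
  then show "clinear (blinfun_apply T)"
    by (simp add: clinear_def blinfun.add_right)
  fix e :: real assume e: "e > 0"
  then obtain n where n: "norm (X n - T) < e / 2"
    using LIMSEQ_D[OF lim, of "e / 2"] by auto
  obtain F where F: "finite F" "\<And>x. norm x < 1 \<Longrightarrow> \<exists>y\<in>F. dist (blinfun_apply (X n) x) y < e / 2"
    using X[of n] e unfolding is_compact_op_iff by (meson half_gt_zero)
  have "\<exists>y\<in>F. dist (blinfun_apply T x) y < e" if x: "norm x < 1" for x
  proof -
    obtain y where y: "y \<in> F" "dist (blinfun_apply (X n) x) y < e / 2" using F(2)[OF x] by blast
    have "dist (blinfun_apply (X n) x) (blinfun_apply T x) \<le> norm (X n - T) * norm x"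
      by (metis blinfun.diff_left dist_norm norm_blinfun)
    also have "\<dots> \<le> norm (X n - T) * 1" using x by (intro mult_left_mono) auto
    finally have "dist (blinfun_apply (X n) x) (blinfun_apply T x) < e / 2" using n by simp
    then have "dist (blinfun_apply T x) y < e"
      using y(2) dist_triangle_half_r by metis
    then show ?thesis using y(1) by blast
  qed
  then show "\<exists>F. finite F \<and> (\<forall>x. norm x < 1 \<longrightarrow> (\<exists>y\<in>F. dist (blinfun_apply T x) y < e))"
    using F(1) by blast
qed

lift_definition scaleC_ell2_op :: "complex \<Rightarrow> ell2 \<Rightarrow>\<^sub>L ell2" is "\<lambda>c x. c *\<^sub>C x"
  subgoal for c
    by (rule bounded_linear_intro[where K = "cmod c"])
      (simp_all add: scaleC_add_right scaleR_scaleC scaleC_scaleC norm_ell2_scaleC mult.commute)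
  done

lemma clinear_scaleC_ell2_op: "clinear (blinfun_apply (scaleC_ell2_op c))"
  by (simp add: clinear_def scaleC_ell2_op.rep_eq scaleC_add_right scaleC_scaleC mult.commute)

typedef compact_op = "{T. is_compact_op T}"
  using is_compact_op_zero by blast

setup_lifting type_definition_compact_op

instantiation compact_op :: star_algebra
begin

lift_definition zero_compact_op :: compact_op is 0 by (rule is_compact_op_zero)
lift_definition plus_compact_op :: "compact_op \<Rightarrow> compact_op \<Rightarrow> compact_op" is "(+)"
  by (rule is_compact_op_add)
lift_definition scaleC_compact_op :: "complex \<Rightarrow> compact_op \<Rightarrow> compact_op"
  is "\<lambda>c T. scaleC_ell2_op c o\<^sub>L T"
  by (intro is_compact_op_comp_left clinear_scaleC_ell2_op)
definition scaleR_compact_op_def: "r *\<^sub>R (T::compact_op) = complex_of_real r *\<^sub>C T"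
definition uminus_compact_op_def: "- (T::compact_op) = (-1) *\<^sub>C T"
definition minus_compact_op_def: "(S::compact_op) - T = S + - T"
lift_definition times_compact_op :: "compact_op \<Rightarrow> compact_op \<Rightarrow> compact_op" is "(o\<^sub>L)"
  by (meson is_compact_op_comp_left is_compact_op_def)
lift_definition star_compact_op :: "compact_op \<Rightarrow> compact_op" is ell2_adjoint
  by (rule is_compact_op_adjoint)

instance
proof
  fix S T U :: compact_op and r :: real and c d :: complex
  show "r *\<^sub>R T = complex_of_real r *\<^sub>C T" by (rule scaleR_compact_op_def)
  show "S + T + U = S + (T + U)" "S + T = T + S" "0 + T = T"
    by (transfer, simp add: ac_simps)+
  show "- T + T = 0"
    unfolding uminus_compact_op_def
    by transfer (auto intro!: blinfun_eqI ell2_eqI simp: scaleC_ell2_op.rep_eq blinfun.add_left)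
  show "S - T = S + - T" by (rule minus_compact_op_def)
  show "c *\<^sub>C (S + T) = c *\<^sub>C S + c *\<^sub>C T" "(c + d) *\<^sub>C T = c *\<^sub>C T + d *\<^sub>C T"
    "c *\<^sub>C d *\<^sub>C T = (c * d) *\<^sub>C T" "1 *\<^sub>C T = T"
    by (transfer, auto intro!: blinfun_eqI simp: scaleC_ell2_op.rep_eq blinfun.add_left
      scaleC_add_right scaleC_add_left scaleC_scaleC scaleC_one)+
  show "S * T * U = S * (T * U)" by transfer (auto intro!: blinfun_eqI)
  show "(S + T) * U = S * U + T * U" "S * (T + U) = S * T + S * U"
    by (transfer, auto intro!: blinfun_eqI simp: blinfun.add_left blinfun.add_right)+
  show "(c *\<^sub>C S) * T = c *\<^sub>C (S * T)" by transfer (auto intro!: blinfun_eqI)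
  show "S * (c *\<^sub>C T) = c *\<^sub>C (S * T)"
    by transfer (auto intro!: blinfun_eqI simp: scaleC_ell2_op.rep_eq is_compact_op_def clinear_def)
  show "star (S + T) = star S + star T"
    by transfer (auto intro!: ell2_adjoint_eqI simp: blinfun.add_left blinfun.add_right
      inner_add_left inner_add_right ell2_adjoint)
  show "star (c *\<^sub>C T) = cnj c *\<^sub>C star T"
  proof transfer
    fix c T assume "is_compact_op T"
    then have "clinear (blinfun_apply (ell2_adjoint T))"
      by (intro clinear_ell2_adjoint) (simp add: is_compact_op_def)
    then show "ell2_adjoint (scaleC_ell2_op c o\<^sub>L T) = scaleC_ell2_op (cnj c) o\<^sub>L ell2_adjoint T"
      by (intro ell2_adjoint_eqI)
        (simp add: scaleC_ell2_op.rep_eq inner_ell2_scaleC ell2_adjoint clinear_def)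
  qed
  show "star (S * T) = star T * star S"
    by transfer (auto intro!: ell2_adjoint_eqI simp: ell2_adjoint)
  show "star (star T) = T"
    by transfer (rule ell2_adjoint_eqI, metis ell2_adjoint inner_commute)
qed

end

instantiation compact_op :: real_normed_algebra
begin

lift_definition norm_compact_op :: "compact_op \<Rightarrow> real" is norm .
definition sgn_compact_op_def: "sgn (T::compact_op) = T /\<^sub>R norm T"
definition dist_compact_op_def: "dist (S::compact_op) T = norm (S - T)"
definition uniformity_compact_op_def [code del]:
  "uniformity = (INF e\<in>{0<..}. principal {(x :: compact_op, y). dist x y < e})"
definition open_compact_op_def [code del]:
  "open (U :: compact_op set) \<longleftrightarrow>
     (\<forall>x\<in>U. eventually (\<lambda>(x', y). x' = x \<longrightarrow> y \<in> U) uniformity)"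

lemma Rep_compact_op_scaleR: "Rep_compact_op (r *\<^sub>R T) = r *\<^sub>R Rep_compact_op T"
  unfolding scaleR_compact_op_def scaleC_compact_op.rep_eq
  by (auto intro!: blinfun_eqI simp: scaleC_ell2_op.rep_eq scaleR_scaleC blinfun.scaleR_left)

lemma Rep_compact_op_diff: "Rep_compact_op (S - T) = Rep_compact_op S - Rep_compact_op T"
proof -
  have "S - T = S + (-1) *\<^sub>R T" by simp
  then show ?thesis
    by (simp only: plus_compact_op.rep_eq Rep_compact_op_scaleR) simp
qed

instance
proof
  fix S T :: compact_op and r :: real
  show "dist S T = norm (S - T)" by (rule dist_compact_op_def)
  show "sgn T = T /\<^sub>R norm T" by (rule sgn_compact_op_def)
  show "uniformity = (INF e\<in>{0<..}. principal {(x :: compact_op, y). dist x y < e})"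
    by (rule uniformity_compact_op_def)
  show "open U \<longleftrightarrow> (\<forall>x\<in>U. eventually (\<lambda>(x', y). x' = x \<longrightarrow> y \<in> U) uniformity)"
    for U :: "compact_op set"
    by (rule open_compact_op_def)
  show "norm T = 0 \<longleftrightarrow> T = 0" by transfer simp
  show "norm (S + T) \<le> norm S + norm T" by transfer (rule norm_triangle_ineq)
  show "norm (r *\<^sub>R T) = \<bar>r\<bar> * norm T" by (simp add: norm_compact_op.rep_eq Rep_compact_op_scaleR)
  show "norm (S * T) \<le> norm S * norm T" by transfer (rule norm_blinfun_compose)
qed

end

instance compact_op :: cstar_algebra
proof
  fix T :: compact_op and c :: complex
  have le: "norm (c *\<^sub>C T) \<le> cmod c * norm T" for c and T :: compact_op
  proof transfer
    fix c T
    show "norm (scaleC_ell2_op c o\<^sub>L T) \<le> cmod c * norm T"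
    proof (rule norm_blinfun_bound)
      fix x
      have "norm (blinfun_apply T x) \<le> norm T * norm x" by (rule norm_blinfun)
      then show "norm (blinfun_apply (scaleC_ell2_op c o\<^sub>L T) x) \<le> cmod c * norm T * norm x"
        by (simp add: scaleC_ell2_op.rep_eq norm_ell2_scaleC mult.assoc mult_left_mono)
    qed simp
  qed
  show "norm (c *\<^sub>C T) = cmod c * norm T"
  proof (cases "c = 0")
    case False
    have "norm T = norm (inverse c *\<^sub>C c *\<^sub>C T)" using False by (simp add: scaleC_scaleC scaleC_one)
    also have "\<dots> \<le> cmod (inverse c) * norm (c *\<^sub>C T)" by (rule le)
    finally have "cmod c * norm T \<le> norm (c *\<^sub>C T)"
      using False by (simp add: norm_inverse norm_divide field_simps)
    then show ?thesis using le[of c T] by simp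
  qed simp
  show "norm (star T * T) = (norm T)\<^sup>2"
  proof (rule antisym)
    have sq: "(norm T)\<^sup>2 \<le> norm (star T * T)" for T :: compact_op
    proof transfer
      fix T
      let ?N = "norm (ell2_adjoint T o\<^sub>L T)"
      have "norm T \<le> sqrt ?N"
      proof (rule norm_blinfun_bound)
        fix x
        have "(norm (blinfun_apply T x))\<^sup>2 = inner x (blinfun_apply (ell2_adjoint T o\<^sub>L T) x)"
          by (simp add: power2_norm_eq_inner ell2_adjoint)
        also have "\<dots> \<le> norm x * norm (blinfun_apply (ell2_adjoint T o\<^sub>L T) x)"
          by (rule norm_cauchy_schwarz)
        also have "\<dots> \<le> norm x * (?N * norm x)"
          by (intro mult_left_mono norm_blinfun) simp
        also have "\<dots> = (sqrt ?N * norm x)\<^sup>2"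
          by (simp add: power_mult_distrib power2_eq_square)
        finally show "norm (blinfun_apply T x) \<le> sqrt ?N * norm x"
          by (rule power2_le_imp_le) simp
      qed simp
      then show "(norm T)\<^sup>2 \<le> ?N"
        by (metis norm_ge_zero power_mono real_sqrt_pow2)
    qed
    show "(norm T)\<^sup>2 \<le> norm (star T * T)" by (rule sq)
    have le_star: "norm T \<le> norm (star T)" for T :: compact_op
    proof (cases "norm T = 0")
      case False
      have "norm T * norm T \<le> norm (star T) * norm T"
        using sq[of T] norm_mult_ineq[of "star T" T] by (simp add: power2_eq_square)
      then show ?thesis using False by simp
    qed simp
    have "norm (star T) = norm T"
      using le_star[of T] le_star[of "star T"] by simp
    then show "norm (star T * T) \<le> (norm T)\<^sup>2"
      using norm_mult_ineq[of "star T" T] by (simp add: power2_eq_square)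
  qed
next
  fix X :: "nat \<Rightarrow> compact_op"
  assume X: "Cauchy X"
  have "Cauchy (\<lambda>n. Rep_compact_op (X n))"
    using X unfolding Cauchy_def
    by (simp add: dist_norm norm_compact_op.rep_eq Rep_compact_op_diff)
  then obtain T where T: "(\<lambda>n. Rep_compact_op (X n)) \<longlonglongrightarrow> T"
    using Cauchy_convergent convergentD by blast
  then have "is_compact_op T"
    using Rep_compact_op by (intro is_compact_op_limit[OF _ T]) auto
  then have "Rep_compact_op (Abs_compact_op T) = T"
    by (simp add: Abs_compact_op_inverse)
  then have "X \<longlonglongrightarrow> Abs_compact_op T"
    using T by (simp add: LIMSEQ_iff norm_compact_op.rep_eq Rep_compact_op_diff)
  then show "convergent X" by (rule convergentI)
qed


section \<open>Stability and almost stable rank one\<close>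

text \<open>\<open>cstar_tensor \<tau>\<close> says that the C*-algebra \<open>'c\<close>, with \<open>\<tau> a k\<close> in the role of the elementary
  tensor \<open>a \<otimes> k\<close>, is a completion of the algebraic tensor product of \<open>'a\<close> and \<open>'k\<close> in a C*-norm:
  \<open>\<tau>\<close> induces a *-homomorphism on the algebraic tensor product, which is injective with dense
  range. Every C*-norm on an algebraic tensor product is a cross norm, and it is unique if one
  of the factors is nuclear, as the compact operators are. The real span of the elementary
  tensors is their complex span, since \<open>\<tau>\<close> is complex-linear.\<close>

definition cstar_tensor :: "('a::cstar_algebra \<Rightarrow> 'k::cstar_algebra \<Rightarrow> 'c::cstar_algebra) \<Rightarrow> bool" where
  "cstar_tensor \<tau> \<longleftrightarrow>
     (\<forall>k. clinear (\<lambda>a. \<tau> a k)) \<and> (\<forall>a. clinear (\<tau> a))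
     \<and> (\<forall>a b k l. \<tau> a k * \<tau> b l = \<tau> (a * b) (k * l))
     \<and> (\<forall>a k. star (\<tau> a k) = \<tau> (star a) (star k))
     \<and> (\<forall>a k. norm (\<tau> a k) = norm a * norm k)
     \<and> (\<forall>S f. finite S \<longrightarrow> (\<forall>c. (\<Sum>k\<in>S. c k *\<^sub>C k) = 0 \<longrightarrow> (\<forall>k\<in>S. c k = 0))
          \<longrightarrow> (\<Sum>k\<in>S. \<tau> (f k) k) = 0 \<longrightarrow> (\<forall>k\<in>S. f k = 0))
     \<and> closure (span {\<tau> a k |a k. True}) = UNIV"

text \<open>An isomorphism from the stabilisation onto \<open>'b\<close> amounts to a way of seeing \<open>'b\<close> itself as
  the tensor product.\<close>

definition stable_cstar :: "'b::cstar_algebra itself \<Rightarrow> bool" where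
  "stable_cstar _ \<longleftrightarrow> (\<exists>\<tau> :: 'b \<Rightarrow> compact_op \<Rightarrow> 'b. cstar_tensor \<tau>)"

definition almost_stable_rank_one :: "'b::cstar_algebra itself \<Rightarrow> bool" where
  "almost_stable_rank_one _ \<longleftrightarrow>
     range unit_emb \<subseteq> closure (general_linear :: 'b unitization set)"


section \<open>Anomalous actions and coherent morphisms\<close>

text \<open>Groups are written additively, as in the class \<^class>\<open>group_add\<close>, which does not ask for
  commutativity; \<open>g + h\<close> and \<open>0\<close> are the product and the neutral element.\<close>

definition has_anomaly ::
    "('g::group_add \<Rightarrow> 'a::cstar_algebra \<Rightarrow> 'a) \<Rightarrow> ('g \<Rightarrow> 'g \<Rightarrow> 'a multiplier)
      \<Rightarrow> ('g \<Rightarrow> 'g \<Rightarrow> 'g \<Rightarrow> complex) \<Rightarrow> bool" where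
  "has_anomaly \<alpha> u \<omega> \<longleftrightarrow> (\<forall>g h k. cmod (\<omega> g h k) = 1
     \<and> multiplier_ext (\<alpha> g) (u h k) * u g (h + k) * star (u (g + h) k) * star (u g h)
         = \<omega> g h k *\<^sub>C 1)"

definition anomalous_action ::
    "('g::group_add \<Rightarrow> 'a::cstar_algebra \<Rightarrow> 'a) \<Rightarrow> ('g \<Rightarrow> 'g \<Rightarrow> 'a multiplier) \<Rightarrow> bool" where
  "anomalous_action \<alpha> u \<longleftrightarrow>
     (\<forall>g. star_automorphism (\<alpha> g)) \<and> (\<forall>g h. unitary (u g h))
     \<and> (\<forall>g h. \<alpha> g \<circ> \<alpha> h = Ad (u g h) \<circ> \<alpha> (g + h))
     \<and> (\<exists>\<omega>. has_anomaly \<alpha> u \<omega>)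
     \<and> (\<forall>g. u g 0 = 1 \<and> u 0 g = 1)"

text \<open>The anomaly is determined by the action, and is then a normalised 3-cocycle, unless the
  algebra is zero.\<close>

definition same_anomaly ::
    "('g::group_add \<Rightarrow> 'a::cstar_algebra \<Rightarrow> 'a) \<Rightarrow> ('g \<Rightarrow> 'g \<Rightarrow> 'a multiplier)
      \<Rightarrow> ('g \<Rightarrow> 'b::cstar_algebra \<Rightarrow> 'b) \<Rightarrow> ('g \<Rightarrow> 'g \<Rightarrow> 'b multiplier) \<Rightarrow> bool" where
  "same_anomaly \<alpha> u \<beta> v \<longleftrightarrow> (\<exists>\<omega>. has_anomaly \<alpha> u \<omega> \<and> has_anomaly \<beta> v \<omega>)"

definition coherent_morphism ::
    "('g::group_add \<Rightarrow> 'a::cstar_algebra \<Rightarrow> 'a) \<Rightarrow> ('g \<Rightarrow> 'g \<Rightarrow> 'a multiplier)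
      \<Rightarrow> ('g \<Rightarrow> 'b::cstar_algebra \<Rightarrow> 'b) \<Rightarrow> ('g \<Rightarrow> 'g \<Rightarrow> 'b multiplier)
      \<Rightarrow> ('g \<Rightarrow> 'a \<Rightarrow> 'b) \<Rightarrow> bool" where
  "coherent_morphism \<alpha> u \<beta> v \<phi> \<longleftrightarrow>
     (\<forall>g. clinear (\<phi> g))
     \<and> (\<forall>g a b. star (\<phi> g a) * \<phi> g b = \<phi> 0 (star a * b))
     \<and> (\<forall>g h a b. \<phi> (g + h) (star (u g h) \<rhd> (\<alpha> g a * b))
          = star (v g h) \<rhd> (\<beta> g (\<phi> h a) * \<phi> g b))"


section \<open>Equivalences of coherent morphisms\<close>

definition approx_MvN_equiv ::
    "('g \<Rightarrow> 'b::cstar_algebra \<Rightarrow> 'b) \<Rightarrow> ('g \<Rightarrow> 'a \<Rightarrow> 'b) \<Rightarrow> ('g \<Rightarrow> 'a \<Rightarrow> 'b) \<Rightarrow> bool" where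
  "approx_MvN_equiv \<beta> \<phi> \<psi> \<longleftrightarrow>
     (\<forall>\<epsilon>>0. \<forall>K F. finite K \<longrightarrow> finite F \<longrightarrow>
       (\<exists>v. \<forall>g\<in>K. \<forall>a\<in>F. norm (\<beta> g (star v) * \<phi> g a * v - \<psi> g a) < \<epsilon>
          \<and> norm (\<beta> g v * \<psi> g a * star v - \<phi> g a) < \<epsilon>))"

definition asymp_MvN_equiv ::
    "('g \<Rightarrow> 'b::cstar_algebra \<Rightarrow> 'b) \<Rightarrow> ('g \<Rightarrow> 'a \<Rightarrow> 'b) \<Rightarrow> ('g \<Rightarrow> 'a \<Rightarrow> 'b) \<Rightarrow> bool" where
  "asymp_MvN_equiv \<beta> \<phi> \<psi> \<longleftrightarrow>
     (\<exists>v :: real \<Rightarrow> 'b. continuous_on {0..} v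
       \<and> (\<forall>g a. ((\<lambda>t. \<beta> g (star (v t)) * \<phi> g a * v t) \<longlongrightarrow> \<psi> g a) at_top
            \<and> ((\<lambda>t. \<beta> g (v t) * \<psi> g a * star (v t)) \<longlongrightarrow> \<phi> g a) at_top))"

text \<open>The products below are formed in the forced unitisation, which contains the algebra
  isometrically as an ideal through \<^const>\<open>unit_emb\<close>.\<close>

definition proper_approx_unitary_equiv ::
    "('g \<Rightarrow> 'b::cstar_algebra \<Rightarrow> 'b) \<Rightarrow> ('g \<Rightarrow> 'a \<Rightarrow> 'b) \<Rightarrow> ('g \<Rightarrow> 'a \<Rightarrow> 'b) \<Rightarrow> bool" where
  "proper_approx_unitary_equiv \<beta> \<phi> \<psi> \<longleftrightarrow>
     (\<exists>w :: nat \<Rightarrow> 'b unitization. range w \<subseteq> unitary_group_one_plus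
       \<and> (\<forall>g a. (\<lambda>n. unit_ext (\<beta> g) (w n) * unit_emb (\<phi> g a) * star (w n))
            \<longlonglongrightarrow> unit_emb (\<psi> g a)))"

definition proper_asymp_unitary_equiv ::
    "('g \<Rightarrow> 'b::cstar_algebra \<Rightarrow> 'b) \<Rightarrow> ('g \<Rightarrow> 'a \<Rightarrow> 'b) \<Rightarrow> ('g \<Rightarrow> 'a \<Rightarrow> 'b) \<Rightarrow> bool" where
  "proper_asymp_unitary_equiv \<beta> \<phi> \<psi> \<longleftrightarrow>
     (\<exists>w :: real \<Rightarrow> 'b unitization. continuous_on {0..} w
       \<and> w ` {0..} \<subseteq> unitary_group_one_plus
       \<and> (\<forall>g a. ((\<lambda>t. unit_ext (\<beta> g) (w t) * unit_emb (\<phi> g a) * star (w t))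
            \<longlongrightarrow> unit_emb (\<psi> g a)) at_top))"

end

theory Submission
  imports Defs
begin

text \<open>The actions enter only through three consequences of coherence:
  \<open>\<phi>\<^sub>g(a)\<^sup>*\<phi>\<^sub>g(b) = \<phi>\<^sub>0(a\<^sup>*b)\<close>, \<open>\<phi>\<^sub>g(ab) = \<phi>\<^sub>g(a)\<phi>\<^sub>0(b)\<close> and
  \<open>\<phi>\<^sub>g(\<alpha>\<^sub>g(a)b) = \<beta>\<^sub>g(\<phi>\<^sub>0(a))\<phi>\<^sub>g(b)\<close>. If unitaries \<open>u\<close> conjugate \<open>\<phi>\<close> to \<open>\<psi>\<close>,
  then \<open>v = u\<^sup>*\<psi>\<^sub>0(e)\<close> with an approximate unit \<open>e\<close> gives a Murray--von Neumann equivalence.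

  Conversely, cutting down with \<open>\<psi>\<^sub>0(e)\<close> makes the given elements \<open>v\<close> contractive, and then
  \<open>v\<^sup>*v\<psi>\<^sub>0(a) \<approx> \<psi>\<^sub>0(a)\<close>. Because \<open>\<psi>\<^sub>g(\<alpha>\<^sub>g(e)ae) = \<beta>\<^sub>g(\<psi>\<^sub>0(e))\<psi>\<^sub>g(a)\<psi>\<^sub>0(e)\<close>, it
  suffices to find unitaries \<open>u\<close> with \<open>u\<psi>\<^sub>0(a) \<approx> v\<psi>\<^sub>0(a)\<close>, and the group plays no further role.
  In the almost stable rank one case \<open>u\<close> is the unitary part of an invertible element close to
  \<open>v\<close>. In the stable case there is a contraction \<open>S\<close> that moves a corner almost containing \<open>v\<close>
  isometrically to an orthogonal one; the rotation \<open>(1 + (z - z\<^sup>*)\<^sup>2)\<^bsup>1/2\<^esup> + z - z\<^sup>*\<close> attached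
  to a square-zero contraction \<open>z\<close> is a unitary in \<open>1 + B\<close>, and the product of the rotations
  attached to \<open>z = Sv\<close> and then to \<open>z = vv\<^sup>*S\<^sup>*\<close> acts as \<open>vv\<^sup>*S\<^sup>*Sv \<approx> v\<close>. All choices can be made
  continuously in a parameter.

  Instead of the continuous functional calculus only the binomial series for real powers of
  elements close to \<open>1\<close> is used.\<close>

section \<open>Unital C*-algebras and the binomial series\<close>

text \<open>The obstacle is that \<open>v\<close> is almost isometric only on the image of \<psi>:
  the isometric part of its polar decomposition need not lie in the algebra, nor extend to a
  unitary. Almost stable rank one allows \<open>v\<close> to be perturbed to an invertible element.
  A stable algebra offers room instead: a rotation needs a square-zero \<open>z\<close>, which
  \<open>v\<close> need not be, so the way from the support of \<open>v\<close> to its range leads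
  through a third corner orthogonal to both. The exact relations \<open>v S v = 0\<close> and
  \<open>star v S v = 0\<close> are arranged by compressing \<open>v\<close> with a local unit
  \<open>Q\<close> such that \<open>Q S Q = 0\<close>, and since the binomial series is used only
  inside the open unit ball, \<open>v\<close> is also shrunk by factors tending to 1. In the stable
  case a sequence is treated as the integer samples of a piecewise linear path. Since
  \<open>v\<close> moves \<psi> to \<phi>, the adjoints of the unitaries found are the required
  ones, and in the approximate case a phase still has to move them into \<open>1 + B\<close>.
  Separability of \<open>A\<close> and countability of \<open>G\<close> let one sequence exhaust all
  test elements. Positivity is encoded as a norm inequality, which avoids spectra; that
  \<open>star v * v\<close> is positive then becomes a theorem.\<close>

class unital_cstar_algebra = cstar_algebra + real_normed_algebra_1

text \<open>The new unit has norm exactly 1 because of its scalar part; the operator norm alone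
  would give 0 over the zero algebra.\<close>

instance unitization :: (cstar_algebra) unital_cstar_algebra
proof
  show "(0::'a unitization) \<noteq> 1"
    by (simp add: zero_unitization_def one_unitization_def)
  have "onorm (unit_lmul (1::'a unitization)) \<le> 1"
    by (rule onorm_bound) (auto simp: unit_lmul_def one_unitization_def scaleC_one)
  then show "norm (1::'a unitization) = 1"
    by (simp add: norm_unitization_def one_unitization_def)
qed

lemma norm_mult_le:
  fixes x y :: "'a::real_normed_algebra"
  shows "norm x \<le> 1 \<Longrightarrow> norm (x * y) \<le> norm y" "norm y \<le> 1 \<Longrightarrow> norm (x * y) \<le> norm x"
  by (rule order_trans[OF norm_mult_ineq], simp add: mult_left_le mult_left_le_one_le)+

lemma norm_mult_le_1:
  fixes x y :: "'a::real_normed_algebra"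
  shows "norm x \<le> 1 \<Longrightarrow> norm y \<le> 1 \<Longrightarrow> norm (x * y) \<le> 1"
  using norm_mult_le(1)[of x y] by linarith

lemma norm_mult3_le:
  fixes x y z :: "'a::real_normed_algebra"
  shows "norm x \<le> 1 \<Longrightarrow> norm z \<le> 1 \<Longrightarrow> norm (x * y * z) \<le> norm y"
  using norm_mult_le(2)[of z "x * y"] norm_mult_le(1)[of x y] by linarith

lemma norm_triangle3: "norm (x + y + z) \<le> norm x + norm y + norm (z :: 'a::real_normed_vector)"
  by (rule order_trans[OF norm_triangle_ineq add_right_mono[OF norm_triangle_ineq]])

lemma scaleC_diff_right: "c *\<^sub>C (x - y) = c *\<^sub>C x - c *\<^sub>C (y :: 'a::complex_vector)"
  using scaleC_add_right[of c x "- y"] by (simp add: scaleC_minus_right)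

lemma star_scaleR: "star (r *\<^sub>R x) = r *\<^sub>R star (x :: 'a::star_algebra)"
  by (simp add: scaleR_scaleC star_scaleC)

lemma bounded_linear_star: "bounded_linear (star :: 'a::cstar_algebra \<Rightarrow> 'a)"
  by (rule bounded_linear_intro[where K = 1]) (simp_all add: star_add star_scaleR)

lemma star_one [simp]: "star (1 :: 'a::{star_algebra, monoid_mult}) = 1"
  by (metis mult.left_neutral star_mult star_star mult.right_neutral)

lemma star_power: "star (x ^ n) = star (x :: 'a::{star_algebra, monoid_mult}) ^ n"
  by (induction n) (simp_all add: star_mult power_commutes)

lemma continuous_on_star [continuous_intros]:
  "continuous_on S f \<Longrightarrow> continuous_on S (\<lambda>x. star (f x :: 'a::cstar_algebra))"
  using bounded_linear.continuous_on[OF bounded_linear_star] .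

lemma tendsto_star [tendsto_intros]:
  "(f \<longlongrightarrow> l) F \<Longrightarrow> ((\<lambda>x. star (f x :: 'a::cstar_algebra)) \<longlongrightarrow> star l) F"
  using bounded_linear.tendsto[OF bounded_linear_star] .

lemma norm_mult_star_self: "norm (x * star x) = (norm (x :: 'a::cstar_algebra))\<^sup>2"
  using cstar_identity[of "star x"] by simp

lemma norm_unitary:
  assumes "unitary (w :: 'a::unital_cstar_algebra)"
  shows "norm w = 1"
proof -
  have "(norm w)\<^sup>2 = 1"
    using assms cstar_identity[of w] by (simp add: unitary_def)
  then show ?thesis
    by (metis norm_ge_zero power2_eq_1_iff one_neq_neg_one not_numeral_le_zero le_minus_one_simps(3))
qed

text \<open>For \<open>norm x < 1\<close> this is the real power \<open>a\<close> of
  \<open>1 + x\<close>, so that \<open>1/2\<close> and \<open>-1\<close> yield the square root and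
  the inverse.\<close>

definition bpow :: "real \<Rightarrow> 'a::unital_cstar_algebra \<Rightarrow> 'a" where
  "bpow a x = (\<Sum>n. (a gchoose n) *\<^sub>R x ^ n)"

lemma summable_gchoose:
  fixes r :: real
  assumes "0 \<le> r" "r < 1"
  shows "summable (\<lambda>n. \<bar>a gchoose n\<bar> * r ^ n)"
proof -
  \<comment> \<open>A radius strictly between \<open>r\<close> and 1: convergence of the real series
    at \<open>s\<close> forces absolute convergence at \<open>r\<close>.\<close>
  define s where "s = (r + 1) / 2"
  have s: "r < s" "s < 1" using assms by (auto simp: s_def)
  have "summable (\<lambda>n. (a gchoose n) * s ^ n)"
    using gen_binomial_real[of s a] s assms by (auto simp: sums_iff)
  then have "summable (\<lambda>n. norm ((a gchoose n) * r ^ n))"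
    by (rule powser_insidea) (use s assms in auto)
  then show ?thesis using assms by (simp add: abs_mult)
qed

lemma norm_bpow_term:
  "norm ((a gchoose n) *\<^sub>R (x :: 'a::unital_cstar_algebra) ^ n) \<le> \<bar>a gchoose n\<bar> * norm x ^ n"
  by (simp add: mult_left_mono norm_power_ineq)

lemma summable_norm_bpow:
  assumes "norm (x :: 'a::unital_cstar_algebra) < 1"
  shows "summable (\<lambda>n. norm ((a gchoose n) *\<^sub>R x ^ n))"
proof (rule summable_comparison_test'[OF summable_gchoose])
  show "0 \<le> norm x" "norm x < 1" using assms by auto
  show "norm (norm ((a gchoose n) *\<^sub>R x ^ n)) \<le> \<bar>a gchoose n\<bar> * norm x ^ n" for n
    using norm_bpow_term[of a n x] by simp
qed

lemma summable_bpow: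
  "norm (x :: 'a::unital_cstar_algebra) < 1 \<Longrightarrow> summable (\<lambda>n. (a gchoose n) *\<^sub>R x ^ n)"
  by (rule summable_norm_cancel[OF summable_norm_bpow])

text \<open>Vandermonde's convolution identifies the Cauchy product of the two series with the
  series of the summed exponents.\<close>

lemma bpow_add:
  assumes "norm (x :: 'a::unital_cstar_algebra) < 1"
  shows "bpow a x * bpow b x = bpow (a + b) x"
proof -
  have eq: "(\<Sum>i\<le>k. ((a gchoose i) *\<^sub>R x ^ i) * ((b gchoose (k - i)) *\<^sub>R x ^ (k - i)))
      = ((a + b) gchoose k) *\<^sub>R x ^ k" for k
    by (simp add: scaleR_sum_left mult.commute atLeast0AtMost flip: gbinomial_Vandermonde power_add)
  show ?thesis
    using Cauchy_product_sums[OF summable_norm_bpow[OF assms, of a] summable_norm_bpow[OF assms, of b]]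
    unfolding eq bpow_def by (simp add: sums_iff)
qed

lemma bpow_0 [simp]: "bpow 0 (x :: 'a::unital_cstar_algebra) = 1"
proof -
  have "(\<lambda>n. ((0::real) gchoose n) *\<^sub>R x ^ n) = (\<lambda>n. if n = 0 then 1 else 0)"
    by (auto simp: fun_eq_iff gbinomial_0_left)
  then show ?thesis
    using sums_single[of 0 "\<lambda>_. 1 :: 'a"] by (simp add: bpow_def sums_iff cong: if_cong)
qed

lemma bpow_1 [simp]: "bpow 1 x = 1 + x"
proof -
  have "((1::real) gchoose n) *\<^sub>R x ^ n = 0" if "n \<notin> {0, 1}" for n
  proof -
    have "(of_nat 1 :: real) gchoose n = of_nat (1 choose n)" by (rule binomial_gbinomial[symmetric])
    then show ?thesis using that by (simp add: binomial_eq_0)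
  qed
  then have "bpow 1 x = (\<Sum>n\<in>{0,1}. ((1::real) gchoose n) *\<^sub>R x ^ n)"
    unfolding bpow_def by (intro suminf_finite) auto
  then show ?thesis by simp
qed

lemma star_bpow:
  assumes "norm (x :: 'a::unital_cstar_algebra) < 1" "star x = x"
  shows "star (bpow a x) = bpow a x"
  unfolding bpow_def
  by (subst bounded_linear.suminf[OF bounded_linear_star summable_bpow[OF assms(1)]])
    (simp add: star_scaleR star_power assms(2))

lemma bpow_commute:
  assumes "norm (x :: 'a::unital_cstar_algebra) < 1" "x * y = y * x"
  shows "bpow a x * y = y * bpow a x"
proof -
  have p: "x ^ n * y = y * x ^ n" for n
    using assms(2) by (induction n) (auto simp: mult.assoc, metis mult.assoc)
  have "bpow a x * y = (\<Sum>n. ((a gchoose n) *\<^sub>R x ^ n) * y)"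
    unfolding bpow_def by (rule bounded_linear.suminf[OF bounded_linear_mult_left summable_bpow[OF assms(1)]])
  also have "\<dots> = (\<Sum>n. y * ((a gchoose n) *\<^sub>R x ^ n))" by (simp add: p)
  also have "\<dots> = y * bpow a x"
    unfolding bpow_def by (rule bounded_linear.suminf[OF bounded_linear_mult_right summable_bpow[OF assms(1)], symmetric])
  finally show ?thesis .
qed

text \<open>The series converges uniformly only on balls of radius below 1, so continuity is
  obtained on these and then pointwise on the open unit ball.\<close>

lemma continuous_on_bpow: "continuous_on (ball 0 1) (bpow a :: 'a::unital_cstar_algebra \<Rightarrow> 'a)"
proof -
  have *: "continuous_on (ball 0 r) (bpow a :: 'a \<Rightarrow> 'a)" if "0 \<le> r" "r < 1" for r
  proof (rule uniform_limit_theorem)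
    show "uniform_limit (ball 0 r) (\<lambda>n x. \<Sum>i<n. (a gchoose i) *\<^sub>R x ^ i) (bpow a :: 'a \<Rightarrow> 'a) sequentially"
      unfolding bpow_def
    proof (rule Weierstrass_m_test)
      show "summable (\<lambda>n. \<bar>a gchoose n\<bar> * r ^ n)" by (rule summable_gchoose) (use that in auto)
      fix n and x :: 'a assume "x \<in> ball 0 r"
      then have "\<bar>a gchoose n\<bar> * norm x ^ n \<le> \<bar>a gchoose n\<bar> * r ^ n"
        by (intro mult_left_mono power_mono) auto
      then show "norm ((a gchoose n) *\<^sub>R x ^ n) \<le> \<bar>a gchoose n\<bar> * r ^ n"
        using norm_bpow_term[of a n x] by linarith
    qed
    show "\<forall>\<^sub>F n in sequentially. continuous_on (ball 0 r) (\<lambda>x::'a. \<Sum>i<n. (a gchoose i) *\<^sub>R x ^ i)"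
      by (intro always_eventually allI continuous_intros)
  qed simp
  have "isCont (bpow a) x" if x: "x \<in> ball 0 1" for x :: 'a
  proof -
    obtain r where r: "norm x < r" "r < 1" using dense[of "norm x" 1] x by auto
    then have "0 \<le> r" using norm_ge_zero[of x] by linarith
    from *[OF this r(2)] r show ?thesis
      by (simp add: continuous_on_eq_continuous_at)
  qed
  then show ?thesis by (intro continuous_at_imp_continuous_on) auto
qed

text \<open>The scalar part is a bounded multiplicative functional killing \<open>x\<close>, so only
  the constant term survives. This is what places the rotations in \<open>1 + B\<close>.\<close>

lemma scalar_part_bpow:
  assumes "norm x < 1" "scalar_part x = 0"
  shows "scalar_part (bpow a x) = 1"
proof -
  have lin: "bounded_linear (scalar_part :: 'a unitization \<Rightarrow> complex)"
    by (rule bounded_linear_intro[where K = 1])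
      (auto simp: norm_unitization_def unitization_ops scaleR_conv_of_real)
  have p: "scalar_part (x ^ n) = (if n = 0 then 1 else 0)" for n
    using assms(2) by (cases n) (auto simp: one_unitization_def times_unitization_def)
  have "scalar_part (bpow a x) = (\<Sum>n. scalar_part ((a gchoose n) *\<^sub>R x ^ n))"
    unfolding bpow_def by (rule bounded_linear.suminf[OF lin summable_bpow[OF assms(1)]])
  also have "\<dots> = (\<Sum>n. if n = 0 then 1 else 0)"
    by (rule suminf_cong)
      (auto simp: linear_scale[OF bounded_linear.linear[OF lin]] p)
  also have "\<dots> = 1"
    using sums_single[of 0 "\<lambda>_. 1 :: complex"] by (simp add: sums_iff cong: if_cong)
  finally show ?thesis .
qed

section \<open>Positive elements\<close>

text \<open>For self-adjoint \<open>a\<close> the norm inequality says that the spectrum lies in the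
  interval from 0 to \<open>2 * M\<close>. Leaving \<open>M\<close> free makes sums
  immediate.\<close>

definition nonneg :: "'a::unital_cstar_algebra \<Rightarrow> bool" where
  "nonneg a \<longleftrightarrow> star a = a \<and> (\<exists>M\<ge>0. norm (M *\<^sub>R 1 - a) \<le> M)"

lemma nonneg_star: "nonneg a \<Longrightarrow> star a = a"
  by (simp add: nonneg_def)

lemma nonneg_add:
  assumes "nonneg a" "nonneg b"
  shows "nonneg (a + b)"
proof -
  obtain M N where M: "M \<ge> 0" "norm (M *\<^sub>R 1 - a) \<le> M" and N: "N \<ge> 0" "norm (N *\<^sub>R 1 - b) \<le> N"
    using assms unfolding nonneg_def by blast
  have "(M + N) *\<^sub>R 1 - (a + b) = (M *\<^sub>R 1 - a) + (N *\<^sub>R 1 - b)" by (simp add: scaleR_add_left)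
  then have "norm ((M + N) *\<^sub>R 1 - (a + b)) \<le> M + N"
    using M N norm_triangle_ineq[of "M *\<^sub>R 1 - a" "N *\<^sub>R 1 - b"] by (simp only:)
  then show ?thesis
    using assms M N unfolding nonneg_def by (auto simp: star_add intro!: exI[of _ "M + N"])
qed

lemma nonneg_scaleR:
  assumes "nonneg a" "r \<ge> 0"
  shows "nonneg (r *\<^sub>R a)"
proof -
  obtain M where M: "M \<ge> 0" "norm (M *\<^sub>R 1 - a) \<le> M" using assms unfolding nonneg_def by blast
  have "(r * M) *\<^sub>R 1 - r *\<^sub>R a = r *\<^sub>R (M *\<^sub>R 1 - a)" by (simp add: scaleR_diff_right)
  then have "norm ((r * M) *\<^sub>R 1 - r *\<^sub>R a) \<le> r * M"
    using M assms by (simp add: mult_left_mono)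
  then show ?thesis
    using assms M unfolding nonneg_def by (auto simp: star_scaleR intro!: exI[of _ "r * M"])
qed

lemma nonneg_const [simp]: "r \<ge> 0 \<Longrightarrow> nonneg (r *\<^sub>R 1)"
  unfolding nonneg_def by (auto simp: star_scaleR intro!: exI[of _ r])

lemma nonneg_0 [simp]: "nonneg 0" and nonneg_1 [simp]: "nonneg 1"
  using nonneg_const[of 0] nonneg_const[of 1] by simp_all

lemma nonneg_sum: "(\<And>i. i \<in> I \<Longrightarrow> nonneg (f i)) \<Longrightarrow> nonneg (sum f I)"
  by (induction I rule: infinite_finite_induct) (auto intro: nonneg_add)

lemma nonneg_norm_minus:
  assumes "star a = a" "norm a \<le> K"
  shows "nonneg (K *\<^sub>R 1 - a)"
  using assms order_trans[OF norm_ge_zero assms(2)]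
  unfolding nonneg_def by (auto simp: star_diff star_scaleR intro!: exI[of _ K])

text \<open>With \<open>w = x + \<i> s\<close>, a unitary, \<open>x\<close> is the mean of \<open>w\<close> and \<open>w\<^sup>*\<close>.\<close>

lemma norm_le_1_if_sum_squares_1:
  assumes "star x = x" "star s = s" "x * s = s * x" "x * x + s * s = (1 :: 'a::unital_cstar_algebra)"
  obtains w where "unitary w" "2 *\<^sub>R x = w + star w" "norm x \<le> 1"
proof -
  define w where "w = x + \<i> *\<^sub>C s"
  have sw: "star w = x - \<i> *\<^sub>C s"
    by (simp add: w_def star_add star_scaleC assms scaleC_minus_left)
  have "star w * w = 1" "w * star w = 1"
    using assms(3,4) unfolding sw unfolding w_def
    by (simp_all add: algebra_simps scaleC_add_right scaleC_diff_right scaleC_scaleC scaleC_minus_left scaleC_one)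
  then have w: "unitary w" by (simp add: unitary_def)
  have eq: "2 *\<^sub>R x = w + star w"
    unfolding sw unfolding w_def by (simp add: scaleR_2)
  then have "2 * norm x \<le> norm w + norm (star w)"
    by (metis norm_scaleR norm_triangle_ineq abs_numeral)
  then have "norm x \<le> 1" using norm_unitary[OF w] by simp
  with w eq show ?thesis by (rule that)
qed

lemma bpow_half_sq:
  assumes "norm (x :: 'a::unital_cstar_algebra) < 1"
  shows "bpow (1/2) x * bpow (1/2) x = 1 + x"
  using bpow_add[OF assms, of "1/2" "1/2"] by simp

lemma norm_sq_le:
  assumes "norm (x :: 'a::real_normed_algebra) < 1"
  shows "norm (x * x) < 1"
proof -
  have "norm x * norm x < 1 * 1" by (rule mult_strict_mono) (use assms in auto)
  then show ?thesis using norm_mult_ineq[of x x] by linarith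
qed

text \<open>The pair \<open>x\<close>, \<open>s\<close> behaves like a cosine and a sine: the
  preceding lemma yields the unitary from \<open>x\<close> and \<open>s\<close>, and the bound on
  \<open>s\<close> from the exchanged roles.\<close>

lemma unitary_average:
  assumes "star x = x" "norm (x :: 'a::unital_cstar_algebra) < 1"
  obtains w s where "unitary w" "2 *\<^sub>R x = w + star w"
    "star s = s" "s * s = 1 - x * x" "norm s \<le> 1"
proof -
  define s where "s = bpow (1/2) (- (x * x))"
  have n: "norm (- (x * x)) < 1" using norm_sq_le[OF assms(2)] by simp
  have "star (- (x * x)) = - (x * x)" by (simp add: star_minus star_mult assms)
  from star_bpow[OF n this] have s1: "star s = s" by (simp add: s_def)
  have s2: "s * s = 1 - x * x" unfolding s_def by (subst bpow_half_sq[OF n]) simp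
  have "s * x = x * s" unfolding s_def by (rule bpow_commute[OF n]) (simp add: mult.assoc)
  note s = s1 s2 this[symmetric]
  obtain w where w: "unitary w" "2 *\<^sub>R x = w + star w"
    using norm_le_1_if_sum_squares_1[of x s] assms s by auto
  have "norm s \<le> 1"
    using norm_le_1_if_sum_squares_1[of s x] assms s by auto
  with w s that show ?thesis by blast
qed

lemma square_divideR:
  "r \<noteq> 0 \<Longrightarrow> (r * r) *\<^sub>R ((m /\<^sub>R r) * (m /\<^sub>R r)) = m * (m :: 'a::real_normed_algebra)"
  by (simp add: field_simps)

lemma norm_divideR: "r > 0 \<Longrightarrow> norm (x /\<^sub>R r) = norm x / r"
  by (simp add: divide_inverse mult.commute)

text \<open>Once \<open>m\<close> is scaled to \<open>x\<close> of norm below 1,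
  \<open>1 - x * x\<close> is the square of a contraction, and the constant 1 witnesses
  positivity.\<close>

lemma nonneg_square:
  assumes "star m = (m :: 'a::unital_cstar_algebra)"
  shows "nonneg (m * m)"
proof -
  define r :: real where "r = norm m + 1"
  have r: "r > 0" using norm_ge_zero[of m] unfolding r_def by linarith
  define x where "x = m /\<^sub>R r"
  have "star x = x" "norm x < 1"
    using assms r by (auto simp: x_def star_scaleR r_def field_simps)
  then obtain s where s: "s * s = 1 - x * x" "norm s \<le> 1" using unitary_average by metis
  have "norm (s * s) \<le> 1" by (rule norm_mult_le_1[OF s(2) s(2)])
  then have "nonneg (x * x)"
    using \<open>star x = x\<close> s unfolding nonneg_def by (auto simp: star_mult intro!: exI[of _ 1])
  then have "nonneg ((r * r) *\<^sub>R (x * x))" using r by (intro nonneg_scaleR) auto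
  moreover have "(r * r) *\<^sub>R (x * x) = m * m" using r by (simp add: x_def field_simps)
  ultimately show ?thesis by simp
qed

section \<open>Real powers, norm bounds and products of positive elements\<close>

definition real_powers :: "'a::unital_cstar_algebra \<Rightarrow> (real \<Rightarrow> 'a) \<Rightarrow> bool" where
  "real_powers a P \<longleftrightarrow> (\<forall>s. star (P s) = P s) \<and> (\<forall>s t. P s * P t = P (s + t))
     \<and> P 0 = 1 \<and> P 1 = a \<and> (\<forall>s y. a * y = y * a \<longrightarrow> P s * y = y * P s)"

lemma real_powersD:
  assumes "real_powers a P"
  shows "star (P s) = P s" "P s * P t = P (s + t)" "P 0 = 1" "P 1 = a"
    "a * y = y * a \<Longrightarrow> P s * y = y * P s"
  using assms by (auto simp: real_powers_def)

lemma real_powers_halves: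
  assumes "real_powers a P"
  shows "P (1/2) * P (1/2) = a" "P (-1/2) * P (-1/2) = P (-1)" "P (-1) * a = 1" "a * P (-1) = 1"
  using assms real_powersD(2)[OF assms, of "1/2" "1/2"] real_powersD(2)[OF assms, of "-1/2" "-1/2"]
    real_powersD(2)[OF assms, of 1 "-1"] real_powersD(2)[OF assms, of "-1" 1]
  by (simp_all add: real_powersD[OF assms])

text \<open>With \<open>K = M + \<delta>\<close> one has \<open>a + \<delta> = K (1 + x)\<close> and
  \<open>norm x \<le> M / K < 1\<close>, so the binomial series applies; \<delta> is what makes the
  inequality strict. The family \<open>P\<close> commutes with everything that commutes with the
  element, so roots of commuting elements commute.\<close>

lemma nonneg_powers:
  fixes a :: "'a::unital_cstar_algebra" and \<delta> :: real
  assumes "nonneg a" "\<delta> > 0"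
  shows "\<exists>P. real_powers (a + \<delta> *\<^sub>R 1) P"
proof -
  obtain M where M: "M \<ge> 0" "norm (M *\<^sub>R 1 - a) \<le> M" and sa: "star a = a"
    using assms unfolding nonneg_def by blast
  define K where "K = M + \<delta>"
  have K: "K > 0" using M assms by (simp add: K_def)
  define x where "x = (a - M *\<^sub>R 1) /\<^sub>R K"
  have x: "norm x < 1"
  proof -
    have "norm x = norm (M *\<^sub>R 1 - a) / K"
      unfolding x_def by (simp only: norm_divideR[OF K] norm_minus_commute)
    also have "\<dots> < 1" using M assms(2) K by (simp add: K_def)
    finally show ?thesis .
  qed
  have sx: "star x = x" by (simp add: x_def star_scaleR star_diff sa)
  define P where "P s = (K powr s) *\<^sub>R bpow s x" for s
  show ?thesis
    unfolding real_powers_def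
  proof (intro exI[of _ P] conjI allI impI)
    show "star (P s) = P s" for s using x sx by (simp add: P_def star_scaleR star_bpow)
    show "P s * P t = P (s + t)" for s t
      using x by (simp add: P_def bpow_add powr_add)
    show "P 0 = 1" using K by (simp add: P_def)
    show "P 1 = a + \<delta> *\<^sub>R 1" using K
      by (simp add: P_def x_def scaleR_add_right) (simp add: K_def scaleR_add_left)
    show "P s * y = y * P s" if "(a + \<delta> *\<^sub>R 1) * y = y * (a + \<delta> *\<^sub>R 1)" for s y
    proof -
      have "a * y = y * a" using that by (simp add: distrib_left distrib_right)
      then have "x * y = y * x" by (simp add: x_def algebra_simps)
      then show ?thesis using x by (simp add: P_def bpow_commute)
    qed
  qed
qed

text \<open>The free constant \<open>M\<close> of \<open>nonneg\<close> may be traded for any bound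
  of the norm: a root of \<open>a + \<delta>\<close> scaled into the unit ball gives
  \<open>x\<close> such that \<open>1 - x * x\<close> is the square of a contraction, and
  \<open>K - a\<close> differs from a multiple of it only by \<delta>.\<close>

lemma nonneg_norm_le:
  assumes "nonneg (a :: 'a::unital_cstar_algebra)" "norm a \<le> K"
  shows "norm (K *\<^sub>R 1 - a) \<le> K"
proof (rule field_le_epsilon)
  fix e :: real assume e: "e > 0"
  define \<delta> where "\<delta> = e / 3"
  have \<delta>: "\<delta> > 0" using e by (simp add: \<delta>_def)
  have K: "K \<ge> 0" using assms(2) norm_ge_zero order_trans by blast
  obtain P where P: "real_powers (a + \<delta> *\<^sub>R 1) P" using nonneg_powers[OF assms(1) \<delta>] by blast
  note PP = real_powers_halves(1)[OF P] and P = real_powersD[OF P]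
  have "(norm (P (1/2)))\<^sup>2 = norm (a + \<delta> *\<^sub>R 1)"
    using cstar_identity[of "P (1/2)"] P(1) PP by simp
  also have "\<dots> \<le> K + \<delta>" using norm_triangle_ineq[of a "\<delta> *\<^sub>R 1"] assms(2) \<delta> by simp
  finally have n: "(norm (P (1/2)))\<^sup>2 \<le> K + \<delta>" .
  \<comment> \<open>The second \<delta> under the root puts \<open>P (1/2) / r\<close> strictly
    inside the unit ball, since \<open>P (1/2)\<close> has squared norm at most
    \<open>K + \<delta>\<close>.\<close>
  define r where "r = sqrt (K + 2 * \<delta>)"
  have r: "r > 0" "r\<^sup>2 = K + 2 * \<delta>" using K \<delta> by (auto simp: r_def)
  define x where "x = P (1/2) /\<^sub>R r"
  have "(norm (P (1/2)))\<^sup>2 < r\<^sup>2" using n r(2) \<delta> by simp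
  then have "norm (P (1/2)) < r" by (rule power2_less_imp_less) (use r in simp)
  then have "star x = x" "norm x < 1"
    using r P(1) by (auto simp: x_def star_scaleR field_simps)
  then obtain s where s: "s * s = 1 - x * x" "norm s \<le> 1" using unitary_average by metis
  have "norm (s * s) \<le> 1" by (rule norm_mult_le_1[OF s(2) s(2)])
  then have le: "norm (1 - x * x) \<le> 1" using s by simp
  have xx: "r\<^sup>2 *\<^sub>R (x * x) = a + \<delta> *\<^sub>R 1"
    using square_divideR[of r "P (1/2)"] r(1) PP by (simp only: x_def power2_eq_square)
  have "K *\<^sub>R 1 - a = r\<^sup>2 *\<^sub>R (1 - x * x) - \<delta> *\<^sub>R 1"
    unfolding scaleR_diff_right xx unfolding r(2)
    by (simp add: algebra_simps) (metis mult.commute scaleR_2 scaleR_scaleR)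
  then have "norm (K *\<^sub>R 1 - a) \<le> r\<^sup>2 * norm (1 - x * x) + \<delta>"
    using norm_triangle_ineq4[of "r\<^sup>2 *\<^sub>R (1 - x * x)" "\<delta> *\<^sub>R 1"] \<delta> r K by simp
  also have "\<dots> \<le> r\<^sup>2 * 1 + \<delta>" by (intro add_right_mono mult_left_mono le) simp
  finally show "norm (K *\<^sub>R 1 - a) \<le> K + e" unfolding r(2) by (simp add: \<delta>_def)
qed

text \<open>The constant \<open>norm a + e\<close> works for \<open>a + e\<close>; inside the norm
  \<open>e\<close> cancels, so it can tend to 0 in the bound.\<close>

lemma nonneg_epsilon:
  assumes "\<And>e. e > 0 \<Longrightarrow> nonneg (a + e *\<^sub>R 1 :: 'a::unital_cstar_algebra)"
  shows "nonneg a"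
proof -
  have "star (a + 1 *\<^sub>R 1) = a + 1 *\<^sub>R 1" using assms[of 1] nonneg_star by simp
  then have sa: "star a = a" by (simp add: star_add)
  have "norm (norm a *\<^sub>R 1 - a) \<le> norm a + e" if "e > 0" for e
  proof -
    have "norm (a + e *\<^sub>R 1) \<le> norm a + e"
      using norm_triangle_ineq[of a "e *\<^sub>R 1"] that by simp
    from nonneg_norm_le[OF assms[OF that] this] show ?thesis by (simp add: algebra_simps)
  qed
  then have "norm (norm a *\<^sub>R 1 - a) \<le> norm a" by (rule field_le_epsilon)
  then show ?thesis using sa unfolding nonneg_def by (auto intro!: exI[of _ "norm a"])
qed

lemma nonneg_mono_const:
  assumes "nonneg (a + d *\<^sub>R 1 :: 'a::unital_cstar_algebra)" "d \<le> e"
  shows "nonneg (a + e *\<^sub>R 1)"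
proof -
  have "a + e *\<^sub>R 1 = (a + d *\<^sub>R 1) + (e - d) *\<^sub>R 1" by (simp add: algebra_simps)
  also have "nonneg \<dots>" by (intro nonneg_add nonneg_const assms) (use assms in simp)
  finally show ?thesis .
qed

text \<open>The roots \<open>a\<close>, \<open>b\<close> of \<open>C + \<delta> - r\<close> and
  \<open>C + \<delta> + r\<close>, divided by \<open>K\<close>, commute and satisfy
  \<open>a * a + b * b = 1\<close>. As for a sine and a cosine, \<open>b * b - a * a\<close> and
  \<open>2 a b\<close> belong to the doubled angle and their squares again add up to 1. Hence
  \<open>b * b - a * a\<close> is a contraction, and \<open>r\<close> is \<open>C + \<delta>\<close>
  times it.\<close>

lemma norm_le_if_nonneg:
  fixes r :: "'a::unital_cstar_algebra"
  assumes "nonneg (C *\<^sub>R 1 - r)" "nonneg (C *\<^sub>R 1 + r)" "C \<ge> 0"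
  shows "norm r \<le> C"
proof (rule field_le_epsilon)
  fix \<delta> :: real assume \<delta>: "\<delta> > 0"
  obtain P where P: "real_powers (C *\<^sub>R 1 - r + \<delta> *\<^sub>R 1) P" using nonneg_powers[OF assms(1) \<delta>] by blast
  note PP = real_powers_halves[OF P] and P = real_powersD[OF P]
  obtain Q where Q: "real_powers (C *\<^sub>R 1 + r + \<delta> *\<^sub>R 1) Q" using nonneg_powers[OF assms(2) \<delta>] by blast
  note QQ = real_powers_halves[OF Q] and Q = real_powersD[OF Q]
  have "P (1/2) * (C *\<^sub>R 1 + r + \<delta> *\<^sub>R 1) = (C *\<^sub>R 1 + r + \<delta> *\<^sub>R 1) * P (1/2)"
    by (rule P(5)) (simp add: algebra_simps)
  then have QP: "Q (1/2) * P (1/2) = P (1/2) * Q (1/2)"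
    by (intro Q(5)) simp
  define K where "K = sqrt (2 * (C + \<delta>))"
  have K: "K > 0" "K * K = 2 * (C + \<delta>)" using assms \<delta> by (auto simp: K_def)
  define a where "a = P (1/2) /\<^sub>R K"
  define b where "b = Q (1/2) /\<^sub>R K"
  have sa: "star a = a" "star b = b" by (auto simp: a_def b_def star_scaleR P Q)
  have ab: "a * b = b * a" using QP by (simp add: a_def b_def)
  have aa: "(K * K) *\<^sub>R (a * a) = (C + \<delta>) *\<^sub>R 1 - r"
    using square_divideR[of K "P (1/2)"] K(1) PP(1) by (simp add: a_def algebra_simps)
  have bb: "(K * K) *\<^sub>R (b * b) = (C + \<delta>) *\<^sub>R 1 + r"
    using square_divideR[of K "Q (1/2)"] K(1) QQ(1) by (simp add: b_def algebra_simps)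
  have "(K * K) *\<^sub>R (a * a + b * b) = (K * K) *\<^sub>R 1"
    unfolding scaleR_add_right aa bb unfolding K(2) scaleR_scaleR[symmetric] scaleR_2 by simp
  then have sum1: "a * a + b * b = 1" using K(1) by simp
  have "(K * K) *\<^sub>R (b * b - a * a) = 2 *\<^sub>R r"
    unfolding scaleR_diff_right aa bb by (simp add: scaleR_2)
  then have r: "r = (C + \<delta>) *\<^sub>R (b * b - a * a)"
    unfolding K(2) by (metis (no_types) scaleR_left_imp_eq scaleR_scaleR zero_neq_numeral)
  define x where "x = b * b - a * a"
  define y where "y = 2 *\<^sub>R (a * b)"
  have s: "(b * b - a * a) * (b * b - a * a) + (2 *\<^sub>R (a * b)) * (2 *\<^sub>R (a * b))
      = (a * a + b * b) * (a * a + b * b)"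
  proof -
    have c: "b * (a * z) = a * (b * z)" for z using ab by (metis mult.assoc)
    show ?thesis by (simp add: algebra_simps c ab[symmetric] scaleR_2)
  qed
  have "norm x \<le> 1"
  proof (rule norm_le_1_if_sum_squares_1)
    show "star x = x" "star y = y"
      unfolding x_def y_def using sa ab by (simp_all add: star_diff star_mult star_scaleR)
    have c: "b * (a * z) = a * (b * z)" for z using ab by (metis mult.assoc)
    show "x * y = y * x" unfolding x_def y_def by (simp add: algebra_simps c ab[symmetric])
    show "x * x + y * y = 1" unfolding x_def y_def s sum1 by simp
  qed
  then have "norm r \<le> (C + \<delta>) * 1" unfolding r x_def[symmetric] norm_scaleR
    using assms(3) \<delta> by (intro mult_mono) auto
  then show "norm r \<le> C + \<delta>" by simp
qed

text \<open>Roots \<open>p\<close>, \<open>q\<close> of \<open>a + \<delta>\<close> and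
  \<open>b + \<delta>\<close> commute, so \<open>(a + \<delta>) (b + \<delta>)\<close> is the square
  of the self-adjoint \<open>p * q\<close>. The surplus \<open>\<delta> a + \<delta> b\<close> is
  compensated by the positive elements \<open>norm a - a\<close> and \<open>norm b - b\<close>, at a
  scalar cost below \<open>e\<close>.\<close>

lemma nonneg_mult:
  fixes a b :: "'a::unital_cstar_algebra"
  assumes "nonneg a" "nonneg b" "a * b = b * a"
  shows "nonneg (a * b)"
proof (rule nonneg_epsilon)
  fix e :: real assume e: "e > 0"
  \<comment> \<open>The cap 1 gives \<open>\<delta> * \<delta> \<le> \<delta>\<close>, and the
    quotient keeps the total scalar cost below \<open>e\<close>.\<close>
  define \<delta> where "\<delta> = min 1 (e / (norm a + norm b + 1))"
  have \<delta>: "\<delta> > 0" using e norm_ge_zero[of a] norm_ge_zero[of b] by (simp add: \<delta>_def add_nonneg_pos)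
  have "\<delta> * (norm a + norm b + 1) \<le> e"
  proof -
    have "norm a + norm b + 1 > 0" by (simp add: add_nonneg_pos)
    moreover have "\<delta> \<le> e / (norm a + norm b + 1)" by (simp add: \<delta>_def)
    ultimately show ?thesis by (simp add: field_simps)
  qed
  moreover have "\<delta> * \<delta> \<le> \<delta> * 1" using \<delta> by (intro mult_left_mono) (auto simp: \<delta>_def)
  ultimately have small: "\<delta> * norm a + \<delta> * norm b + \<delta> * \<delta> \<le> e" by (simp add: algebra_simps)
  obtain P where P: "real_powers (a + \<delta> *\<^sub>R 1) P" using nonneg_powers[OF assms(1) \<delta>] by blast
  note PP = real_powers_halves[OF P] and P = real_powersD[OF P]
  obtain Q where Q: "real_powers (b + \<delta> *\<^sub>R 1) Q" using nonneg_powers[OF assms(2) \<delta>] by blast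
  note QQ = real_powers_halves[OF Q] and Q = real_powersD[OF Q]
  define p where "p = P (1/2)"
  define q where "q = Q (1/2)"
  have "p * (b + \<delta> *\<^sub>R 1) = (b + \<delta> *\<^sub>R 1) * p"
    unfolding p_def by (rule P(5)) (simp add: algebra_simps assms(3))
  then have pq: "p * q = q * p"
    unfolding q_def by (intro Q(5)[symmetric]) simp
  have pp: "p * p = a + \<delta> *\<^sub>R 1" and qq: "q * q = b + \<delta> *\<^sub>R 1"
    by (simp_all add: p_def q_def PP QQ)
  have "star (p * q) = p * q" by (simp add: star_mult p_def q_def P Q) (use pq in \<open>simp add: p_def q_def\<close>)
  then have "nonneg ((p * q) * (p * q))" by (rule nonneg_square)
  also have "(p * q) * (p * q) = (p * p) * (q * q)" by (metis pq mult.assoc)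
  finally have n: "nonneg ((a + \<delta> *\<^sub>R 1) * (b + \<delta> *\<^sub>R 1))" by (simp add: pp qq)
  have "a * b + e *\<^sub>R 1 = (a + \<delta> *\<^sub>R 1) * (b + \<delta> *\<^sub>R 1) + \<delta> *\<^sub>R (norm a *\<^sub>R 1 - a)
      + \<delta> *\<^sub>R (norm b *\<^sub>R 1 - b) + (e - \<delta> * norm a - \<delta> * norm b - \<delta> * \<delta>) *\<^sub>R 1"
    by (simp add: algebra_simps)
  also have "nonneg \<dots>"
    using n \<delta> small assms
    by (intro nonneg_add nonneg_scaleR nonneg_norm_minus nonneg_const) (auto intro: nonneg_star)
  finally show "nonneg (a * b + e *\<^sub>R 1)" .
qed

text \<open>The inverse \<open>d = d * d * a\<close> is positive, so \<open>norm d - d\<close> and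
  \<open>a\<close> are commuting positive elements; their product \<open>norm d a - 1\<close>
  exhibits the gap \<open>1 / norm d\<close>.\<close>

lemma nonneg_invertible_gap:
  fixes a d :: "'a::unital_cstar_algebra"
  assumes "nonneg a" "a * d = 1" "d * a = 1"
  obtains \<eta> where "\<eta> > 0" "nonneg (a - \<eta> *\<^sub>R 1)"
proof
  have "star d * a = 1" using assms by (metis nonneg_star star_mult star_one)
  then have sd: "star d = d" using assms by (metis mult.assoc mult.left_neutral mult.right_neutral)
  have "nonneg (d * d * a)"
    by (intro nonneg_mult nonneg_square sd assms) (simp add: mult.assoc assms, simp add: assms flip: mult.assoc)
  then have d: "nonneg d" by (simp add: mult.assoc assms)
  have "d \<noteq> 0" using assms by auto
  then have nd: "norm d > 0" by simp
  then show "1 / norm d > 0" by simp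
  have "nonneg ((norm d *\<^sub>R 1 - d) * a)"
    by (intro nonneg_mult nonneg_norm_minus sd assms) (auto simp: algebra_simps assms)
  also have "(norm d *\<^sub>R 1 - d) * a = norm d *\<^sub>R a - 1" by (simp add: algebra_simps assms)
  finally have "nonneg ((1 / norm d) *\<^sub>R (norm d *\<^sub>R a - 1))" by (rule nonneg_scaleR) simp
  also have "(1 / norm d) *\<^sub>R (norm d *\<^sub>R a - 1) = a - (1 / norm d) *\<^sub>R 1"
    using nd by (simp add: scaleR_diff_right)
  finally show "nonneg (a - (1 / norm d) *\<^sub>R 1)" .
qed

lemma nonneg_add_const_inverse:
  fixes a :: "'a::unital_cstar_algebra" and \<delta> :: real
  assumes "nonneg a" "\<delta> > 0"
  obtains c where "(a + \<delta> *\<^sub>R 1) * c = 1" "c * (a + \<delta> *\<^sub>R 1) = 1" "nonneg c"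
    "\<And>y. a * y = y * a \<Longrightarrow> c * y = y * c"
proof -
  obtain P where P: "real_powers (a + \<delta> *\<^sub>R 1) P" using nonneg_powers[OF assms] by blast
  note PP = real_powers_halves[OF P] and P = real_powersD[OF P]
  show ?thesis
  proof
    show "(a + \<delta> *\<^sub>R 1) * P (-1) = 1" "P (-1) * (a + \<delta> *\<^sub>R 1) = 1" by (rule PP)+
    show "nonneg (P (-1))" using nonneg_square[OF P(1)[of "-1/2"]] PP(2) by simp
    show "P (-1) * y = y * P (-1)" if "a * y = y * a" for y
      by (rule P(5)) (simp add: algebra_simps that)
  qed
qed

section \<open>Positivity of \<open>star v * v\<close>\<close>

text \<open>The set of \<open>l\<close> with \<open>y\<^sup>*y + l\<close> positive is closed upwards. Its infimum cannot exceed \<open>e\<close>,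
  because \<open>y\<^sup>*y + l\<close> is invertible along with \<open>yy\<^sup>* + l\<close>.\<close>

lemma nonneg_flip:
  fixes y :: "'a::unital_cstar_algebra" and e :: real
  assumes "nonneg (y * star y + e *\<^sub>R 1)" "e \<ge> 0"
  shows "nonneg (star y * y + e *\<^sub>R 1)"
proof -
  define L where "L = {l. l \<ge> e \<and> nonneg (star y * y + l *\<^sub>R 1)}"
  have sy: "star (star y * y) = star y * y" by (simp add: star_mult)
  have "nonneg (star y * y + (norm (star y * y)) *\<^sub>R 1)"
    using nonneg_norm_minus[of "- (star y * y)" "norm (star y * y)"] sy
    by (simp add: star_minus algebra_simps)
  then have "max e (norm (star y * y)) \<in> L"
    unfolding L_def by (auto intro: nonneg_mono_const)
  then have ne: "L \<noteq> {}" by blast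
  have bd: "bdd_below L" unfolding L_def by (auto intro: bdd_belowI[of _ e])
  define l where "l = Inf L"
  have le: "e \<le> l" unfolding l_def by (rule cInf_greatest[OF ne]) (simp add: L_def)
  have nl: "nonneg (star y * y + l *\<^sub>R 1)"
  proof (rule nonneg_epsilon)
    fix d :: real assume "d > 0"
    then have "Inf L < l + d" by (simp add: l_def)
    then obtain l' where "l' \<in> L" "l' < l + d" using cInf_lessD[OF ne] by blast
    then have "nonneg (star y * y + (l + d) *\<^sub>R 1)"
      unfolding L_def by (auto intro: nonneg_mono_const)
    then show "nonneg (star y * y + l *\<^sub>R 1 + d *\<^sub>R 1)" by (simp add: algebra_simps)
  qed
  have "l \<le> e"
  proof (rule ccontr)
    assume "\<not> l \<le> e"
    then have l: "l - e > 0" "l > 0" using assms(2) by auto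
    have l': "y * star y + e *\<^sub>R 1 + (l - e) *\<^sub>R 1 = y * star y + l *\<^sub>R 1"
      by (simp add: algebra_simps)
    obtain c where c: "(y * star y + l *\<^sub>R 1) * c = 1" "c * (y * star y + l *\<^sub>R 1) = 1"
      by (rule nonneg_add_const_inverse[OF assms(1) l(1), unfolded l'])
    have c1: "y * (star y * c) = 1 - l *\<^sub>R c" and c2: "c * (y * star y) = 1 - l *\<^sub>R c"
      using c by (simp_all add: algebra_simps)
    define d where "d = (1 / l) *\<^sub>R (1 - star y * c * y)"
    have "(star y * y + l *\<^sub>R 1) * (1 - star y * c * y) = l *\<^sub>R 1"
    proof -
      have "(star y * y + l *\<^sub>R 1) * (1 - star y * c * y)
          = star y * y + l *\<^sub>R 1 - star y * (y * (star y * c)) * y - l *\<^sub>R (star y * c * y)"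
        by (simp add: algebra_simps)
      also have "star y * (y * (star y * c)) * y = star y * y - l *\<^sub>R (star y * c * y)"
        unfolding c1 by (simp add: algebra_simps)
      finally show ?thesis by simp
    qed
    then have d1: "(star y * y + l *\<^sub>R 1) * d = 1" using l by (simp add: d_def)
    have "(1 - star y * c * y) * (star y * y + l *\<^sub>R 1) = l *\<^sub>R 1"
    proof -
      have "(1 - star y * c * y) * (star y * y + l *\<^sub>R 1)
          = star y * y + l *\<^sub>R 1 - star y * (c * (y * star y)) * y - l *\<^sub>R (star y * c * y)"
        by (simp add: algebra_simps)
      also have "star y * (c * (y * star y)) * y = star y * y - l *\<^sub>R (star y * c * y)"
        unfolding c2 by (simp add: algebra_simps)
      finally show ?thesis by simp
    qed
    then have d2: "d * (star y * y + l *\<^sub>R 1) = 1" using l by (simp add: d_def)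
    obtain \<eta> where \<eta>: "\<eta> > 0" "nonneg (star y * y + l *\<^sub>R 1 - \<eta> *\<^sub>R 1)"
      using nonneg_invertible_gap[OF nl d1 d2] by blast
    have "nonneg (star y * y + (l - \<eta>) *\<^sub>R 1)" using \<eta>(2) by (simp add: algebra_simps)
    \<comment> \<open>Invertibility leaves a gap \<eta>, so a number below the infimum
      \<open>l\<close> belongs to \<open>L\<close>; the maximum respects the lower bound
      \<open>e\<close>.\<close>
    then have "max e (l - \<eta>) \<in> L" unfolding L_def by (auto intro: nonneg_mono_const)
    then have "l \<le> max e (l - \<eta>)" unfolding l_def by (rule cInf_lower[OF _ bd])
    then show False using l \<eta> by linarith
  qed
  with le nl show ?thesis by simp
qed

text \<open>Up to factors, \<open>a\<close> and \<open>b\<close> are the real and imaginary parts of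
  \<open>z\<close>; the terms \<open>z * z\<close> and \<open>star z * star z\<close> cancel in the
  sum of their squares.\<close>

lemma nonneg_star_mult_add:
  fixes z :: "'a::unital_cstar_algebra"
  shows "nonneg (z * star z + star z * z)"
proof -
  define a where "a = z + star z"
  define b where "b = \<i> *\<^sub>C (z - star z)"
  have "nonneg (a * a)" by (rule nonneg_square) (simp add: a_def star_add add.commute)
  moreover have "nonneg (b * b)"
    by (rule nonneg_square) (simp add: b_def star_scaleC star_diff scaleC_minus_left flip: scaleC_minus_right)
  ultimately have "nonneg ((1/2) *\<^sub>R (a * a + b * b))" by (intro nonneg_scaleR nonneg_add) auto
  also have "(1/2) *\<^sub>R (a * a + b * b) = z * star z + star z * z"
  proof -
    have "b * b = - ((z - star z) * (z - star z))"
      by (simp add: b_def scaleC_scaleC scaleC_minus_left scaleC_one)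
    then have "a * a + b * b = 2 *\<^sub>R (z * star z + star z * z)"
      by (simp add: a_def algebra_simps scaleR_2)
    then show ?thesis by simp
  qed
  finally show ?thesis .
qed

text \<open>Kaplansky's argument: let \<open>g = |h| - h\<close> be twice the negative part of \<open>h = v\<^sup>*v\<close>, up to \<open>\<delta>\<close>. For
  \<open>z = vg\<close> the element \<open>z\<^sup>*z = ghg\<close> is almost negative, hence by \<open>nonneg_star_mult_add\<close> and
  \<open>nonneg_flip\<close> also almost positive, so \<open>g\<close> is small.\<close>

lemma nonneg_star_mult_self:
  fixes v :: "'a::unital_cstar_algebra"
  shows "nonneg (star v * v)"
proof (rule nonneg_epsilon)
  fix \<eta> :: real assume \<eta>: "\<eta> > 0"
  define h where "h = star v * v"
  have sh: "star h = h" by (simp add: h_def star_mult)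
  define K where "K = 2 * norm h + 1"
  have K: "K > 0" using norm_ge_zero[of h] by (simp add: K_def add_nonneg_pos)
  \<comment> \<open>Chosen so that the final estimate of \<open>g * (g * g)\<close> is at most
    \<open>\<eta> ^ 3\<close>; the cap 1 is what makes \<open>K\<close> a bound for
    \<open>norm g\<close>.\<close>
  define \<delta> where "\<delta> = min 1 (sqrt (\<eta> ^ 3 / (2 * K)))"
  have \<delta>: "\<delta> > 0" "\<delta> \<le> 1" using \<eta> K by (auto simp: \<delta>_def)
  have "\<delta>\<^sup>2 \<le> (sqrt (\<eta> ^ 3 / (2 * K)))\<^sup>2" using \<delta> by (intro power_mono) (auto simp: \<delta>_def)
  also have "\<dots> = \<eta> ^ 3 / (2 * K)" using \<eta> K by simp
  finally have small: "2 * (\<delta>\<^sup>2 * K) \<le> \<eta> ^ 3" using K by (simp add: field_simps)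
  have \<delta>2: "\<delta>\<^sup>2 > 0" using \<delta> by simp
  obtain P where P: "real_powers (h * h + \<delta>\<^sup>2 *\<^sub>R 1) P"
    using nonneg_powers[OF nonneg_square[OF sh] \<delta>2] by blast
  note PP = real_powers_halves[OF P] and P = real_powersD[OF P]
  have comm: "P s * h = h * P s" for s
    by (rule P(5)) (simp add: algebra_simps)
  define q where "q = P (1/2)"
  define g where "g = q - h"
  have qq: "q * q = h * h + \<delta>\<^sup>2 *\<^sub>R 1" by (simp add: q_def PP)
  have sq: "star q = q" by (simp add: q_def P)
  have qh: "q * h = h * q" by (simp add: q_def comm)
  have "q = P (1/4) * P (1/4)" by (simp add: q_def P)
  then have nq: "nonneg q" using nonneg_square[OF P(1)[of "1/4"]] by simp
  have sg: "star g = g" by (simp add: g_def star_diff sq sh)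
  have gh: "g * h = h * g" by (simp add: g_def algebra_simps qh)
  have gg: "g * g + \<delta>\<^sup>2 *\<^sub>R 1 = 2 *\<^sub>R (q * g)"
    unfolding scaleR_2 by (simp add: g_def left_diff_distrib right_diff_distrib qq qh)
  have ghd: "2 *\<^sub>R (g * h) = \<delta>\<^sup>2 *\<^sub>R 1 - g * g"
    unfolding scaleR_2 by (simp add: g_def left_diff_distrib right_diff_distrib qq qh)
  \<comment> \<open>The regularisation makes \<open>q\<close> invertible, and \<open>2 g\<close> is
    the product of its inverse with \<open>g * g + \<delta>\<^sup>2\<close>, two commuting positive
    elements.\<close>
  have ng: "nonneg g"
  proof -
    have "P (-1/2) * q = 1" using P(2)[of "-1/2" "1/2"] P(3) by (simp add: q_def)
    then have eq: "P (-1/2) * (g * g + \<delta>\<^sup>2 *\<^sub>R 1) = 2 *\<^sub>R g"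
      unfolding gg by (simp flip: mult.assoc)
    have "P (-1/2) = P (-1/4) * P (-1/4)" by (simp add: P)
    then have "nonneg (P (-1/2))" using nonneg_square[OF P(1)[of "-1/4"]] by simp
    moreover have "nonneg (g * g + \<delta>\<^sup>2 *\<^sub>R 1)" by (intro nonneg_add nonneg_square nonneg_const sg) simp
    moreover have "P (-1/2) * g = g * P (-1/2)"
      using comm[of "-1/2"] P(2)[of "-1/2" "1/2"] P(2)[of "1/2" "-1/2"] by (simp add: g_def q_def algebra_simps)
    then have "P (-1/2) * (g * g + \<delta>\<^sup>2 *\<^sub>R 1) = (g * g + \<delta>\<^sup>2 *\<^sub>R 1) * P (-1/2)"
      by (simp add: algebra_simps) (metis mult.assoc)
    ultimately have "nonneg (2 *\<^sub>R g)" unfolding eq[symmetric] by (rule nonneg_mult)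
    from nonneg_scaleR[OF this, of "1/2"] show ?thesis by simp
  qed
  have gK: "norm g \<le> K"
  proof -
    have "(norm q)\<^sup>2 = norm (h * h + \<delta>\<^sup>2 *\<^sub>R 1)" using cstar_identity[of q] by (simp add: sq qq)
    also have "\<dots> \<le> norm h * norm h + \<delta>\<^sup>2 * 1"
      by (rule order_trans[OF norm_triangle_ineq]) (simp add: norm_mult_ineq)
    also have "\<dots> \<le> norm h * norm h + 1"
      using \<delta> by (simp add: power_le_one)
    also have "\<dots> \<le> (norm h + 1)\<^sup>2" by (simp add: power2_eq_square algebra_simps)
    finally have "norm q \<le> norm h + 1" by (rule power2_le_imp_le) simp
    then show ?thesis unfolding g_def K_def using norm_triangle_ineq4[of q h] by linarith
  qed
  define z where "z = v * g"
  have "star z * z = g * h * g" by (simp add: z_def star_mult sg h_def mult.assoc)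
  then have zz: "2 *\<^sub>R (star z * z) = \<delta>\<^sup>2 *\<^sub>R g - g * (g * g)"
  proof -
    have "2 *\<^sub>R (g * h * g) = (2 *\<^sub>R (g * h)) * g" by simp
    then show ?thesis unfolding \<open>star z * z = _\<close> ghd by (simp add: algebra_simps)
  qed
  define e where "e = \<delta>\<^sup>2 * K / 2"
  have e: "e \<ge> 0" using K by (simp add: e_def)
  have "nonneg ((1/2) *\<^sub>R (g * (g * g) + \<delta>\<^sup>2 *\<^sub>R (K *\<^sub>R 1 - g)))"
    by (intro nonneg_scaleR nonneg_add nonneg_mult nonneg_square nonneg_norm_minus ng sg gK)
      (simp_all add: mult.assoc)
  also have "(1/2) *\<^sub>R (g * (g * g) + \<delta>\<^sup>2 *\<^sub>R (K *\<^sub>R 1 - g)) = e *\<^sub>R 1 - star z * z"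
  proof -
    have "(1/2) *\<^sub>R (2 *\<^sub>R (star z * z)) = (1/2) *\<^sub>R (\<delta>\<^sup>2 *\<^sub>R g - g * (g * g))" by (simp only: zz)
    then show ?thesis by (simp add: e_def algebra_simps)
  qed
  finally have n1: "nonneg (e *\<^sub>R 1 - star z * z)" .
  have "nonneg ((z * star z + star z * z) + (e *\<^sub>R 1 - star z * z))"
    by (rule nonneg_add[OF nonneg_star_mult_add n1])
  then have "nonneg (z * star z + e *\<^sub>R 1)" by (simp add: algebra_simps)
  then have n2: "nonneg (e *\<^sub>R 1 + star z * z)" using nonneg_flip e by (simp add: add.commute)
  have nz: "norm (star z * z) \<le> e" by (rule norm_le_if_nonneg[OF n1 n2 e])
  have "g * (g * g) = \<delta>\<^sup>2 *\<^sub>R g - 2 *\<^sub>R (star z * z)" by (simp add: zz)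
  then have "norm (g * (g * g)) \<le> \<delta>\<^sup>2 * norm g + 2 * norm (star z * z)"
    using norm_triangle_ineq4[of "\<delta>\<^sup>2 *\<^sub>R g" "2 *\<^sub>R (star z * z)"] by simp
  also have "\<dots> \<le> \<delta>\<^sup>2 * K + 2 * e" using gK nz by (intro add_mono mult_left_mono) auto
  also have "\<dots> \<le> \<eta> ^ 3" using small by (simp add: e_def mult.commute)
  finally have g3: "norm (g * (g * g)) \<le> \<eta> ^ 3" .
  have "norm g \<le> \<eta>"
  proof (rule ccontr)
    assume "\<not> norm g \<le> \<eta>"
    then have g: "norm g > \<eta>" "norm g > 0" using \<eta> by auto
    have n2: "norm (x * x) = norm x * norm x" if "star x = x" for x :: 'a
      using cstar_identity[of x] that by (simp add: power2_eq_square)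
    \<comment> \<open>The C*-identity for the self-adjoint \<open>g\<close> and \<open>g * g\<close>
      gives the fourth power of the norm, and one factor \<open>g\<close> is split off.\<close>
    have "norm g * norm g * (norm g * norm g) = norm ((g * g) * (g * g))"
      by (simp only: n2[OF sg] n2[of "g * g"] star_mult sg)
    also have "\<dots> \<le> norm g * norm (g * (g * g))"
      by (metis norm_mult_ineq mult.assoc)
    also have "\<dots> \<le> norm g * \<eta> ^ 3" using g3 by (intro mult_left_mono) auto
    finally have "norm g ^ 3 \<le> \<eta> ^ 3" using g by (simp add: power3_eq_cube mult.assoc)
    moreover have "\<eta> ^ 3 < norm g ^ 3" using g \<eta> by (intro power_strict_mono) auto
    ultimately show False by simp
  qed
  then have "nonneg (q + (\<eta> *\<^sub>R 1 - g))" by (intro nonneg_add nq nonneg_norm_minus sg)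
  then show "nonneg (star v * v + \<eta> *\<^sub>R 1)" by (simp add: g_def h_def algebra_simps)
qed

section \<open>Norm estimates and the polar decomposition\<close>

lemma norm_mono_nonneg:
  assumes "nonneg a" "nonneg (b - a)"
  shows "norm (a :: 'a::unital_cstar_algebra) \<le> norm b"
proof (rule norm_le_if_nonneg)
  have b: "star b = b" using nonneg_star[OF assms(1)] nonneg_star[OF assms(2)] by (simp add: star_diff)
  have "nonneg ((norm b *\<^sub>R 1 - b) + (b - a))"
    by (intro nonneg_add assms nonneg_norm_minus b) simp
  then show "nonneg (norm b *\<^sub>R 1 - a)" by simp
  show "nonneg (norm b *\<^sub>R 1 + a)" by (intro nonneg_add assms nonneg_const) simp
qed simp

text \<open>Positivity of \<open>star v * v\<close> together with norm at most 1 makes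
  \<open>1 - star v * v\<close> a contraction.\<close>

lemma norm_diff_contraction:
  fixes v x :: "'a::unital_cstar_algebra"
  assumes "norm v \<le> 1"
  shows "norm (x - star v * v * x) \<le> norm x"
proof -
  have "norm (star v * v) \<le> 1" using assms by (simp add: cstar_identity power_le_one)
  then have "norm (1 *\<^sub>R 1 - star v * v) \<le> 1" by (rule nonneg_norm_le[OF nonneg_star_mult_self])
  then have "norm ((1 - star v * v) * x) \<le> norm x" by (intro norm_mult_le(1)) simp
  then show ?thesis by (simp add: algebra_simps)
qed

text \<open>\<open>1 + s\<close> is bounded below by 1: in
  \<open>(1 + K) y = (1 + s) y + (K - s) y\<close> the last term costs at most
  \<open>K * norm y\<close>. This turns \<open>s * s * c \<approx> c\<close> into
  \<open>s * c \<approx> c\<close>.\<close>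

lemma norm_le_add_nonneg:
  fixes s y :: "'a::unital_cstar_algebra"
  assumes "nonneg s"
  shows "norm y \<le> norm (y + s * y)"
proof -
  define K where "K = norm s"
  have "norm (K *\<^sub>R 1 - s) \<le> K" by (rule nonneg_norm_le[OF assms]) (simp add: K_def)
  then have "norm ((K *\<^sub>R 1 - s) * y) \<le> K * norm y"
    by (intro order_trans[OF norm_mult_ineq] mult_right_mono) auto
  moreover have "(1 + K) *\<^sub>R y = (y + s * y) + (K *\<^sub>R 1 - s) * y" by (simp add: algebra_simps)
  then have "norm ((1 + K) *\<^sub>R y) \<le> norm (y + s * y) + norm ((K *\<^sub>R 1 - s) * y)"
    by (metis norm_triangle_ineq)
  ultimately show ?thesis by (simp add: K_def distrib_right)
qed

text \<open>Invertibility leaves a gap below \<open>star x * x\<close>, so this element itself, not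
  a perturbation of it, has real powers; \<open>u\<close> is \<open>x\<close> times the inverse
  root.\<close>

lemma polar_decomposition:
  fixes x :: "'a::unital_cstar_algebra"
  assumes "x \<in> general_linear"
  obtains u s where "unitary u" "x = u * s" "nonneg s" "s * s = star x * x"
proof -
  obtain y where y: "x * y = 1" "y * x = 1" using assms by (auto simp: general_linear_def)
  define h where "h = star x * x"
  have nh: "nonneg h" unfolding h_def by (rule nonneg_star_mult_self)
  have sy: "star x * star y = 1" "star y * star x = 1"
    by (metis y star_mult star_one)+
  have inv: "h * (y * star y) = 1" "(y * star y) * h = 1"
    unfolding h_def by (metis y sy mult.assoc mult.left_neutral)+
  obtain \<eta> where \<eta>: "\<eta> > 0" "nonneg (h - \<eta> *\<^sub>R 1)"
    using nonneg_invertible_gap[OF nh inv] by blast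
  obtain P where P: "real_powers ((h - \<eta> *\<^sub>R 1) + \<eta> *\<^sub>R 1) P" using nonneg_powers[OF \<eta>(2,1)] by blast
  then have P: "real_powers h P" by simp
  note PP = real_powers_halves[OF P] and P = real_powersD[OF P]
  define s where "s = P (1/2)"
  define u where "u = x * P (-1/2)"
  have ps: "P (-1/2) * s = 1" "s * P (-1/2) = 1"
    using P(2)[of "-1/2" "1/2"] P(2)[of "1/2" "-1/2"] P(3) by (simp_all add: s_def)
  have "star u * u = P (-1/2) * h * P (-1/2)"
    by (simp add: u_def star_mult P h_def mult.assoc)
  also have "\<dots> = 1" unfolding PP(1)[symmetric] s_def[symmetric] by (metis ps mult.assoc mult.left_neutral)
  finally have u1: "star u * u = 1" .
  have "u * (s * y) = 1" unfolding u_def by (metis ps y mult.assoc mult.left_neutral)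
  then have "s * y = star u" by (metis u1 mult.assoc mult.left_neutral mult.right_neutral)
  then have "u * star u = 1" using \<open>u * (s * y) = 1\<close> by simp
  with u1 have "unitary u" by (simp add: unitary_def)
  moreover have "x = u * s" unfolding u_def by (simp only: mult.assoc ps mult_1_right)
  moreover have "s = P (1/4) * P (1/4)" by (simp add: s_def P)
  then have "nonneg s" using nonneg_square[OF P(1)[of "1/4"]] by simp
  moreover have "s * s = star x * x" by (simp add: s_def PP h_def)
  ultimately show ?thesis by (rule that)
qed

section \<open>Approximate units\<close>

lemma unit_emb_simps:
  "unit_emb (x + y) = unit_emb x + unit_emb y" "unit_emb (x - y) = unit_emb x - unit_emb y"
  "unit_emb (x * y) = unit_emb x * unit_emb y" "unit_emb (star x) = star (unit_emb x)"
  "unit_emb (c *\<^sub>C x) = c *\<^sub>C unit_emb x" "unit_emb (r *\<^sub>R x) = r *\<^sub>R unit_emb x"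
  "unit_emb 0 = 0" "unit_emb (- x) = - unit_emb x"
  by (simp_all add: unit_emb_def unitization_ops scaleR_scaleC)

lemma norm_unit_emb [simp]: "norm (unit_emb x) = norm x"
  by (simp add: unit_emb_def norm_unitization_def onorm_unit_lmul_Unitization)

lemma unit_emb_eq_iff [simp]: "unit_emb x = unit_emb y \<longleftrightarrow> x = y"
  by (simp add: unit_emb_def)

lemma range_unit_emb_iff: "p \<in> range unit_emb \<longleftrightarrow> scalar_part p = 0"
  by (auto simp: unit_emb_def image_iff) (metis unitization.collapse)

lemma unit_emb_unit_lmul: "unit_emb (unit_lmul w x) = w * unit_emb x"
  by (simp add: unit_lmul_def unit_emb_def unitization_ops)

lemma range_unit_emb_ideal:
  "p \<in> range unit_emb \<Longrightarrow> p * q \<in> range unit_emb" "p \<in> range unit_emb \<Longrightarrow> q * p \<in> range unit_emb"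
  by (auto simp: range_unit_emb_iff times_unitization_def)

text \<open>The candidate is \<open>k / (k + \<delta>)\<close> for \<open>k\<close> the sum of all
  \<open>b * star b\<close>. Its defect \<open>d = \<delta> c\<close> satisfies
  \<open>d b (star b) d \<le> d k d\<close>, whose norm is at most \<delta>; hence the choice of
  \<delta> below the square of \<epsilon>.\<close>

lemma approximate_unit:
  fixes F :: "'a::cstar_algebra set"
  assumes "finite F" "\<epsilon> > 0"
  shows "\<exists>e. star e = e \<and> norm e \<le> 1 \<and> (\<forall>a\<in>F. norm (e * a - a) < \<epsilon> \<and> norm (a * e - a) < \<epsilon>)"
proof -
  define \<delta> where "\<delta> = \<epsilon>\<^sup>2 / 2"
  have \<delta>: "\<delta> > 0" "\<delta> < \<epsilon>\<^sup>2" using assms(2) by (auto simp: \<delta>_def)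
  \<comment> \<open>Closed under adjoints, so that the estimate from the left also yields the one
    from the right.\<close>
  define G where "G = unit_emb ` F \<union> star ` unit_emb ` F"
  have fG: "finite G" using assms by (simp add: G_def)
  define k where "k = (\<Sum>b\<in>G. b * star b)"
  have nb: "nonneg (b * star b)" for b :: "'a unitization"
    using nonneg_star_mult_self[of "star b"] by simp
  have nk: "nonneg k" unfolding k_def by (intro nonneg_sum nb)
  obtain c where c: "(k + \<delta> *\<^sub>R 1) * c = 1" "c * (k + \<delta> *\<^sub>R 1) = 1" "nonneg c"
    "\<And>y. k * y = y * k \<Longrightarrow> c * y = y * c"
    using nonneg_add_const_inverse[OF nk \<delta>(1)] by blast
  have ck: "c * k = k * c" by (rule c(4)) simp
  have kc: "k * c = 1 - \<delta> *\<^sub>R c" using c(1) by (simp add: algebra_simps)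
  have sc: "star c = c" by (rule nonneg_star[OF c(3)])
  have nkc: "nonneg (k * c)" by (intro nonneg_mult nk c(3) ck[symmetric])
  have n1: "norm (k * c) \<le> 1"
    by (rule norm_le_if_nonneg)
      (use nonneg_scaleR[OF c(3), of \<delta>] \<delta> nkc in \<open>simp_all add: kc nonneg_add\<close>)
  have n2: "norm (\<delta> *\<^sub>R c) \<le> 1"
    by (rule norm_le_if_nonneg)
      (use nonneg_scaleR[OF c(3), of \<delta>] \<delta> nkc in \<open>simp_all add: kc nonneg_add\<close>)
  have "scalar_part b = 0" if "b \<in> G" for b
    using that by (auto simp: G_def unit_emb_def star_unitization_def)
  then have bb: "b * star b \<in> range unit_emb" if "b \<in> G" for b
    using that by (auto simp: range_unit_emb_iff times_unitization_def)
  have sumr: "finite S \<Longrightarrow> (\<And>b. b \<in> S \<Longrightarrow> f b \<in> range unit_emb) \<Longrightarrow> sum f S \<in> range unit_emb"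
    for S and f :: "'a unitization \<Rightarrow> 'a unitization"
    by (induction S rule: finite_induct)
      (auto simp: range_unit_emb_iff plus_unitization_def zero_unitization_def)
  have "k \<in> range unit_emb" unfolding k_def by (rule sumr[OF fG bb])
  then have "k * c \<in> range unit_emb" by (rule range_unit_emb_ideal)
  then obtain e where "k * c = unit_emb e" by blast
  note e = this[symmetric]
  have key: "norm (k * c * b - b) < \<epsilon>" if b: "b \<in> G" for b
  proof -
    define d where "d = \<delta> *\<^sub>R c"
    have eq: "k * c * b - b = - (d * b)" by (simp add: kc d_def algebra_simps)
    have sd: "star d = d" by (simp add: d_def star_scaleR sc)
    have "(norm (d * b))\<^sup>2 = norm (d * (b * star b) * d)"
      using norm_mult_star_self[of "d * b"] by (simp add: star_mult sd mult.assoc)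
    also have "\<dots> \<le> norm (d * k * d)"
    proof (rule norm_mono_nonneg)
      have *: "nonneg (d * (y * star y) * d)" for y
        using nb[of "d * y"] by (simp add: star_mult sd mult.assoc)
      then show "nonneg (d * (b * star b) * d)" .
      have "k = b * star b + (\<Sum>y\<in>G - {b}. y * star y)" unfolding k_def by (rule sum.remove[OF fG b])
      then have "d * k * d - d * (b * star b) * d = (\<Sum>y\<in>G - {b}. d * (y * star y) * d)"
        by (simp add: algebra_simps sum_distrib_left sum_distrib_right)
      then show "nonneg (d * k * d - d * (b * star b) * d)" by (simp add: nonneg_sum *)
    qed
    also have "d * k * d = \<delta> *\<^sub>R ((k * c) * (\<delta> *\<^sub>R c))"
      by (simp add: d_def ck)
    also have "norm \<dots> = \<delta> * norm ((k * c) * (\<delta> *\<^sub>R c))" using \<delta> by simp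
    also have "\<dots> \<le> \<delta> * (norm (k * c) * norm (\<delta> *\<^sub>R c))"
      using \<delta> by (intro mult_left_mono norm_mult_ineq) simp
    also have "\<dots> \<le> \<delta> * (1 * 1)" using \<delta> n1 n2 by (intro mult_left_mono mult_mono) auto
    also have "\<dots> < \<epsilon>\<^sup>2" using \<delta> by simp
    finally have "norm (d * b) < \<epsilon>" by (rule power2_less_imp_less) (use assms in simp)
    then show ?thesis by (simp add: eq)
  qed
  have se: "star (unit_emb e) = unit_emb e" unfolding e using nonneg_star[OF nkc] .
  show ?thesis
  proof (intro exI[of _ e] conjI ballI)
    show "star e = e" using se by (simp flip: unit_emb_simps)
    show "norm e \<le> 1" using n1 by (simp flip: e)
    fix a assume a: "a \<in> F"
    show "norm (e * a - a) < \<epsilon>"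
      using key[of "unit_emb a"] a by (simp add: G_def flip: e unit_emb_simps)
    have "norm (star (unit_emb (a * e - a))) < \<epsilon>"
      using key[of "star (unit_emb a)"] a by (simp add: G_def star_diff star_mult se unit_emb_simps flip: e)
    then show "norm (a * e - a) < \<epsilon>" by simp
  qed
qed

section \<open>Contractivity of homomorphisms\<close>

lemma clinearD:
  assumes "clinear f"
  shows "f (x + y) = f x + f y" "f (c *\<^sub>C x) = c *\<^sub>C f x" "f (r *\<^sub>R x) = r *\<^sub>R f x"
    "f 0 = 0" "f (- x) = - f x" "f (x - y) = f x - f y"
proof -
  show add: "f (x + y) = f x + f y" for x y using assms by (simp add: clinear_def)
  show sc: "f (c *\<^sub>C x) = c *\<^sub>C f x" for c x using assms by (simp add: clinear_def)
  show "f (r *\<^sub>R x) = r *\<^sub>R f x" by (simp add: scaleR_scaleC sc)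
  show "f 0 = 0" using sc[of 0 0] by simp
  show neg: "f (- x) = - f x" for x using sc[of "-1" x] by (simp add: scaleC_minus_left scaleC_one)
  show "f (x - y) = f x - f y" using add[of x "- y"] neg[of y] by simp
qed

text \<open>A self-adjoint \<open>h\<close> of norm below 1 is the mean of a unitary and its
  adjoint, so multiplication by \<open>\<theta> h\<close> is contractive on the range; taking
  \<open>h\<close> itself as the second factor bounds \<open>\<theta> h\<close>. The assumption on
  adjoints is weaker than \<open>\<theta> (star x) = star (\<theta> x)\<close>, which for \<phi> is
  derived only afterwards, by means of this bound.\<close>

lemma norm_hom_le:
  fixes \<theta> :: "'a::cstar_algebra \<Rightarrow> 'b::cstar_algebra"
  assumes lin: "clinear \<theta>" and mult: "\<And>x y. \<theta> (x * y) = \<theta> x * \<theta> y"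
    and star: "\<And>x y. star (\<theta> x) * \<theta> y = \<theta> (star x * y)"
  shows "norm (\<theta> x) \<le> norm x"
proof -
  note lin = clinearD[OF lin]
  have sq: "(norm (\<theta> z))\<^sup>2 = norm (\<theta> (star z * z))" for z
    by (simp flip: cstar_identity star)
  \<comment> \<open>The unitary lies outside the domain of \<theta>, so only its products with
    elements of the algebra are compared: \<open>y\<close> and \<open>w y\<close> have the same
    \<open>star y * y\<close>.\<close>
  have uni: "norm (\<theta> (unit_lmul w y)) = norm (\<theta> y)" if w: "unitary w" for w y
  proof -
    have "unit_emb (star (unit_lmul w y) * unit_lmul w y) = star (unit_emb y) * (star w * w) * unit_emb y"
      by (simp add: unit_emb_simps unit_emb_unit_lmul star_mult mult.assoc)
    also have "\<dots> = unit_emb (star y * y)" using w by (simp add: unitary_def unit_emb_simps)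
    finally have "(norm (\<theta> (unit_lmul w y)))\<^sup>2 = (norm (\<theta> y))\<^sup>2" by (simp add: sq)
    then show ?thesis by simp
  qed
  have small: "norm (\<theta> h * \<theta> y) \<le> norm (\<theta> y)" if h: "star h = h" "norm h < 1" for h y
  proof -
    obtain w where w: "unitary w" "2 *\<^sub>R unit_emb h = w + star w"
      using unitary_average[of "unit_emb h"] h by (metis norm_unit_emb unit_emb_simps(4))
    have w': "unitary (star w)" using w by (simp add: unitary_def)
    have "unit_emb (2 *\<^sub>R (h * y)) = (2 *\<^sub>R unit_emb h) * unit_emb y" by (simp add: unit_emb_simps)
    also have "\<dots> = unit_emb (unit_lmul w y + unit_lmul (star w) y)"
      unfolding w(2) by (simp add: unit_emb_simps unit_emb_unit_lmul distrib_right)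
    finally have "2 *\<^sub>R (h * y) = unit_lmul w y + unit_lmul (star w) y" by simp
    then have "2 *\<^sub>R (\<theta> h * \<theta> y) = \<theta> (unit_lmul w y) + \<theta> (unit_lmul (star w) y)"
      by (metis lin(1,3) mult)
    then have "2 * norm (\<theta> h * \<theta> y) \<le> norm (\<theta> (unit_lmul w y)) + norm (\<theta> (unit_lmul (star w) y))"
      by (metis norm_scaleR norm_triangle_ineq abs_numeral)
    then show ?thesis by (simp add: uni w w')
  qed
  have sa: "norm (\<theta> h) \<le> norm h" if h: "star h = h" for h
  proof (rule dense_ge)
    fix r assume r: "norm h < r"
    then have r0: "r > 0" using norm_ge_zero[of h] by linarith
    have "norm (\<theta> (h /\<^sub>R r) * \<theta> h) \<le> norm (\<theta> h)"
    proof (rule small)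
      show "star (h /\<^sub>R r) = h /\<^sub>R r" by (simp add: star_scaleR h)
      show "norm (h /\<^sub>R r) < 1" unfolding norm_divideR[OF r0] using r r0 by simp
    qed
    then have "norm (\<theta> h * \<theta> h) / r \<le> norm (\<theta> h)"
      using r0 by (simp add: lin divide_inverse mult.commute)
    then have "norm (\<theta> h * \<theta> h) \<le> r * norm (\<theta> h)" using r0 by (simp add: field_simps)
    moreover have "norm (\<theta> h * \<theta> h) = norm (\<theta> h) * norm (\<theta> h)"
      using sq[of h] h by (simp add: mult power2_eq_square)
    ultimately have "norm (\<theta> h) * norm (\<theta> h) \<le> r * norm (\<theta> h)" by simp
    then show "norm (\<theta> h) \<le> r" using r0 by (cases "\<theta> h = 0") auto
  qed
  have "(norm (\<theta> x))\<^sup>2 \<le> norm (star x * x)" unfolding sq by (rule sa) (simp add: star_mult)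
  then have "(norm (\<theta> x))\<^sup>2 \<le> (norm x)\<^sup>2" by (simp add: cstar_identity)
  then show ?thesis by (rule power2_le_imp_le) simp
qed

definition star_hom :: "('a::star_algebra \<Rightarrow> 'b::star_algebra) \<Rightarrow> bool" where
  "star_hom f \<longleftrightarrow> clinear f \<and> (\<forall>x y. f (x * y) = f x * f y) \<and> (\<forall>x. f (star x) = star (f x))"

lemma norm_star_hom_le:
  fixes f :: "'a::cstar_algebra \<Rightarrow> 'b::cstar_algebra"
  assumes "star_hom f"
  shows "norm (f x) \<le> norm x"
  using assms by (intro norm_hom_le) (auto simp: star_hom_def)

lemma star_automorphism_imp_star_hom: "star_automorphism f \<Longrightarrow> star_hom f"
  by (simp add: star_automorphism_def star_hom_def)

lemma bounded_linear_star_hom: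
  fixes f :: "'a::cstar_algebra \<Rightarrow> 'b::cstar_algebra"
  assumes "star_hom f"
  shows "bounded_linear f"
proof -
  have "clinear f" using assms by (simp add: star_hom_def)
  then show ?thesis
    using norm_star_hom_le[OF assms]
    by (intro bounded_linear_intro[where K = 1]) (simp_all add: clinearD)
qed

lemma star_hom_unit_ext:
  assumes "star_hom f"
  shows "star_hom (unit_ext f)"
proof -
  have "clinear f" using assms by (simp add: star_hom_def)
  then show ?thesis
    using assms unfolding star_hom_def
    by (auto simp: clinear_def unit_ext_def unitization_ops)
qed

lemma norm_diff_contraction_nonunital:
  fixes v x :: "'a::cstar_algebra"
  assumes "norm v \<le> 1"
  shows "norm (x - star v * v * x) \<le> norm x"
proof -
  have "norm (unit_emb (x - star v * v * x)) \<le> norm (unit_emb x)"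
    using norm_diff_contraction[of "unit_emb v" "unit_emb x"] assms by (simp add: unit_emb_simps)
  then show ?thesis by simp
qed

section \<open>Limits\<close>

lemma tendsto_0_mult_bounded:
  fixes f g :: "'i \<Rightarrow> 'a::real_normed_algebra"
  assumes "(f \<longlongrightarrow> 0) F" "\<forall>\<^sub>F i in F. norm (g i) \<le> C"
  shows "((\<lambda>i. f i * g i) \<longlongrightarrow> 0) F" "((\<lambda>i. g i * f i) \<longlongrightarrow> 0) F"
proof -
  have z: "((\<lambda>i. norm (f i) * C) \<longlongrightarrow> 0) F"
    using tendsto_mult_right[OF tendsto_norm_zero[OF assms(1)], of C] by (simp add: mult.commute)
  show "((\<lambda>i. f i * g i) \<longlongrightarrow> 0) F"
  proof (rule Lim_null_comparison[OF _ z])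
    show "\<forall>\<^sub>F i in F. norm (f i * g i) \<le> norm (f i) * C"
      using assms(2)
      by eventually_elim (meson mult_left_mono norm_ge_zero norm_mult_ineq order_trans)
  qed
  show "((\<lambda>i. g i * f i) \<longlongrightarrow> 0) F"
  proof (rule Lim_null_comparison[OF _ z])
    show "\<forall>\<^sub>F i in F. norm (g i * f i) \<le> norm (f i) * C"
      using assms(2)
      by eventually_elim (metis mult.commute mult_left_mono norm_ge_zero norm_mult_ineq order_trans)
  qed
qed

lemma tendsto_if_dense:
  fixes L :: "'i \<Rightarrow> 'a::real_normed_vector \<Rightarrow> 'b::real_normed_vector"
  assumes "\<And>\<epsilon>. \<epsilon> > 0 \<Longrightarrow> \<exists>b. norm (b - a) < \<epsilon> \<and> ((\<lambda>i. L i b) \<longlongrightarrow> l b) F"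
    and "\<And>i x y. norm (L i x - L i y) \<le> C * norm (x - y)" and "\<And>x y. norm (l x - l y) \<le> C * norm (x - y)"
    and "C > 0"
  shows "((\<lambda>i. L i a) \<longlongrightarrow> l a) F"
proof (rule tendstoI)
  fix e :: real assume e: "e > 0"
  then obtain b where b: "norm (b - a) < e / (3 * C)" "((\<lambda>i. L i b) \<longlongrightarrow> l b) F"
    using assms(1)[of "e / (3 * C)"] assms(4) by auto
  have small: "C * norm (b - a) < e / 3" using b(1) assms(4) by (simp add: field_simps)
  from b(2) have "\<forall>\<^sub>F i in F. dist (L i b) (l b) < e / 3" using e by (intro tendstoD) auto
  then show "\<forall>\<^sub>F i in F. dist (L i a) (l a) < e"
  proof eventually_elim
    case (elim i)
    have "dist (L i a) (L i b) \<le> C * norm (b - a)" "dist (l b) (l a) \<le> C * norm (b - a)"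
      using assms(2)[of i b a] assms(3)[of b a] by (simp_all add: dist_norm norm_minus_commute)
    then show ?case
      using elim small dist_triangle[of "L i a" "l a" "L i b"] dist_triangle[of "L i b" "l a" "l b"] by linarith
  qed
qed

lemma LIMSEQ_if_norm_less_inverse:
  fixes f :: "nat \<Rightarrow> 'a::real_normed_vector"
  assumes "\<And>n. n \<ge> N \<Longrightarrow> norm (f n) < 1 / (real n + 1)"
  shows "f \<longlonglongrightarrow> 0"
proof (rule Lim_null_comparison)
  show "\<forall>\<^sub>F n in sequentially. norm (f n) \<le> 1 / (real n + 1)"
    using assms by (auto simp: eventually_sequentially intro!: exI[of _ N] less_imp_le)
  show "(\<lambda>n. 1 / (real n + 1)) \<longlonglongrightarrow> 0"
    using LIMSEQ_inverse_real_of_nat by (simp add: inverse_eq_divide add.commute)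
qed

definition approx_unit :: "('i \<Rightarrow> 'a::cstar_algebra) \<Rightarrow> 'i filter \<Rightarrow> bool" where
  "approx_unit e F \<longleftrightarrow> (\<forall>i. star (e i) = e i \<and> norm (e i) \<le> 1)
     \<and> (\<forall>a. ((\<lambda>i. e i * a) \<longlongrightarrow> a) F \<and> ((\<lambda>i. a * e i) \<longlongrightarrow> a) F)"

text \<open>The target algebra is not assumed separable, so the index is a finite set together with
  a tolerance.\<close>

lemma approx_unit_exists:
  "\<exists>e :: 'a::cstar_algebra set \<times> nat \<Rightarrow> 'a. approx_unit e (finite_subsets_at_top UNIV \<times>\<^sub>F sequentially)"
proof -
  define good where "good i e \<longleftrightarrow> star e = e \<and> norm e \<le> 1 \<and> (finite (fst i) \<longrightarrow> (\<forall>a\<in>fst i.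
      norm (e * a - a) < 1 / (real (snd i) + 1)))" for i :: "'a set \<times> nat" and e
  have "\<exists>e. good i e" for i
  proof (cases "finite (fst i)")
    case True
    have "(0::real) < 1 / (real (snd i) + 1)" by (simp add: add_nonneg_pos)
    then show ?thesis unfolding good_def using approximate_unit[OF True] by blast
  next
    case False
    \<comment> \<open>A default value: infinite sets are eventually absent from the filter.\<close>
    then show ?thesis by (intro exI[of _ 0]) (simp add: good_def)
  qed
  then obtain e where e: "\<And>i. good i (e i)" by metis
  have left: "((\<lambda>i. e i * a) \<longlongrightarrow> a) (finite_subsets_at_top UNIV \<times>\<^sub>F sequentially)" for a
  proof (rule tendstoI)
    fix \<epsilon> :: real assume "\<epsilon> > 0"
    then obtain N where N: "1 / (real N + 1) < \<epsilon>"
      using reals_Archimedean[of \<epsilon>] by (auto simp: inverse_eq_divide add.commute)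
    have "dist (e (X, n) * a) a < \<epsilon>" if "finite X" "a \<in> X" "n \<ge> N" for X n
    proof -
      have "1 / (real n + 1) \<le> 1 / (real N + 1)" using that(3) by (simp add: frac_le)
      moreover have "norm (e (X, n) * a - a) < 1 / (real n + 1)"
        using e[of "(X, n)"] that by (simp add: good_def)
      ultimately show ?thesis using N by (simp add: dist_norm)
    qed
    moreover have "\<forall>\<^sub>F X in finite_subsets_at_top UNIV. finite X \<and> a \<in> X"
      by (auto simp: eventually_finite_subsets_at_top intro!: exI[of _ "{a}"])
    ultimately show "\<forall>\<^sub>F i in finite_subsets_at_top UNIV \<times>\<^sub>F sequentially. dist (e i * a) a < \<epsilon>"
      unfolding eventually_prod_filter
      by (intro exI[of _ "\<lambda>X. finite X \<and> a \<in> X"] exI[of _ "\<lambda>n. n \<ge> N"]) (auto simp: eventually_ge_at_top)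
  qed
  have "((\<lambda>i. a * e i) \<longlongrightarrow> a) (finite_subsets_at_top UNIV \<times>\<^sub>F sequentially)" for a
    using tendsto_star[OF left[of "star a"]] e by (simp add: star_mult good_def)
  with left e show ?thesis by (intro exI[of _ e]) (auto simp: approx_unit_def good_def)
qed

lemma separable_dense_sequence:
  assumes "separable_space (euclidean :: 'a::topological_space topology)"
  shows "\<exists>x :: nat \<Rightarrow> 'a. closure (range x) = UNIV"
proof -
  obtain U :: "'a set" where U: "countable U" "closure U = UNIV"
    using assms by (auto simp: separable_space_def)
  then have "U \<noteq> {}" by auto
  then show ?thesis using U range_from_nat_into by metis
qed

lemma separable_approx_unit:
  assumes "separable_space (euclidean :: 'a::cstar_algebra topology)"
  shows "\<exists>e :: nat \<Rightarrow> 'a. approx_unit e sequentially"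
proof -
  obtain x :: "nat \<Rightarrow> 'a" where x: "closure (range x) = UNIV"
    using separable_dense_sequence[OF assms] by blast
  define good where "good n e \<longleftrightarrow> star e = e \<and> norm e \<le> 1 \<and> (\<forall>a\<in>x ` {..n}.
      norm (e * a - a) < 1 / (real n + 1))" for n e
  have "\<exists>e. good n e" for n
  proof -
    have "(0::real) < 1 / (real n + 1)" by (simp add: add_nonneg_pos)
    then show ?thesis unfolding good_def using approximate_unit[of "x ` {..n}"] by blast
  qed
  then obtain e where "\<And>n. good n (e n)" by metis
  then have e: "\<And>n. star (e n) = e n" "\<And>n. norm (e n) \<le> 1"
    "\<And>n k. k \<le> n \<Longrightarrow> norm (e n * x k - x k) < 1 / (real n + 1)"
    unfolding good_def by auto
  have ex: "\<exists>k. norm (x k - a) < \<epsilon>" if \<epsilon>: "\<epsilon> > 0" for a \<epsilon>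
  proof -
    have "a \<in> closure (range x)" by (simp add: x)
    then show ?thesis using \<epsilon> by (auto simp: closure_approachable dist_norm)
  qed
  have left: "(\<lambda>n. e n * a) \<longlonglongrightarrow> a" for a
  proof (rule tendsto_if_dense[where L = "\<lambda>n a. e n * a" and l = "\<lambda>a. a" and C = 1])
    fix \<epsilon> :: real assume "\<epsilon> > 0"
    then obtain k where k: "norm (x k - a) < \<epsilon>" using ex by blast
    have "(\<lambda>n. e n * x k - x k) \<longlonglongrightarrow> 0"
      by (rule LIMSEQ_if_norm_less_inverse[of k]) (rule e(3))
    then have "(\<lambda>n. e n * x k) \<longlonglongrightarrow> x k" by (rule LIM_zero_cancel)
    with k show "\<exists>b. norm (b - a) < \<epsilon> \<and> (\<lambda>n. e n * b) \<longlonglongrightarrow> b" by blast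
  next
    show "norm (e i * y - e i * z) \<le> 1 * norm (y - z)" for i y z
      using norm_mult_le(1)[OF e(2)[of i], of "y - z"] by (simp add: right_diff_distrib)
  qed auto
  have "(\<lambda>n. a * e n) \<longlonglongrightarrow> a" for a
    using tendsto_star[OF left[of "star a"]] by (simp add: star_mult e)
  with left have "approx_unit e sequentially" by (simp add: approx_unit_def e)
  then show ?thesis by blast
qed

section \<open>Covariant maps\<close>

text \<open>The last two identities are the coherence relation at a neutral group element, where the
  normalised multipliers are 1. Asking \<beta> only to be a *-homomorphism lets the locale pass
  directly to \<open>unit_ext\<close>.\<close>

locale covariant_map =
  fixes \<alpha> :: "'g::group_add \<Rightarrow> 'a::cstar_algebra \<Rightarrow> 'a"
    and \<beta> :: "'g \<Rightarrow> 'b::cstar_algebra \<Rightarrow> 'b" and \<phi> :: "'g \<Rightarrow> 'a \<Rightarrow> 'b"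
  assumes \<alpha>: "star_automorphism (\<alpha> g)" and \<beta>: "star_hom (\<beta> g)" and lin: "clinear (\<phi> g)"
    and star_mult_phi: "star (\<phi> g a) * \<phi> g b = \<phi> 0 (star a * b)"
    and phi_mult: "\<phi> g (a * b) = \<phi> g a * \<phi> 0 b"
    and phi_alpha_mult: "\<phi> g (\<alpha> g a * b) = \<beta> g (\<phi> 0 a) * \<phi> g b"
begin

lemmas phi_lin = clinearD[OF lin]

text \<open>Only the component at 0 is multiplicative; the others inherit its bound through
  \<open>star (\<phi> g a) * \<phi> g a = \<phi> 0 (star a * a)\<close>.\<close>

lemma norm_phi_le: "norm (\<phi> g a) \<le> norm a"
proof -
  have "norm (\<phi> 0 x) \<le> norm x" for x
    by (rule norm_hom_le[OF lin]) (simp_all add: phi_mult star_mult_phi)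
  then have "(norm (\<phi> g a))\<^sup>2 \<le> norm (star a * a)"
    unfolding cstar_identity[symmetric] star_mult_phi by simp
  then have "(norm (\<phi> g a))\<^sup>2 \<le> (norm a)\<^sup>2" by (simp add: cstar_identity)
  then show ?thesis by (rule power2_le_imp_le) simp
qed

lemma bounded_linear_phi: "bounded_linear (\<phi> g)"
  by (rule bounded_linear_intro[where K = 1]) (simp_all add: phi_lin norm_phi_le)

text \<open>On products \<open>e * a\<close> adjoints are preserved, because both
  \<open>star (\<phi> 0 e) * \<phi> 0 a\<close> and its adjoint are values of \<phi>. An approximate
  unit and contractivity extend this to every element.\<close>

lemma star_phi: "star (\<phi> 0 a) = \<phi> 0 (star a)"
proof -
  have "norm (star (\<phi> 0 a) - \<phi> 0 (star a)) \<le> 0 + \<epsilon>" if \<epsilon>: "\<epsilon> > 0" for \<epsilon>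
  proof -
    obtain e where e: "star e = e" "norm (e * a - a) < \<epsilon> / 2"
      using approximate_unit[of "{a}" "\<epsilon> / 2"] \<epsilon> by auto
    have "star (star (\<phi> 0 e) * \<phi> 0 a) = star (\<phi> 0 a) * \<phi> 0 e" by (simp add: star_mult)
    then have "star (\<phi> 0 (e * a)) = \<phi> 0 (star (e * a))"
      unfolding star_mult_phi by (simp add: e star_mult)
    then have "star (\<phi> 0 a) - \<phi> 0 (star a) = \<phi> 0 (star (e * a - a)) - star (\<phi> 0 (e * a - a))"
      by (simp add: phi_lin star_diff)
    also have "norm \<dots> \<le> norm (e * a - a) + norm (e * a - a)"
      by (rule order_trans[OF norm_triangle_ineq4 add_mono])
        (use norm_phi_le[of 0 "star (e * a - a)"] norm_phi_le[of 0 "e * a - a"] in simp_all)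
    finally show ?thesis using e(2) by linarith
  qed
  then have "norm (star (\<phi> 0 a) - \<phi> 0 (star a)) \<le> 0" by (rule field_le_epsilon)
  then show ?thesis by simp
qed

lemma phi_sandwich: "\<phi> g (\<alpha> g x * a * y) = \<beta> g (\<phi> 0 x) * \<phi> g a * \<phi> 0 y"
  using phi_alpha_mult[of g x "a * y"] phi_mult[of g a y] by (simp add: mult.assoc)

lemma beta_mult: "\<beta> g (x * y) = \<beta> g x * \<beta> g y" and beta_star: "\<beta> g (star x) = star (\<beta> g x)"
  and beta_diff: "\<beta> g (x - y) = \<beta> g x - \<beta> g y" and beta_scaleR: "\<beta> g (r *\<^sub>R x) = r *\<^sub>R \<beta> g x"
  using \<beta>[of g] unfolding star_hom_def by (auto simp: clinearD)

lemma norm_beta_le: "norm (\<beta> g x) \<le> norm x"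
  by (rule norm_star_hom_le[OF \<beta>])

lemma tendsto_alpha_sandwich:
  assumes "approx_unit e F"
  shows "((\<lambda>i. \<alpha> g (e i) * a * e i) \<longlongrightarrow> a) F"
proof -
  have e: "star (e i) = e i" "norm (e i) \<le> 1" "((\<lambda>i. e i * b) \<longlongrightarrow> b) F" "((\<lambda>i. b * e i) \<longlongrightarrow> b) F" for i b
    using assms by (auto simp: approx_unit_def)
  have bij: "bij (\<alpha> g)" and am: "\<alpha> g (x * y) = \<alpha> g x * \<alpha> g y" for x y
    using \<alpha>[of g] by (auto simp: star_automorphism_def)
  \<comment> \<open>Pulling \<open>a\<close> back by the automorphism turns
    \<open>\<alpha> g (e i) * a\<close> into \<open>\<alpha> g (e i * b)\<close>, where
    \<open>e\<close> acts as an approximate unit.\<close>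
  define b where "b = inv (\<alpha> g) a"
  have b: "\<alpha> g b = a" unfolding b_def using bij by (simp add: bij_is_surj surj_f_inv_f)
  have "((\<lambda>i. \<alpha> g (e i * b)) \<longlongrightarrow> \<alpha> g b) F"
    by (rule bounded_linear.tendsto[OF bounded_linear_star_hom[OF star_automorphism_imp_star_hom[OF \<alpha>]] e(3)])
  then have "((\<lambda>i. \<alpha> g (e i) * a - a) \<longlongrightarrow> 0) F" by (simp add: am b LIM_zero)
  then have "((\<lambda>i. (\<alpha> g (e i) * a - a) * e i) \<longlongrightarrow> 0) F"
    by (rule tendsto_0_mult_bounded(1)[where C = 1]) (simp add: e)
  from tendsto_add[OF this e(4)[of a]] show ?thesis by (simp add: left_diff_distrib)
qed

lemma alpha_sandwich_approx:
  assumes "\<epsilon> > 0"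
  obtains e where "star e = e" "norm e \<le> 1" "norm (\<alpha> g e * a * e - a) < \<epsilon>"
proof -
  have bij: "bij (\<alpha> g)" and am: "\<alpha> g (x * y) = \<alpha> g x * \<alpha> g y"
    and ad: "\<alpha> g (x - y) = \<alpha> g x - \<alpha> g y" for x y
    using \<alpha>[of g] by (auto simp: star_automorphism_def clinearD)
  define b where "b = inv (\<alpha> g) a"
  have b: "\<alpha> g b = a" unfolding b_def using bij by (simp add: bij_is_surj surj_f_inv_f)
  obtain e where e: "star e = e" "norm e \<le> 1" "norm (e * b - b) < \<epsilon> / 2" "norm (a * e - a) < \<epsilon> / 2"
    using approximate_unit[of "{a, b}" "\<epsilon> / 2"] assms by auto
  have "\<alpha> g e * a * e - a = \<alpha> g (e * b - b) * e + (a * e - a)"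
    by (simp add: am ad b left_diff_distrib)
  also have "norm \<dots> \<le> norm (\<alpha> g (e * b - b)) * norm e + norm (a * e - a)"
    by (rule order_trans[OF norm_triangle_ineq add_right_mono[OF norm_mult_ineq]])
  also have "\<dots> \<le> norm (e * b - b) * 1 + norm (a * e - a)"
    using e(2) norm_star_hom_le[OF star_automorphism_imp_star_hom[OF \<alpha>]]
    by (intro add_right_mono mult_mono) auto
  also have "\<dots> < \<epsilon>" using e by simp
  finally show ?thesis using e that by blast
qed

end

locale covariant_pair = phi: covariant_map \<alpha> \<beta> \<phi> + psi: covariant_map \<alpha> \<beta> \<psi>
  for \<alpha> :: "'g::group_add \<Rightarrow> 'a::cstar_algebra \<Rightarrow> 'a"
    and \<beta> :: "'g \<Rightarrow> 'b::cstar_algebra \<Rightarrow> 'b" and \<phi> \<psi>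
begin

lemma conjugate_lipschitz:
  assumes "norm v \<le> 1"
  shows "norm (\<beta> g v * \<psi> g x * star v - \<beta> g v * \<psi> g y * star v) \<le> 1 * norm (x - y)"
proof -
  have "\<beta> g v * \<psi> g x * star v - \<beta> g v * \<psi> g y * star v = \<beta> g v * \<psi> g (x - y) * star v"
    by (simp add: psi.phi_lin algebra_simps)
  also have "norm \<dots> \<le> norm (\<psi> g (x - y))"
    by (rule norm_mult3_le) (use phi.norm_beta_le[of g v] assms in auto)
  also have "\<dots> \<le> norm (x - y)" by (rule psi.norm_phi_le)
  finally show ?thesis by simp
qed

lemma phi_lipschitz: "norm (\<phi> g x - \<phi> g y) \<le> 1 * norm (x - y)"
  using phi.norm_phi_le[of g "x - y"] by (simp add: phi.phi_lin)

text \<open>Up to \<epsilon>, \<open>a\<close> may be replaced by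
  \<open>\<alpha> g e * a * e\<close>. The conjugates then see only \<open>u i * \<psi> 0 e\<close>
  and \<open>v i * \<psi> 0 e\<close>, which are asymptotically equal.\<close>

lemma conjugate_tendsto_cong:
  assumes u: "\<And>i. norm (u i) \<le> 1" and v: "\<And>i. norm (v i) \<le> 1"
    and diff: "\<And>a. ((\<lambda>i. (u i - v i) * \<psi> 0 a) \<longlongrightarrow> 0) F"
    and conv: "\<And>g a. ((\<lambda>i. \<beta> g (v i) * \<psi> g a * star (v i)) \<longlongrightarrow> \<phi> g a) F"
  shows "((\<lambda>i. \<beta> g (u i) * \<psi> g a * star (u i)) \<longlongrightarrow> \<phi> g a) F"
proof (rule tendsto_if_dense[where L = "\<lambda>i a. \<beta> g (u i) * \<psi> g a * star (u i)" and l = "\<phi> g" and C = 1])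
  fix \<epsilon> :: real assume "\<epsilon> > 0"
  then obtain e where e: "star e = e" "norm e \<le> 1" "norm (\<alpha> g e * a * e - a) < \<epsilon>"
    using phi.alpha_sandwich_approx by blast
  define b where "b = \<alpha> g e * a * e"
  have sand: "\<beta> g w * \<psi> g b * star w = \<beta> g (w * \<psi> 0 e) * \<psi> g a * star (w * \<psi> 0 e)" for w
    unfolding b_def psi.phi_sandwich by (simp add: phi.beta_mult star_mult psi.star_phi e mult.assoc)
  define x where "x i = u i * \<psi> 0 e" for i
  define y where "y i = v i * \<psi> 0 e" for i
  have ne: "norm (\<psi> 0 e) \<le> 1" using psi.norm_phi_le[of 0 e] e(2) by linarith
  have nx: "norm (x i) \<le> 1" "norm (y i) \<le> 1" for i
    unfolding x_def y_def by (intro norm_mult_le_1 u v ne)+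
  have xy: "((\<lambda>i. x i - y i) \<longlongrightarrow> 0) F" using diff[of e] by (simp add: x_def y_def left_diff_distrib)
  have bxy: "((\<lambda>i. \<beta> g (x i - y i)) \<longlongrightarrow> 0) F"
    by (rule Lim_null_comparison[OF _ tendsto_norm_zero[OF xy]]) (simp add: phi.norm_beta_le)
  have sxy: "((\<lambda>i. star (x i - y i)) \<longlongrightarrow> 0) F"
    using tendsto_star[OF xy] by simp
  have bd: "norm (\<psi> g a * star (x i)) \<le> norm (\<psi> g a)" "norm (\<beta> g (y i) * \<psi> g a) \<le> norm (\<psi> g a)" for i
    using nx(1)[of i] order_trans[OF phi.norm_beta_le nx(2)[of i]] by (auto intro: norm_mult_le)
  have "((\<lambda>i. \<beta> g (x i - y i) * (\<psi> g a * star (x i))) \<longlongrightarrow> 0) F"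
    by (rule tendsto_0_mult_bounded(1)[OF bxy, where C = "norm (\<psi> g a)"]) (use bd in auto)
  moreover have "((\<lambda>i. \<beta> g (y i) * \<psi> g a * star (x i - y i)) \<longlongrightarrow> 0) F"
    by (rule tendsto_0_mult_bounded(2)[OF sxy, where C = "norm (\<psi> g a)"]) (use bd in auto)
  ultimately have "((\<lambda>i. \<beta> g (x i - y i) * (\<psi> g a * star (x i)) + \<beta> g (y i) * \<psi> g a * star (x i - y i)
      + \<beta> g (v i) * \<psi> g b * star (v i)) \<longlongrightarrow> 0 + 0 + \<phi> g b) F"
    by (intro tendsto_add conv)
  moreover have "\<beta> g (x i - y i) * (\<psi> g a * star (x i)) + \<beta> g (y i) * \<psi> g a * star (x i - y i)
      + \<beta> g (v i) * \<psi> g b * star (v i) = \<beta> g (u i) * \<psi> g b * star (u i)" for i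
    unfolding sand x_def[symmetric] y_def[symmetric]
    by (simp add: phi.beta_diff star_diff algebra_simps)
  ultimately have "((\<lambda>i. \<beta> g (u i) * \<psi> g b * star (u i)) \<longlongrightarrow> \<phi> g b) F" by simp
  then show "\<exists>b. norm (b - a) < \<epsilon> \<and> ((\<lambda>i. \<beta> g (u i) * \<psi> g b * star (u i)) \<longlongrightarrow> \<phi> g b) F"
    using e(3) unfolding b_def by blast
next
  show "norm (\<beta> g (u i) * \<psi> g x * star (u i) - \<beta> g (u i) * \<psi> g y * star (u i)) \<le> 1 * norm (x - y)" for i x y
    by (rule conjugate_lipschitz[OF u])
qed (use phi_lipschitz in auto)

text \<open>With \<open>h = v\<^sup>*v\<close> one has \<open>h x h \<approx> x\<close> on the image of \<open>\<psi>\<close>. This forces \<open>h\<close> to commute with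
  products \<open>xy\<close>, since both \<open>hxy\<close> and \<open>xyh\<close> are close to \<open>(hxh)yh = hx(hyh)\<close>. So \<open>h\<^sup>2x \<approx> x\<close>, and
  positivity of \<open>h\<close> gives \<open>hx \<approx> x\<close>.\<close>

lemma star_mult_self_tendsto:
  assumes v: "\<And>i. norm (v i) \<le> 1"
    and c1: "\<And>a. ((\<lambda>i. star (v i) * \<phi> 0 a * v i) \<longlongrightarrow> \<psi> 0 a) F"
    and c2: "\<And>a. ((\<lambda>i. v i * \<psi> 0 a * star (v i)) \<longlongrightarrow> \<phi> 0 a) F"
  shows "((\<lambda>i. star (v i) * v i * \<psi> 0 a) \<longlongrightarrow> \<psi> 0 a) F"
proof -
  define h where "h i = star (v i) * v i" for i
  have nh: "norm (h i) \<le> 1" for i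
    using v[of i] by (simp add: h_def cstar_identity power_le_one)
  have nhx: "norm (h i * x) \<le> norm x" "norm (x * h i) \<le> norm x" for i x
    by (intro norm_mult_le nh)+
  have hxh: "((\<lambda>i. h i * \<psi> 0 a * h i) \<longlongrightarrow> \<psi> 0 a) F" for a
  proof -
    have "((\<lambda>i. v i * \<psi> 0 a * star (v i) - \<phi> 0 a) \<longlongrightarrow> 0) F" using c2 by (rule LIM_zero)
    then have "((\<lambda>i. star (v i) * (v i * \<psi> 0 a * star (v i) - \<phi> 0 a) * v i) \<longlongrightarrow> 0) F"
      by (intro tendsto_0_mult_bounded[where C = 1]) (use v in auto)
    from tendsto_add[OF this c1[of a]] show ?thesis
      by (simp add: h_def algebra_simps)
  qed
  have comm: "((\<lambda>i. h i * \<psi> 0 a - \<psi> 0 a * h i) \<longlongrightarrow> 0) F" for a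
  proof (rule tendsto_if_dense[where L = "\<lambda>i a. h i * \<psi> 0 a - \<psi> 0 a * h i" and l = "\<lambda>_. 0" and C = 2])
    fix \<epsilon> :: real assume "\<epsilon> > 0"
    then obtain e where e: "norm (a * e - a) < \<epsilon>"
      using approximate_unit[of "{a}" \<epsilon>] by auto
    have z: "((\<lambda>i. h i * \<psi> 0 x * h i - \<psi> 0 x) \<longlongrightarrow> 0) F" for x using hxh by (rule LIM_zero)
    have "((\<lambda>i. (h i * \<psi> 0 a * h i - \<psi> 0 a) * (\<psi> 0 e * h i)) \<longlongrightarrow> 0) F"
      by (rule tendsto_0_mult_bounded(1)[OF z, where C = "norm (\<psi> 0 e)"]) (simp add: nhx)
    moreover have "((\<lambda>i. (h i * \<psi> 0 a) * (h i * \<psi> 0 e * h i - \<psi> 0 e)) \<longlongrightarrow> 0) F"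
      by (rule tendsto_0_mult_bounded(2)[OF z, where C = "norm (\<psi> 0 a)"]) (simp add: nhx)
    \<comment> \<open>The terms \<open>h a h e h\<close> cancel in this difference, which leaves the
      commutator of \<open>h\<close> with the product \<open>a * e\<close>.\<close>
    ultimately have "((\<lambda>i. (h i * \<psi> 0 a * h i - \<psi> 0 a) * (\<psi> 0 e * h i)
        - (h i * \<psi> 0 a) * (h i * \<psi> 0 e * h i - \<psi> 0 e)) \<longlongrightarrow> 0 - 0) F" by (rule tendsto_diff)
    then have "((\<lambda>i. h i * \<psi> 0 (a * e) - \<psi> 0 (a * e) * h i) \<longlongrightarrow> 0) F"
      by (simp add: psi.phi_mult algebra_simps)
    with e show "\<exists>b. norm (b - a) < \<epsilon> \<and> ((\<lambda>i. h i * \<psi> 0 b - \<psi> 0 b * h i) \<longlongrightarrow> 0) F" by blast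
  next
    fix i x y
    have "h i * \<psi> 0 x - \<psi> 0 x * h i - (h i * \<psi> 0 y - \<psi> 0 y * h i)
        = h i * \<psi> 0 (x - y) - \<psi> 0 (x - y) * h i" by (simp add: psi.phi_lin algebra_simps)
    also have "norm \<dots> \<le> norm (\<psi> 0 (x - y)) + norm (\<psi> 0 (x - y))"
      by (rule order_trans[OF norm_triangle_ineq4 add_mono]) (rule nhx)+
    also have "\<dots> \<le> 2 * norm (x - y)" using psi.norm_phi_le[of 0 "x - y"] by simp
    finally show "norm (h i * \<psi> 0 x - \<psi> 0 x * h i - (h i * \<psi> 0 y - \<psi> 0 y * h i)) \<le> 2 * norm (x - y)" .
  qed auto
  have "((\<lambda>i. h i * (h i * \<psi> 0 a - \<psi> 0 a * h i)) \<longlongrightarrow> 0) F"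
    by (rule tendsto_0_mult_bounded(2)[OF comm, where C = 1]) (simp add: nh)
  from tendsto_add[OF this LIM_zero[OF hxh[of a]]]
  have hh: "((\<lambda>i. h i * (h i * \<psi> 0 a) - \<psi> 0 a) \<longlongrightarrow> 0) F" by (simp add: algebra_simps)
  define d where "d i = h i * \<psi> 0 a - \<psi> 0 a" for i
  have "norm (d i) \<le> norm (h i * (h i * \<psi> 0 a) - \<psi> 0 a)" for i
  proof -
    \<comment> \<open>Here \<open>d - h d\<close> is \<open>(1 - h) d\<close>, of norm at most
      \<open>norm d\<close>; this absorbs half of the left side.\<close>
    have "2 *\<^sub>R d i = (h i * (h i * \<psi> 0 a) - \<psi> 0 a) + (d i - h i * d i)"
      by (simp add: d_def scaleR_2 algebra_simps)
    then have "2 * norm (d i) \<le> norm (h i * (h i * \<psi> 0 a) - \<psi> 0 a) + norm (d i - h i * d i)"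
      by (metis norm_scaleR norm_triangle_ineq abs_numeral)
    also have "norm (d i - h i * d i) \<le> norm (d i)"
      unfolding h_def by (rule norm_diff_contraction_nonunital[OF v])
    finally show ?thesis by simp
  qed
  then have "(d \<longlongrightarrow> 0) F"
    by (intro Lim_null_comparison[OF _ tendsto_norm_zero[OF hh]]) auto
  then show ?thesis unfolding d_def h_def by (rule LIM_zero_cancel)
qed

text \<open>The square of \<open>norm (v i * \<psi> 0 (e i))\<close> is the norm of
  \<open>v i * \<psi> 0 (e i * e i) * star (v i)\<close>, hence at most 1 up to an error tending to
  0; so the normalising factors tend to 1 and do not affect limits. The test elements in the last
  two convergence hypotheses move with \<open>i\<close>, since convergence at each fixed element
  says nothing about them.\<close>

lemma contractive_conjugators:
  assumes e: "approx_unit e F" and X: "closure X = UNIV"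
    and c1: "\<And>a. a \<in> X \<Longrightarrow> ((\<lambda>i. star (v i) * \<phi> 0 a * v i) \<longlongrightarrow> \<psi> 0 a) F"
    and c2: "\<And>g a. a \<in> X \<Longrightarrow> ((\<lambda>i. \<beta> g (v i) * \<psi> g (\<alpha> g (e i) * a * e i) * star (v i)
        - \<phi> g (\<alpha> g (e i) * a * e i)) \<longlongrightarrow> 0) F"
    and c3: "((\<lambda>i. v i * \<psi> 0 (e i * e i) * star (v i) - \<phi> 0 (e i * e i)) \<longlongrightarrow> 0) F"
    and w_def: "\<And>i. w i = (1 / max 1 (norm (v i * \<psi> 0 (e i)))) *\<^sub>R (v i * \<psi> 0 (e i))"
  shows "norm (w i) \<le> 1"
    and "((\<lambda>i. star (w i) * \<phi> 0 a * w i) \<longlongrightarrow> \<psi> 0 a) F"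
    and "((\<lambda>i. \<beta> g (w i) * \<psi> g a * star (w i)) \<longlongrightarrow> \<phi> g a) F"
proof -
  note ae = e
  have e: "star (e i) = e i" "norm (e i) \<le> 1" "((\<lambda>i. e i * b) \<longlongrightarrow> b) F" "((\<lambda>i. b * e i) \<longlongrightarrow> b) F" for i b
    using e by (auto simp: approx_unit_def)
  define x where "x i = v i * \<psi> 0 (e i)" for i
  define c where "c i = 1 / max 1 (norm (x i))" for i
  have w: "w i = c i *\<^sub>R x i" for i by (simp add: w_def c_def x_def)
  have c0: "c i > 0" for i by (simp add: c_def)
  show nw: "norm (w i) \<le> 1" for i by (simp add: w c_def)
  define err where "err i = norm (v i * \<psi> 0 (e i * e i) * star (v i) - \<phi> 0 (e i * e i))" for i
  have err: "(err \<longlongrightarrow> 0) F" unfolding err_def by (rule tendsto_norm_zero[OF c3])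
  have "max 1 (norm (x i)) \<le> 1 + err i" for i
  proof -
    have ee: "norm (e i * e i) \<le> 1"
      by (intro norm_mult_le_1 e)
    have "(norm (x i))\<^sup>2 = norm (v i * \<psi> 0 (e i * e i) * star (v i))"
      unfolding norm_mult_star_self[symmetric] x_def
      by (simp add: star_mult psi.star_phi e psi.phi_mult mult.assoc)
    also have "\<dots> \<le> norm (\<phi> 0 (e i * e i)) + err i"
      unfolding err_def by (rule norm_triangle_sub)
    also have "\<dots> \<le> 1 + err i" using phi.norm_phi_le[of 0 "e i * e i"] ee by simp
    finally have x2: "(norm (x i))\<^sup>2 \<le> 1 + err i" .
    have "err i \<ge> 0" by (simp add: err_def)
    moreover have "norm (x i) \<le> (norm (x i))\<^sup>2" if "norm (x i) \<ge> 1"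
      using mult_right_mono[OF that norm_ge_zero[of "x i"]] by (simp add: power2_eq_square)
    ultimately show ?thesis using x2 by (cases "norm (x i) \<ge> 1") auto
  qed
  then have le: "\<forall>\<^sub>F i in F. max 1 (norm (x i)) \<le> 1 + err i" by simp
  have "((\<lambda>i. 1 + err i) \<longlongrightarrow> 1) F" using tendsto_add[OF tendsto_const[of 1] err] by simp
  from tendsto_sandwich[OF _ le tendsto_const this]
  have mx: "((\<lambda>i. max 1 (norm (x i))) \<longlongrightarrow> 1) F" by simp
  have c: "(c \<longlongrightarrow> 1) F"
    using tendsto_divide[OF tendsto_const[of 1] mx] by (simp add: c_def[abs_def])
  have cc: "((\<lambda>i. c i * c i) \<longlongrightarrow> 1) F" using tendsto_mult[OF c c] by simp
  have dense: "\<exists>b\<in>X. norm (b - a) < \<epsilon>" if "\<epsilon> > 0" for a \<epsilon>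
    using X that closure_approachable[of a X] by (auto simp: dist_norm)
  show "((\<lambda>i. star (w i) * \<phi> 0 a * w i) \<longlongrightarrow> \<psi> 0 a) F"
  proof (rule tendsto_if_dense[where L = "\<lambda>i a. star (w i) * \<phi> 0 a * w i" and l = "\<psi> 0" and C = 1])
    fix \<epsilon> :: real assume "\<epsilon> > 0"
    then obtain b where b: "b \<in> X" "norm (b - a) < \<epsilon>" using dense by blast
    have ne: "norm (\<psi> 0 (e i)) \<le> 1" for i using psi.norm_phi_le[of 0 "e i"] e(2)[of i] by linarith
    have "((\<lambda>i. \<psi> 0 (e i) * (star (v i) * \<phi> 0 b * v i - \<psi> 0 b) * \<psi> 0 (e i)) \<longlongrightarrow> 0) F"
      by (intro tendsto_0_mult_bounded[where C = 1] LIM_zero c1 b) (use ne in auto)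
    moreover have "((\<lambda>i. \<psi> 0 (e i * (b * e i))) \<longlongrightarrow> \<psi> 0 b) F"
    proof (rule bounded_linear.tendsto[OF psi.bounded_linear_phi])
      have "((\<lambda>i. e i * (b * e i - b)) \<longlongrightarrow> 0) F"
        by (intro tendsto_0_mult_bounded(2)[where C = 1] LIM_zero e) (use e in auto)
      from tendsto_add[OF this e(3)[of b]] show "((\<lambda>i. e i * (b * e i)) \<longlongrightarrow> b) F"
        by (simp add: algebra_simps)
    qed
    ultimately have "((\<lambda>i. (c i * c i) *\<^sub>R (\<psi> 0 (e i) * (star (v i) * \<phi> 0 b * v i - \<psi> 0 b) * \<psi> 0 (e i)
        + \<psi> 0 (e i * (b * e i)))) \<longlongrightarrow> 1 *\<^sub>R (0 + \<psi> 0 b)) F"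
      by (intro tendsto_scaleR tendsto_add cc)
    moreover have "(c i * c i) *\<^sub>R (\<psi> 0 (e i) * (star (v i) * \<phi> 0 b * v i - \<psi> 0 b) * \<psi> 0 (e i)
        + \<psi> 0 (e i * (b * e i))) = star (w i) * \<phi> 0 b * w i" for i
      unfolding w x_def by (simp add: star_scaleR star_mult psi.star_phi e psi.phi_mult algebra_simps)
    ultimately have "((\<lambda>i. star (w i) * \<phi> 0 b * w i) \<longlongrightarrow> \<psi> 0 b) F" by simp
    with b show "\<exists>b. norm (b - a) < \<epsilon> \<and> ((\<lambda>i. star (w i) * \<phi> 0 b * w i) \<longlongrightarrow> \<psi> 0 b) F" by blast
  next
    fix i y z
    have "star (w i) * \<phi> 0 y * w i - star (w i) * \<phi> 0 z * w i = star (w i) * \<phi> 0 (y - z) * w i"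
      by (simp add: phi.phi_lin algebra_simps)
    also have "norm \<dots> \<le> norm (\<phi> 0 (y - z))" by (rule norm_mult3_le) (use nw in auto)
    also have "\<dots> \<le> 1 * norm (y - z)" using phi.norm_phi_le by simp
    finally show "norm (star (w i) * \<phi> 0 y * w i - star (w i) * \<phi> 0 z * w i) \<le> 1 * norm (y - z)" .
    show "norm (\<psi> 0 y - \<psi> 0 z) \<le> 1 * norm (y - z)"
      using psi.norm_phi_le[of 0 "y - z"] by (simp add: psi.phi_lin)
  qed simp
  show "((\<lambda>i. \<beta> g (w i) * \<psi> g a * star (w i)) \<longlongrightarrow> \<phi> g a) F"
  proof (rule tendsto_if_dense[where L = "\<lambda>i a. \<beta> g (w i) * \<psi> g a * star (w i)" and l = "\<phi> g" and C = 1])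
    fix \<epsilon> :: real assume "\<epsilon> > 0"
    then obtain b where b: "b \<in> X" "norm (b - a) < \<epsilon>" using dense by blast
    have "((\<lambda>i. \<phi> g (\<alpha> g (e i) * b * e i)) \<longlongrightarrow> \<phi> g b) F"
      by (rule bounded_linear.tendsto[OF phi.bounded_linear_phi phi.tendsto_alpha_sandwich[OF ae]])
    from tendsto_add[OF c2[OF b(1), of g] this]
    have "((\<lambda>i. \<beta> g (v i) * \<psi> g (\<alpha> g (e i) * b * e i) * star (v i)) \<longlongrightarrow> \<phi> g b) F" by simp
    then have "((\<lambda>i. (c i * c i) *\<^sub>R (\<beta> g (v i) * \<psi> g (\<alpha> g (e i) * b * e i) * star (v i))) \<longlongrightarrow> 1 *\<^sub>R \<phi> g b) F"
      by (intro tendsto_scaleR cc)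
    moreover have "(c i * c i) *\<^sub>R (\<beta> g (v i) * \<psi> g (\<alpha> g (e i) * b * e i) * star (v i))
        = \<beta> g (w i) * \<psi> g b * star (w i)" for i
      unfolding w x_def psi.phi_sandwich
      by (simp add: star_scaleR star_mult psi.star_phi e phi.beta_scaleR phi.beta_mult mult.assoc)
    ultimately have "((\<lambda>i. \<beta> g (w i) * \<psi> g b * star (w i)) \<longlongrightarrow> \<phi> g b) F" by simp
    with b show "\<exists>b. norm (b - a) < \<epsilon> \<and> ((\<lambda>i. \<beta> g (w i) * \<psi> g b * star (w i)) \<longlongrightarrow> \<phi> g b) F" by blast
  next
    show "norm (\<beta> g (w i) * \<psi> g y * star (w i) - \<beta> g (w i) * \<psi> g z * star (w i)) \<le> 1 * norm (y - z)" for i y z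
      by (rule conjugate_lipschitz[OF nw])
  qed (use phi_lipschitz in auto)
qed

end

locale unital_covariant_pair = covariant_pair \<alpha> \<beta> \<phi> \<psi>
  for \<alpha> :: "'g::group_add \<Rightarrow> 'a::cstar_algebra \<Rightarrow> 'a"
    and \<beta> :: "'g \<Rightarrow> 'b::unital_cstar_algebra \<Rightarrow> 'b" and \<phi> \<psi> +
  assumes beta_one: "\<beta> g 1 = 1"
begin

lemma beta_unitary: "unitary u \<Longrightarrow> \<beta> g (star u) * \<beta> g u = 1" "unitary u \<Longrightarrow> \<beta> g u * \<beta> g (star u) = 1"
  by (simp_all add: unitary_def beta_one flip: phi.beta_mult)

text \<open>The unitaries imitate \<open>v\<close> and so carry \<psi> to \<phi>; multiplying by
  their inverses on both sides reverses the direction.\<close>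

lemma unitary_conjugators:
  assumes u: "\<And>i. unitary (u i)" and v: "\<And>i. norm (v i) \<le> 1"
    and diff: "\<And>a. ((\<lambda>i. (u i - v i) * \<psi> 0 a) \<longlongrightarrow> 0) F"
    and conv: "\<And>g a. ((\<lambda>i. \<beta> g (v i) * \<psi> g a * star (v i)) \<longlongrightarrow> \<phi> g a) F"
  shows "((\<lambda>i. \<beta> g (star (u i)) * \<phi> g a * u i) \<longlongrightarrow> \<psi> g a) F"
proof -
  have nu: "norm (u i) = 1" for i by (rule norm_unitary[OF u])
  have "((\<lambda>i. \<beta> g (u i) * \<psi> g a * star (u i)) \<longlongrightarrow> \<phi> g a) F"
    by (rule conjugate_tendsto_cong[OF _ v diff conv]) (simp add: nu)
  then have "((\<lambda>i. \<phi> g a - \<beta> g (u i) * \<psi> g a * star (u i)) \<longlongrightarrow> 0) F"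
    using tendsto_diff[OF tendsto_const[of "\<phi> g a"]] by fastforce
  then have "((\<lambda>i. \<beta> g (star (u i)) * (\<phi> g a - \<beta> g (u i) * \<psi> g a * star (u i)) * u i) \<longlongrightarrow> 0) F"
    by (intro tendsto_0_mult_bounded[where C = 1])
      (use phi.norm_beta_le[of g "star (u _)"] nu in \<open>auto\<close>)
  moreover have "\<beta> g (star (u i)) * (\<phi> g a - \<beta> g (u i) * \<psi> g a * star (u i)) * u i
      = \<beta> g (star (u i)) * \<phi> g a * u i - \<psi> g a" for i
  proof -
    have "\<beta> g (star (u i)) * (\<beta> g (u i) * \<psi> g a * star (u i)) * u i
        = (\<beta> g (star (u i)) * \<beta> g (u i)) * \<psi> g a * (star (u i) * u i)" by (simp only: mult.assoc)
    also have "\<dots> = \<psi> g a" using u[of i] by (simp add: beta_unitary) (simp add: unitary_def)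
    finally show ?thesis by (simp add: left_diff_distrib right_diff_distrib)
  qed
  ultimately show ?thesis using LIM_zero_cancel by simp
qed

lemma MvN_from_unitary:
  assumes e: "approx_unit e F" and u: "\<And>i. unitary (u i)"
    and conv: "\<And>g a. ((\<lambda>i. \<beta> g (u i) * \<phi> g a * star (u i)) \<longlongrightarrow> \<psi> g a) F"
    and v_def: "\<And>i. v i = star (u i) * \<psi> 0 (e i)"
  shows "((\<lambda>i. \<beta> g (star (v i)) * \<phi> g a * v i) \<longlongrightarrow> \<psi> g a) F"
    and "((\<lambda>i. \<beta> g (v i) * \<psi> g a * star (v i)) \<longlongrightarrow> \<phi> g a) F"
proof -
  have nu: "norm (u i) = 1" for i by (rule norm_unitary[OF u])
  have ee: "star (e i) = e i" "norm (e i) \<le> 1" for i using e by (auto simp: approx_unit_def)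
  have sand: "((\<lambda>i. \<psi> g (\<alpha> g (e i) * a * e i)) \<longlongrightarrow> \<psi> g a) F"
    by (rule bounded_linear.tendsto[OF psi.bounded_linear_phi phi.tendsto_alpha_sandwich[OF e]])
  have ne: "norm (\<psi> 0 (e i)) \<le> 1" "norm (\<beta> g (\<psi> 0 (e i))) \<le> 1" for i
    using psi.norm_phi_le[of 0 "e i"] ee(2)[of i] phi.norm_beta_le[of g "\<psi> 0 (e i)"] by linarith+
  have "((\<lambda>i. \<beta> g (\<psi> 0 (e i)) * (\<beta> g (u i) * \<phi> g a * star (u i) - \<psi> g a) * \<psi> 0 (e i)) \<longlongrightarrow> 0) F"
    by (intro tendsto_0_mult_bounded[where C = 1] LIM_zero conv) (use ne in auto)
  from tendsto_add[OF this sand]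
  have "((\<lambda>i. \<beta> g (\<psi> 0 (e i)) * (\<beta> g (u i) * \<phi> g a * star (u i)) * \<psi> 0 (e i)) \<longlongrightarrow> \<psi> g a) F"
    unfolding psi.phi_sandwich by (simp add: left_diff_distrib right_diff_distrib)
  then show "((\<lambda>i. \<beta> g (star (v i)) * \<phi> g a * v i) \<longlongrightarrow> \<psi> g a) F"
    unfolding v_def by (simp add: star_mult psi.star_phi ee phi.beta_mult mult.assoc)
  have nus: "norm (\<beta> g (star (u i))) \<le> 1" for i using phi.norm_beta_le[of g "star (u i)"] nu by simp
  have "((\<lambda>i. \<psi> g (\<alpha> g (e i) * a * e i) - \<beta> g (u i) * \<phi> g a * star (u i)) \<longlongrightarrow> \<psi> g a - \<psi> g a) F"
    by (intro tendsto_diff sand conv)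
  then have "((\<lambda>i. \<beta> g (star (u i)) * (\<psi> g (\<alpha> g (e i) * a * e i) - \<beta> g (u i) * \<phi> g a * star (u i)) * u i) \<longlongrightarrow> 0) F"
    by (intro tendsto_0_mult_bounded[where C = 1]) (use nus nu in auto)
  moreover have "\<beta> g (star (u i)) * (\<psi> g (\<alpha> g (e i) * a * e i) - \<beta> g (u i) * \<phi> g a * star (u i)) * u i
      = \<beta> g (v i) * \<psi> g a * star (v i) - \<phi> g a" for i
  proof -
    have "\<beta> g (star (u i)) * (\<beta> g (u i) * \<phi> g a * star (u i)) * u i
        = (\<beta> g (star (u i)) * \<beta> g (u i)) * \<phi> g a * (star (u i) * u i)" by (simp only: mult.assoc)
    also have "\<dots> = \<phi> g a" using u[of i] by (simp add: beta_unitary) (simp add: unitary_def)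
    finally show ?thesis
      unfolding v_def psi.phi_sandwich
      by (simp add: left_diff_distrib right_diff_distrib star_mult psi.star_phi ee phi.beta_mult mult.assoc)
  qed
  ultimately show "((\<lambda>i. \<beta> g (v i) * \<psi> g a * star (v i)) \<longlongrightarrow> \<phi> g a) F" using LIM_zero_cancel by simp
qed

end

section \<open>Rotations\<close>

text \<open>If \<open>z\<close> is a lower left matrix entry \<open>t\<close>, this is the unitary
  with diagonal entries the roots of \<open>1 - star t * t\<close> and \<open>1 - t * star t\<close>
  and off-diagonal entries \<open>t\<close> and \<open>- star t\<close>. In general,
  \<open>z - star z\<close> is skew and commutes with the root, like the sine and the cosine
  part.\<close>

definition rotation :: "'a::unital_cstar_algebra \<Rightarrow> 'a" where
  "rotation z = bpow (1/2) ((z - star z) * (z - star z)) + (z - star z)"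

text \<open>As \<open>z * z = 0\<close>, the elements \<open>a = star z * z\<close> and
  \<open>b = z * star z\<close> annihilate each other, and
  \<open>(r - a) (r - b) = r (r - (a + b))\<close> shows that \<open>r - (a + b)\<close> is
  positive. The bound carries no extra factor, so every \<open>z\<close> of norm below 1 stays in
  the domain of convergence.\<close>

lemma norm_skew_square:
  fixes z :: "'a::unital_cstar_algebra"
  assumes "z * z = 0"
  shows "norm ((z - star z) * (z - star z)) \<le> (norm z)\<^sup>2"
proof (cases "z = 0")
  case False
  define r where "r = (norm z)\<^sup>2"
  have r: "r > 0" using False by (simp add: r_def)
  define a where "a = star z * z"
  define b where "b = z * star z"
  have zz: "star z * star z = 0" using arg_cong[OF assms, of star] by (simp add: star_mult)
  have ab: "a * b = 0" "b * a = 0"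
    unfolding a_def b_def by (metis assms zz mult.assoc mult_zero_left mult_zero_right)+
  have na: "nonneg a" "nonneg b"
    using nonneg_star_mult_self[of z] nonneg_star_mult_self[of "star z"] by (simp_all add: a_def b_def)
  have norms: "norm a \<le> r" "norm b \<le> r"
    using norm_mult_star_self[of z] by (simp_all add: a_def b_def r_def cstar_identity)
  have "nonneg ((r *\<^sub>R 1 - a) * (r *\<^sub>R 1 - b))"
    by (intro nonneg_mult nonneg_norm_minus nonneg_star na norms) (simp add: algebra_simps ab)
  also have "(r *\<^sub>R 1 - a) * (r *\<^sub>R 1 - b) = r *\<^sub>R (r *\<^sub>R 1 - (a + b))"
    by (simp add: algebra_simps ab)
  finally have "nonneg ((1 / r) *\<^sub>R (r *\<^sub>R (r *\<^sub>R 1 - (a + b))))" by (rule nonneg_scaleR) (use r in simp)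
  then have "nonneg (r *\<^sub>R 1 - (a + b))" using r by simp
  moreover have "nonneg (r *\<^sub>R 1 + (a + b))" using r by (intro nonneg_add na nonneg_const) simp
  ultimately have "norm (a + b) \<le> r" by (rule norm_le_if_nonneg) (use r in simp)
  moreover have "(z - star z) * (z - star z) = - (a + b)"
    by (simp add: a_def b_def algebra_simps assms zz)
  ultimately show ?thesis by (simp only: norm_minus_cancel r_def)
qed simp

lemma norm_skew_square_less:
  fixes z :: "'a::unital_cstar_algebra"
  assumes "z * z = 0" "norm z < 1"
  shows "norm ((z - star z) * (z - star z)) < 1"
proof -
  have "(norm z)\<^sup>2 < 1" using assms(2) by (simp add: power_less_one_iff)
  then show ?thesis using norm_skew_square[OF assms(1)] by linarith
qed

text \<open>If \<open>star z * z * c \<approx> c\<close> and \<open>star z * c \<approx> 0\<close>,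
  then the rotation carries \<open>c\<close> to about \<open>z * c\<close>. The error is
  \<open>s * c - star z * c\<close>, and the first term is controlled through
  \<open>s * s = 1 - star z * z - z * star z\<close>.\<close>

lemma
  fixes z :: "'a::unital_cstar_algebra"
  assumes "z * z = 0" "norm z < 1"
  shows unitary_rotation: "unitary (rotation z)"
    and norm_rotation_minus:
      "norm (rotation z * c - z * c) \<le> sqrt (norm c * (norm (star z * z * c - c) + norm (star z * c))) + norm (star z * c)"
proof -
  define k where "k = z - star z"
  define s where "s = bpow (1/2) (k * k)"
  have n: "norm (k * k) < 1" unfolding k_def by (rule norm_skew_square_less[OF assms])
  have sk: "star k = - k" by (simp add: k_def star_diff)
  have "star (k * k) = k * k" by (simp add: star_mult sk)
  then have ss: "star s = s" unfolding s_def by (rule star_bpow[OF n])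
  have s2: "s * s = 1 + k * k" unfolding s_def by (rule bpow_half_sq[OF n])
  have sc: "s * k = k * s" unfolding s_def by (rule bpow_commute[OF n]) (simp add: mult.assoc)
  have rot: "rotation z = s + k" by (simp add: rotation_def s_def k_def)
  show "unitary (rotation z)"
    unfolding unitary_def rot by (simp add: star_add ss sk algebra_simps s2 sc)
  have zz: "star z * star z = 0" using arg_cong[OF assms(1), of star] by (simp add: star_mult)
  have "s * s * c = - (star z * z * c - c) - z * (star z * c)"
    by (simp add: s2 k_def algebra_simps zz) (simp add: assms(1) zz flip: mult.assoc)
  then have "norm (s * s * c) \<le> norm (star z * z * c - c) + norm (z * (star z * c))"
    using norm_triangle_ineq4[of "- (star z * z * c - c)" "z * (star z * c)"] by (simp only: norm_minus_cancel)
  also have "norm (z * (star z * c)) \<le> norm (star z * c)"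
    by (rule norm_mult_le(1)) (use assms(2) in simp)
  finally have le: "norm (s * s * c) \<le> norm (star z * z * c - c) + norm (star z * c)" by simp
  have "(norm (s * c))\<^sup>2 = norm (star c * (s * s * c))"
    by (simp add: star_mult ss mult.assoc flip: cstar_identity)
  also have "\<dots> \<le> norm c * norm (s * s * c)" using norm_mult_ineq[of "star c"] by simp
  also have "\<dots> \<le> norm c * (norm (star z * z * c - c) + norm (star z * c))"
    by (intro mult_left_mono le) simp
  finally have "norm (s * c) \<le> sqrt (norm c * (norm (star z * z * c - c) + norm (star z * c)))"
    by (rule real_le_rsqrt)
  moreover have eq: "rotation z * c - z * c = s * c - star z * c"
    by (simp add: rot k_def algebra_simps)
  ultimately show "norm (rotation z * c - z * c)
      \<le> sqrt (norm c * (norm (star z * z * c - c) + norm (star z * c))) + norm (star z * c)"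
    unfolding eq using norm_triangle_ineq4[of "s * c" "star z * c"] by linarith
qed

lemma scalar_part_rotation:
  fixes z :: "'a::cstar_algebra unitization"
  assumes "z * z = 0" "norm z < 1" "scalar_part z = 0"
  shows "scalar_part (rotation z) = 1"
proof -
  have "scalar_part (bpow (1/2) ((z - star z) * (z - star z))) = 1"
    by (rule scalar_part_bpow[OF norm_skew_square_less[OF assms(1,2)]])
      (simp add: times_unitization_def minus_unitization_def star_unitization_def assms(3))
  then show ?thesis
    by (simp add: rotation_def plus_unitization_def minus_unitization_def star_unitization_def assms(3))
qed

lemma continuous_on_rotation:
  fixes z :: "'t::topological_space \<Rightarrow> 'a::unital_cstar_algebra"
  assumes "continuous_on S z" "\<And>t. t \<in> S \<Longrightarrow> z t * z t = 0" "\<And>t. t \<in> S \<Longrightarrow> norm (z t) < 1"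
  shows "continuous_on S (\<lambda>t. rotation (z t))"
  unfolding rotation_def
proof (intro continuous_on_add continuous_on_compose2[OF continuous_on_bpow])
  show "continuous_on S (\<lambda>t. z t - star (z t))" "continuous_on S (\<lambda>t. (z t - star (z t)) * (z t - star (z t)))"
    by (intro continuous_intros assms(1))+
  show "(\<lambda>t. (z t - star (z t)) * (z t - star (z t))) ` S \<subseteq> ball 0 1"
    using assms(2,3) by (auto intro!: norm_skew_square_less)
qed

lemma rotation_tendsto:
  fixes z c :: "'i \<Rightarrow> 'a::unital_cstar_algebra"
  assumes "\<And>i. z i * z i = 0" "\<And>i. norm (z i) < 1" "\<And>i. norm (c i) \<le> C"
    and "((\<lambda>i. star (z i) * z i * c i - c i) \<longlongrightarrow> 0) F" "((\<lambda>i. star (z i) * c i) \<longlongrightarrow> 0) F"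
  shows "((\<lambda>i. rotation (z i) * c i - z i * c i) \<longlongrightarrow> 0) F"
proof (rule Lim_null_comparison)
  define e where "e i = norm (star (z i) * z i * c i - c i) + norm (star (z i) * c i)" for i
  have e: "(e \<longlongrightarrow> 0) F"
    unfolding e_def using tendsto_add[OF tendsto_norm_zero[OF assms(4)] tendsto_norm_zero[OF assms(5)]] by simp
  have "norm (rotation (z i) * c i - z i * c i) \<le> sqrt (C * e i) + norm (star (z i) * c i)" for i
  proof -
    have "sqrt (norm (c i) * e i) \<le> sqrt (C * e i)"
      using assms(3)[of i] by (intro real_sqrt_le_mono mult_right_mono) (auto simp: e_def)
    then show ?thesis
      using norm_rotation_minus[OF assms(1,2), of i "c i", folded e_def] by linarith
  qed
  then show "\<forall>\<^sub>F i in F. norm (rotation (z i) * c i - z i * c i) \<le> sqrt (C * e i) + norm (star (z i) * c i)"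
    by simp
  have "((\<lambda>i. sqrt (C * e i) + norm (star (z i) * c i)) \<longlongrightarrow> sqrt (C * 0) + 0) F"
    by (intro tendsto_add tendsto_real_sqrt tendsto_mult tendsto_const e tendsto_norm_zero assms(5))
  then show "((\<lambda>i. sqrt (C * e i) + norm (star (z i) * c i)) \<longlongrightarrow> 0) F" by simp
qed

text \<open>The first rotation carries \<open>c\<close> to \<open>Svc\<close>, in a corner orthogonal to the one of \<open>v\<close>, and the
  second one carries \<open>Svc\<close> back to \<open>vc\<close>.\<close>

lemma double_rotation:
  fixes v S :: "'i \<Rightarrow> 'a::unital_cstar_algebra"
  assumes v: "\<And>i. norm (v i) < 1" and S: "\<And>i. norm (S i) \<le> 1"
    and orth: "\<And>i. v i * S i * v i = 0" "\<And>i. star (v i) * S i * v i = 0"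
    and SS: "((\<lambda>i. star (S i) * S i * v i - v i) \<longlongrightarrow> 0) F"
    and vv: "((\<lambda>i. star (v i) * v i * c) \<longlongrightarrow> c) F"
  shows "(S i * v i) * (S i * v i) = 0" "norm (S i * v i) < 1"
    "(v i * star (v i) * star (S i)) * (v i * star (v i) * star (S i)) = 0"
    "norm (v i * star (v i) * star (S i)) < 1"
    "((\<lambda>i. (rotation (v i * star (v i) * star (S i)) * rotation (S i * v i) - v i) * c) \<longlongrightarrow> 0) F"
proof -
  define z1 where "z1 i = S i * v i" for i
  define z2 where "z2 i = v i * star (v i) * star (S i)" for i
  define d where "d i = S i * v i * c" for i
  have v1: "norm (v i) \<le> 1" for i using v[of i] by simp
  have vo: "v i * (S i * (v i * x)) = 0" "star (v i) * (S i * (v i * x)) = 0" for i x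
    using orth[of i] by (metis mult.assoc mult_zero_left)+
  have so: "star (v i) * (star (S i) * (star (v i) * x)) = 0" "star (v i) * (star (S i) * (v i * x)) = 0" for i x
  proof -
    have "star (v i * S i * v i) * x = 0" "star (star (v i) * S i * v i) * x = 0" by (simp_all add: orth)
    then show "star (v i) * (star (S i) * (star (v i) * x)) = 0" "star (v i) * (star (S i) * (v i * x)) = 0"
      by (simp_all add: star_mult mult.assoc)
  qed
  have prod: "norm (x * y) < 1" if "norm x \<le> 1" "norm y < 1" for x y :: 'a
    using norm_mult_le(1)[of x y] that by linarith
  have prod': "norm (x * y) < 1" if "norm x < 1" "norm y \<le> 1" for x y :: 'a
    using norm_mult_le(2)[of y x] that by linarith
  have z1: "z1 i * z1 i = 0" "norm (z1 i) < 1" for i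
    unfolding z1_def by (simp add: mult.assoc vo(1)[of i 1, simplified]) (rule prod[OF S v])
  have z2: "z2 i * z2 i = 0" "norm (z2 i) < 1" for i
    unfolding z2_def by (simp add: mult.assoc so) (intro prod' v; use S v1 in simp)
  show "(S i * v i) * (S i * v i) = 0" "norm (S i * v i) < 1"
    "(v i * star (v i) * star (S i)) * (v i * star (v i) * star (S i)) = 0"
    "norm (v i * star (v i) * star (S i)) < 1"
    using z1[of i] z2[of i] by (simp_all add: z1_def z2_def)
  note bd = tendsto_0_mult_bounded(2)[where C = 1, rotated]
  have SSc: "((\<lambda>i. (star (S i) * S i * v i - v i) * c) \<longlongrightarrow> 0) F"
    by (rule tendsto_0_mult_bounded(1)[OF SS, where C = "norm c"]) simp
  have vvc: "((\<lambda>i. star (v i) * v i * c - c) \<longlongrightarrow> 0) F" using vv by (rule LIM_zero)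
  have "((\<lambda>i. star (v i) * ((star (S i) * S i * v i - v i) * c) + (star (v i) * v i * c - c)) \<longlongrightarrow> 0 + 0) F"
    by (intro tendsto_add vvc bd[OF _ SSc]) (simp add: v1)
  then have a1: "((\<lambda>i. star (z1 i) * z1 i * c - c) \<longlongrightarrow> 0) F"
    by (simp add: z1_def star_mult algebra_simps)
  \<comment> \<open>Orthogonality gives \<open>star (z1 i) * star (v i) = 0\<close>, so this product
    is \<open>- star (z1 i) * c\<close>: the support of \<open>v\<close> is asymptotically
    orthogonal to the third corner.\<close>
  have "((\<lambda>i. star (z1 i) * (star (v i) * v i * c - c)) \<longlongrightarrow> 0) F"
    by (rule bd[OF _ vvc]) (use z1(2) in \<open>simp add: less_imp_le\<close>)
  moreover have "star (z1 i) * (star (v i) * v i * c - c) = - (star (z1 i) * c)" for i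
    by (simp add: z1_def star_mult algebra_simps so)
  ultimately have "((\<lambda>i. - (star (z1 i) * c)) \<longlongrightarrow> 0) F" by simp
  from tendsto_minus[OF this] have a2: "((\<lambda>i. star (z1 i) * c) \<longlongrightarrow> 0) F" by simp
  have A: "((\<lambda>i. rotation (z1 i) * c - z1 i * c) \<longlongrightarrow> 0) F"
    by (rule rotation_tendsto[OF z1 _ a1 a2, where C = "norm c"]) simp
  have nd: "norm (d i) \<le> norm c" for i
    unfolding d_def by (rule norm_mult_le(1)) (use z1(2)[of i] in \<open>simp add: z1_def\<close>)
  have vvv: "((\<lambda>i. star (v i) * v i * (star (v i) * v i * c - c)) \<longlongrightarrow> 0) F"
    by (rule bd[OF _ vvc]) (use v1 in \<open>simp add: cstar_identity power_le_one\<close>)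
  have "((\<lambda>i. (z1 i * star (v i) * (v i * star (v i))) * ((star (S i) * S i * v i - v i) * c)
      + z1 i * (star (v i) * v i * (star (v i) * v i * c - c) + (star (v i) * v i * c - c))) \<longlongrightarrow> 0 + 0) F"
  proof (intro tendsto_add bd[OF _ SSc] bd)
    show "\<forall>\<^sub>F i in F. norm (z1 i * star (v i) * (v i * star (v i))) \<le> 1"
      by (intro always_eventually allI norm_mult_le_1) (simp_all add: v1 z1(2) less_imp_le)
    show "\<forall>\<^sub>F i in F. norm (z1 i) \<le> 1" using z1(2)[THEN less_imp_le] by simp
    show "((\<lambda>i. star (v i) * v i * (star (v i) * v i * c - c) + (star (v i) * v i * c - c)) \<longlongrightarrow> 0) F"
      using tendsto_add[OF vvv vvc] by simp
  qed
  moreover have "(z1 i * star (v i) * (v i * star (v i))) * ((star (S i) * S i * v i - v i) * c)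
      + z1 i * (star (v i) * v i * (star (v i) * v i * c - c) + (star (v i) * v i * c - c))
      = star (z2 i) * z2 i * d i - d i" for i
    by (simp add: z1_def z2_def d_def star_mult algebra_simps)
  ultimately have b1: "((\<lambda>i. star (z2 i) * z2 i * d i - d i) \<longlongrightarrow> 0) F" by simp
  have "star (z2 i) * d i = 0" for i
    by (simp add: z2_def d_def star_mult mult.assoc vo)
  then have b2: "((\<lambda>i. star (z2 i) * d i) \<longlongrightarrow> 0) F" by simp
  have B: "((\<lambda>i. rotation (z2 i) * d i - z2 i * d i) \<longlongrightarrow> 0) F"
    by (rule rotation_tendsto[OF z2 nd b1 b2])
  have "((\<lambda>i. (v i * star (v i)) * ((star (S i) * S i * v i - v i) * c) + v i * (star (v i) * v i * c - c)) \<longlongrightarrow> 0 + 0) F"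
  proof (intro tendsto_add bd[OF _ SSc] bd[OF _ vvc])
    show "\<forall>\<^sub>F i in F. norm (v i * star (v i)) \<le> 1"
      using v1 by (simp add: norm_mult_star_self power_le_one)
    show "\<forall>\<^sub>F i in F. norm (v i) \<le> 1" using v1 by simp
  qed
  moreover have "(v i * star (v i)) * ((star (S i) * S i * v i - v i) * c) + v i * (star (v i) * v i * c - c)
      = z2 i * d i - v i * c" for i
    by (simp add: z2_def d_def algebra_simps)
  ultimately have E: "((\<lambda>i. z2 i * d i - v i * c) \<longlongrightarrow> 0) F" by simp
  have "((\<lambda>i. rotation (z2 i) * (rotation (z1 i) * c - z1 i * c) + (rotation (z2 i) * d i - z2 i * d i)
      + (z2 i * d i - v i * c)) \<longlongrightarrow> 0 + 0 + 0) F"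
    by (intro tendsto_add B E bd[OF _ A]) (simp add: norm_unitary unitary_rotation z2)
  then have "((\<lambda>i. (rotation (z2 i) * rotation (z1 i) - v i) * c) \<longlongrightarrow> 0) F"
    by (simp add: d_def z1_def algebra_simps)
  then show "((\<lambda>i. (rotation (v i * star (v i) * star (S i)) * rotation (S i * v i) - v i) * c) \<longlongrightarrow> 0) F"
    by (simp add: z1_def z2_def)
qed

section \<open>Matrix units in the compact operators\<close>

definition ell2_basis :: "nat \<Rightarrow> ell2" where
  "ell2_basis i = Abs_ell2 (\<lambda>n. if n = i then 1 else 0)"

lemma ell2_nth_basis: "ell2_nth (ell2_basis i) n = (if n = i then 1 else 0)"
proof -
  have "summable (\<lambda>n. (cmod (if n = i then 1 else 0))\<^sup>2)"
    by (rule summable_finite[of "{i}"]) auto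
  then show ?thesis by (simp add: ell2_basis_def ell2_nth_Abs)
qed

lemma norm_ell2_basis: "norm (ell2_basis i) = 1"
proof -
  have "(norm (ell2_basis i))\<^sup>2 = (\<Sum>n. if n = i then 1 else 0)"
    unfolding norm_ell2_sq by (rule suminf_cong) (simp add: ell2_nth_basis)
  also have "\<dots> = 1" using sums_single[of i "\<lambda>_. 1 :: real"] by (simp add: sums_iff cong: if_cong)
  finally show ?thesis by (simp add: power2_eq_1_iff) (smt (verit) norm_ge_zero)
qed

lemma bounded_linear_matrix_unit: "bounded_linear (\<lambda>x. ell2_nth x j *\<^sub>C ell2_basis i)"
  by (rule bounded_linear_intro[where K = 1])
    (simp_all add: scaleC_add_left scaleR_scaleC scaleC_scaleC norm_ell2_scaleC norm_ell2_basis norm_ell2_nth)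

lift_definition matrix_unit :: "nat \<Rightarrow> nat \<Rightarrow> compact_op" is
  "\<lambda>i j. Blinfun (\<lambda>x. ell2_nth x j *\<^sub>C ell2_basis i)"
proof -
  fix i j
  let ?T = "Blinfun (\<lambda>x. ell2_nth x j *\<^sub>C ell2_basis i)"
  have ap: "blinfun_apply ?T = (\<lambda>x. ell2_nth x j *\<^sub>C ell2_basis i)"
    by (rule bounded_linear_Blinfun_apply[OF bounded_linear_matrix_unit])
  define K where "K = (\<lambda>c. c *\<^sub>C ell2_basis i) ` cball (0::complex) 1"
  have "bounded_linear (\<lambda>c::complex. c *\<^sub>C ell2_basis i)"
    by (rule bounded_linear_intro[where K = 1])
      (simp_all add: scaleC_add_left scaleR_scaleC scaleC_scaleC norm_ell2_scaleC norm_ell2_basis scaleR_conv_of_real)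
  then have "compact K" unfolding K_def
    by (intro compact_continuous_image linear_continuous_on) auto
  moreover have "blinfun_apply ?T ` ball 0 1 \<subseteq> K"
  proof
    fix y assume "y \<in> blinfun_apply ?T ` ball 0 1"
    then obtain x where x: "norm x < 1" "y = ell2_nth x j *\<^sub>C ell2_basis i" by (auto simp: ap)
    then have "cmod (ell2_nth x j) \<le> 1" using norm_ell2_nth[of x j] by linarith
    then show "y \<in> K" unfolding K_def x(2) by (intro imageI) simp
  qed
  then have "closure (blinfun_apply ?T ` ball 0 1) \<subseteq> K"
    using \<open>compact K\<close> by (intro closure_minimal compact_imp_closed)
  ultimately have "compact (closure (blinfun_apply ?T ` ball 0 1))"
    by (metis closed_closure compact_Int_closed inf.absorb_iff2)
  moreover have "clinear (blinfun_apply ?T)"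
    by (simp add: ap clinear_def scaleC_add_left scaleC_scaleC)
  ultimately show "is_compact_op ?T" by (simp add: is_compact_op_def)
qed

lemma Rep_matrix_unit: "blinfun_apply (Rep_compact_op (matrix_unit i j)) x = ell2_nth x j *\<^sub>C ell2_basis i"
  by (simp add: matrix_unit.rep_eq bounded_linear_Blinfun_apply[OF bounded_linear_matrix_unit])

lemma compact_op_eqI:
  assumes "\<And>x. blinfun_apply (Rep_compact_op S) x = blinfun_apply (Rep_compact_op T) x"
  shows "S = T"
  using assms by (metis Rep_compact_op_inject blinfun_eqI)

lemma matrix_unit_mult: "matrix_unit i j * matrix_unit k l = (if j = k then matrix_unit i l else 0)"
  by (rule compact_op_eqI)
    (auto simp: times_compact_op.rep_eq zero_compact_op.rep_eq Rep_matrix_unit ell2_nth_basis)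

lemma inner_ell2_basis: "inner (c *\<^sub>C ell2_basis i) y = Re (cnj c * ell2_nth y i)"
proof -
  have "inner (c *\<^sub>C ell2_basis i) y = (\<Sum>n. if n = i then Re (cnj c * ell2_nth y i) else 0)"
    unfolding inner_ell2_def by (rule suminf_cong) (simp add: ell2_nth_basis)
  also have "\<dots> = Re (cnj c * ell2_nth y i)"
    using sums_single[of i "\<lambda>_. Re (cnj c * ell2_nth y i)"] by (simp add: sums_iff cong: if_cong)
  finally show ?thesis .
qed

lemma star_matrix_unit: "star (matrix_unit i j) = matrix_unit j i"
proof -
  have "ell2_adjoint (Rep_compact_op (matrix_unit i j)) = Rep_compact_op (matrix_unit j i)"
    by (rule ell2_adjoint_eqI)
      (simp add: Rep_matrix_unit inner_ell2_basis inner_commute[of _ "_ *\<^sub>C ell2_basis _"] mult.commute)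
  then show ?thesis by (simp add: star_compact_op.rep_eq flip: Rep_compact_op_inject)
qed

definition proj :: "nat \<Rightarrow> compact_op" where
  "proj m = (\<Sum>i<m. matrix_unit i i)"

text \<open>A partial isometry moving the first \<open>m\<close> coordinates into the block that
  starts at \<open>L\<close>; for \<open>m \<le> L\<close> this block is disjoint from the original
  one.\<close>

definition shift :: "nat \<Rightarrow> nat \<Rightarrow> compact_op" where
  "shift m L = (\<Sum>i<m. matrix_unit (L + i) i)"

lemma star_sum: "star (sum f I) = (\<Sum>i\<in>I. star (f i :: 'a::star_algebra))"
  by (induction I rule: infinite_finite_induct) (auto simp: star_add)

lemma star_proj: "star (proj m) = proj m"
  by (simp add: proj_def star_sum star_matrix_unit)

lemma star_shift_mult_shift: "star (shift m L) * shift m L = proj m"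
  by (simp add: proj_def shift_def star_sum star_matrix_unit sum_product matrix_unit_mult)

lemma star_shift_mult_shift_eq_0: "L + m \<le> L' \<Longrightarrow> star (shift m L) * shift m' L' = 0"
  by (auto simp: shift_def star_sum star_matrix_unit sum_product matrix_unit_mult intro!: sum.neutral)

lemma proj_mult_shift_eq_0: "k \<le> L \<Longrightarrow> proj k * shift m L = 0"
  by (auto simp: shift_def proj_def sum_product matrix_unit_mult intro!: sum.neutral)

lemma proj_mult_proj: "proj m * proj m = proj m"
  by (simp add: proj_def sum_product matrix_unit_mult)

lemma norm_proj_le: "norm (proj m) \<le> 1"
proof -
  have "(norm (proj m))\<^sup>2 = norm (proj m)"
    using cstar_identity[of "proj m"] by (simp add: star_proj proj_mult_proj)
  then show ?thesis by (auto simp: power2_eq_square)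
qed

lemma norm_shift_le: "norm (shift m L) \<le> 1"
proof -
  have "(norm (shift m L))\<^sup>2 \<le> 1\<^sup>2"
    using norm_proj_le[of m] by (simp add: star_shift_mult_shift flip: cstar_identity)
  then show ?thesis by (rule power2_le_imp_le) simp
qed

lemma ell2_nth_proj:
  "ell2_nth (blinfun_apply (Rep_compact_op (proj m)) x) n = (if n < m then ell2_nth x n else 0)"
proof (induction m)
  case 0
  then show ?case by (simp add: proj_def zero_compact_op.rep_eq)
next
  case (Suc m)
  have "proj (Suc m) = proj m + matrix_unit m m" by (simp add: proj_def)
  then show ?case
    using Suc by (auto simp: less_Suc_eq plus_compact_op.rep_eq blinfun.add_left Rep_matrix_unit ell2_nth_basis)
qed

lemma proj_apply_tendsto: "(\<lambda>m. blinfun_apply (Rep_compact_op (proj m)) x) \<longlonglongrightarrow> x"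
proof (rule LIM_zero_cancel, rule tendsto_norm_zero_cancel)
  let ?f = "\<lambda>n. (cmod (ell2_nth x n))\<^sup>2"
  let ?d = "\<lambda>m. blinfun_apply (Rep_compact_op (proj m)) x - x"
  have eq: "(norm (?d m))\<^sup>2 = (\<Sum>n. ?f n) - (\<Sum>n<m. ?f n)" for m
  proof -
    have "(norm (?d m))\<^sup>2 = (\<Sum>n. ?f n - (if n < m then ?f n else 0))"
      unfolding norm_ell2_sq by (rule suminf_cong) (simp add: ell2_nth_proj)
    also have "\<dots> = (\<Sum>n. ?f n) - (\<Sum>n. if n < m then ?f n else 0)"
      by (rule suminf_diff[symmetric, OF ell2_summable]) (rule summable_finite[of "{..<m}"]; simp)
    also have "(\<Sum>n. if n < m then ?f n else 0) = (\<Sum>n<m. if n < m then ?f n else 0)"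
      by (rule suminf_finite) auto
    finally show ?thesis by simp
  qed
  have "(\<lambda>m. (\<Sum>n. ?f n) - (\<Sum>n<m. ?f n)) \<longlonglongrightarrow> (\<Sum>n. ?f n) - (\<Sum>n. ?f n)"
    by (intro tendsto_diff tendsto_const summable_LIMSEQ ell2_summable)
  then have "(\<lambda>m. (norm (?d m))\<^sup>2) \<longlonglongrightarrow> 0" by (simp only: eq diff_self)
  from tendsto_real_sqrt[OF this] show "(\<lambda>m. norm (?d m)) \<longlonglongrightarrow> 0" by simp
qed

text \<open>Compactness upgrades strong convergence of the projections to norm convergence: the
  image of the unit ball has finite nets, on which pointwise convergence is uniform.\<close>

lemma proj_mult_tendsto: "(\<lambda>m. proj m * T) \<longlonglongrightarrow> T"
proof (rule LIMSEQ_I)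
  fix \<epsilon> :: real assume "\<epsilon> > 0"
  define T' where "T' = Rep_compact_op T"
  define P where "P m = Rep_compact_op (proj m)" for m
  \<comment> \<open>Three error terms on the open unit ball, doubled when a vector is scaled by
    \<open>2 * norm x\<close>, add up to \<open>6 * e\<close>.\<close>
  define e where "e = \<epsilon> / 8"
  have e: "e > 0" using \<open>\<epsilon> > 0\<close> by (simp add: e_def)
  have "is_compact_op T'" unfolding T'_def using Rep_compact_op by blast
  then obtain F where F: "finite F" "\<And>x. norm x < 1 \<Longrightarrow> \<exists>y\<in>F. dist (blinfun_apply T' x) y < e"
    using e unfolding is_compact_op_iff by meson
  have "\<forall>y\<in>F. \<forall>\<^sub>F m in sequentially. dist (blinfun_apply (P m) y) y < e"
    unfolding P_def using tendstoD[OF proj_apply_tendsto e] by blast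
  then have "\<forall>\<^sub>F m in sequentially. \<forall>y\<in>F. dist (blinfun_apply (P m) y) y < e"
    using F(1) by (simp add: eventually_ball_finite_distrib)
  then obtain M where M: "\<And>m y. m \<ge> M \<Longrightarrow> y \<in> F \<Longrightarrow> dist (blinfun_apply (P m) y) y < e"
    by (auto simp: eventually_sequentially)
  have "norm (proj m * T - T) < \<epsilon>" if m: "m \<ge> M" for m
  proof -
    define D where "D = (P m o\<^sub>L T') - T'"
    have nP: "norm (P m) \<le> 1" using norm_proj_le[of m] by (simp add: P_def norm_compact_op.rep_eq)
    have small: "norm (blinfun_apply D x) \<le> 3 * e" if x: "norm x < 1" for x
    proof -
      obtain y where y: "y \<in> F" "dist (blinfun_apply T' x) y < e" using F(2)[OF x] by blast
      have "blinfun_apply D x = blinfun_apply (P m) (blinfun_apply T' x - y) + (blinfun_apply (P m) y - y)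
          + (y - blinfun_apply T' x)"
        by (simp add: D_def blinfun.diff_left blinfun.diff_right)
      also have "norm \<dots> \<le> norm (blinfun_apply (P m) (blinfun_apply T' x - y))
          + norm (blinfun_apply (P m) y - y) + norm (y - blinfun_apply T' x)"
        by (rule norm_triangle3)
      also have "norm (blinfun_apply (P m) (blinfun_apply T' x - y)) \<le> 1 * norm (blinfun_apply T' x - y)"
        using nP by (intro order_trans[OF norm_blinfun mult_right_mono]) auto
      finally show ?thesis
        using y(2) M[OF m y(1)] by (simp add: dist_norm norm_minus_commute)
    qed
    have "norm D \<le> 6 * e"
    proof (rule norm_blinfun_bound)
      fix x
      show "norm (blinfun_apply D x) \<le> 6 * e * norm x"
      proof (cases "x = 0")
        case False
        define r where "r = 2 * norm x"
        have r: "r > 0" using False by (simp add: r_def)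
        have "norm (x /\<^sub>R r) < 1" unfolding norm_divideR[OF r] using False by (simp add: r_def)
        then have "norm (blinfun_apply D (x /\<^sub>R r)) \<le> 3 * e" by (rule small)
        moreover have "norm (blinfun_apply D (x /\<^sub>R r)) = norm (blinfun_apply D x) / r"
          unfolding blinfun.scaleR_right by (rule norm_divideR[OF r])
        ultimately have "norm (blinfun_apply D x) / r \<le> 3 * e" by simp
        then have "norm (blinfun_apply D x) \<le> 3 * e * r" using r by (simp only: pos_divide_le_eq)
        then show ?thesis by (simp add: r_def)
      qed simp
    qed (use e in simp)
    moreover have "norm (proj m * T - T) = norm D"
      by (simp add: norm_compact_op.rep_eq Rep_compact_op_diff times_compact_op.rep_eq D_def P_def T'_def)
    ultimately show ?thesis using e by (simp add: e_def)
  qed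
  then show "\<exists>M. \<forall>m\<ge>M. norm (proj m * T - T) < \<epsilon>" by blast
qed

section \<open>Local units in a stable algebra\<close>

locale stable_algebra =
  fixes \<tau> :: "'b::cstar_algebra \<Rightarrow> compact_op \<Rightarrow> 'b"
  assumes tensor: "cstar_tensor \<tau>"
begin

lemma tau_lin1: "clinear (\<lambda>a. \<tau> a k)" and tau_lin2: "clinear (\<tau> a)"
  and tau_mult: "\<tau> a k * \<tau> b l = \<tau> (a * b) (k * l)"
  and tau_star: "star (\<tau> a k) = \<tau> (star a) (star k)"
  and norm_tau: "norm (\<tau> a k) = norm a * norm k"
  and tau_dense: "closure (span {\<tau> a k |a k. True}) = UNIV"
  using tensor unfolding cstar_tensor_def by simp_all

lemma tau_0 [simp]: "\<tau> a 0 = 0"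
  using clinearD(4)[OF tau_lin2] .

lemma tau_contraction: "norm e \<le> 1 \<Longrightarrow> norm k \<le> 1 \<Longrightarrow> norm (\<tau> e k) \<le> 1"
  by (simp add: norm_tau mult_le_one)

lemma bounded_bilinear_tau: "bounded_bilinear \<tau>"
  by unfold_locales
    (auto simp: clinearD[OF tau_lin1] clinearD[OF tau_lin2] norm_tau intro!: exI[of _ 1])

text \<open>The two tensor legs grow independently along a product filter. Convergence passes from
  elementary tensors to their span, and by contractivity to the closure.\<close>

lemma tau_tendsto:
  assumes "approx_unit e F"
  shows "((\<lambda>p. \<tau> (e (fst p)) (proj (snd p)) * c) \<longlongrightarrow> c) (F \<times>\<^sub>F sequentially)"
proof -
  define G where "G = F \<times>\<^sub>F sequentially"
  have ne: "norm (e i) \<le> 1" and e: "((\<lambda>i. e i * a) \<longlongrightarrow> a) F" for i a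
    using assms by (auto simp: approx_unit_def)
  have elem: "((\<lambda>p. \<tau> (e (fst p)) (proj (snd p)) * \<tau> a k) \<longlongrightarrow> \<tau> a k) G" for a k
    unfolding tau_mult G_def
    by (intro bounded_bilinear.tendsto[OF bounded_bilinear_tau] filterlim_compose[OF e filterlim_fst]
        filterlim_compose[OF proj_mult_tendsto filterlim_snd])
  have sp: "((\<lambda>p. \<tau> (e (fst p)) (proj (snd p)) * d) \<longlongrightarrow> d) G" if "d \<in> span {\<tau> a k |a k. True}" for d
    using that
  proof (rule span_induct)
    show "subspace {d. ((\<lambda>p. \<tau> (e (fst p)) (proj (snd p)) * d) \<longlongrightarrow> d) G}"
      by (auto simp: subspace_def distrib_left intro: tendsto_add tendsto_scaleR[OF tendsto_const])
  qed (auto simp: elem)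
  show ?thesis
    unfolding G_def[symmetric]
  proof (rule tendsto_if_dense[where L = "\<lambda>p c. \<tau> (e (fst p)) (proj (snd p)) * c" and l = "\<lambda>c. c" and C = 1])
    fix \<epsilon> :: real assume "\<epsilon> > 0"
    moreover have "c \<in> closure (span {\<tau> a k |a k. True})" unfolding tau_dense by simp
    ultimately obtain d where "d \<in> span {\<tau> a k |a k. True}" "dist d c < \<epsilon>"
      unfolding closure_approachable by blast
    then show "\<exists>d. norm (d - c) < \<epsilon> \<and> ((\<lambda>p. \<tau> (e (fst p)) (proj (snd p)) * d) \<longlongrightarrow> d) G"
      using sp by (auto simp: dist_norm)
  next
    fix p x y
    have "norm (\<tau> (e (fst p)) (proj (snd p)) * (x - y)) \<le> norm (x - y)"
      by (intro norm_mult_le(1) tau_contraction ne norm_proj_le)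
    then show "norm (\<tau> (e (fst p)) (proj (snd p)) * x - \<tau> (e (fst p)) (proj (snd p)) * y) \<le> 1 * norm (x - y)"
      by (simp add: right_diff_distrib)
  qed auto
qed

text \<open>A single \<open>e\<close> serves all large \<open>m\<close>, so that projections can
  later be enlarged without touching it. Compactness reduces the uniform estimate to a finite
  net.\<close>

lemma local_unit:
  assumes "compact K" "\<epsilon> > 0"
  shows "\<exists>e M. star e = e \<and> norm e \<le> 1 \<and> (\<forall>m\<ge>M. \<forall>c\<in>K. norm (\<tau> e (proj m) * c - c) \<le> \<epsilon>)"
proof -
  have \<epsilon>: "\<epsilon> / 3 > 0" using assms by simp
  obtain C where C: "finite C" "K \<subseteq> (\<Union>c\<in>C. ball c (\<epsilon> / 3))"
    using assms(1) \<epsilon> unfolding compact_eq_totally_bounded by blast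
  define A where "A = (finite_subsets_at_top UNIV :: 'b set filter) \<times>\<^sub>F sequentially"
  obtain e :: "'b set \<times> nat \<Rightarrow> 'b" where e: "approx_unit e A" unfolding A_def using approx_unit_exists by blast
  have "\<forall>c\<in>C. \<forall>\<^sub>F p in A \<times>\<^sub>F sequentially. dist (\<tau> (e (fst p)) (proj (snd p)) * c) c < \<epsilon> / 3"
    using tendstoD[OF tau_tendsto[OF e] \<epsilon>] by blast
  then have "\<forall>\<^sub>F p in A \<times>\<^sub>F sequentially. \<forall>c\<in>C. dist (\<tau> (e (fst p)) (proj (snd p)) * c) c < \<epsilon> / 3"
    by (rule eventually_ball_finite[OF C(1)])
  \<comment> \<open>The product filter separates the conditions on the two legs: \<open>i\<close>
    can be fixed while \<open>m\<close> stays free.\<close>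
  then obtain P Q where PQ: "eventually P A" "eventually Q sequentially"
    "\<And>i m. P i \<Longrightarrow> Q m \<Longrightarrow> \<forall>c\<in>C. dist (\<tau> (e i) (proj m) * c) c < \<epsilon> / 3"
    unfolding eventually_prod_filter by auto
  have "A \<noteq> bot" by (simp add: A_def prod_filter_eq_bot)
  then obtain i where i: "P i" using eventually_happens[OF PQ(1)] by blast
  obtain M where M: "\<And>m. m \<ge> M \<Longrightarrow> Q m" using PQ(2) unfolding eventually_sequentially by blast
  have ei: "star (e i) = e i" "norm (e i) \<le> 1" using e unfolding approx_unit_def by blast+
  have "norm (\<tau> (e i) (proj m) * c - c) \<le> \<epsilon>" if m: "m \<ge> M" and c: "c \<in> K" for m c
  proof -
    define q where "q = \<tau> (e i) (proj m)"
    have q: "norm q \<le> 1" unfolding q_def by (intro tau_contraction ei norm_proj_le)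
    obtain d where d: "d \<in> C" "dist d c < \<epsilon> / 3" using C(2) c by auto
    have qd: "dist (q * d) d < \<epsilon> / 3" using PQ(3)[OF i M[OF m]] d(1) by (simp add: q_def)
    have eq: "q * c - c = q * (c - d) + (q * d - d) + (d - c)" by (simp add: algebra_simps)
    show ?thesis
      unfolding q_def[symmetric] eq
      using norm_mult_le(1)[OF q, of "c - d"] d(2) qd norm_triangle3[of "q * (c - d)" "q * d - d" "d - c"]
      by (simp only: dist_norm norm_minus_commute[of d c])
  qed
  with ei show ?thesis by blast
qed

end

section \<open>Paths\<close>

lemma continuous_on_glue:
  fixes f :: "nat \<Rightarrow> real \<Rightarrow> 'a::topological_space"
  assumes cont: "\<And>n. continuous_on {real n..real n + 1} (f n)"
    and match: "\<And>n. f (Suc n) (real n + 1) = f n (real n + 1)"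
  defines "g \<equiv> \<lambda>t. f (nat \<lfloor>t\<rfloor>) t"
  shows "continuous_on {0..} g" and "t \<in> {real n..real n + 1} \<Longrightarrow> g t = f n t"
proof -
  show val: "g t = f n t" if "t \<in> {real n..real n + 1}" for n t
  proof (cases "t = real n + 1")
    case True
    then have "nat \<lfloor>t\<rfloor> = Suc n" by (simp add: floor_add_int)
    then show ?thesis by (simp add: g_def True match)
  next
    case False
    then have "\<lfloor>t\<rfloor> = int n" using that by (intro floor_unique) auto
    then show ?thesis by (simp add: g_def)
  qed
  have fin: "continuous_on {0..real N} g" for N
  proof (induction N)
    case (Suc N)
    have "continuous_on {real N..real N + 1} g"
      by (rule continuous_on_eq[OF cont[of N]]) (simp add: val)
    then have "continuous_on ({0..real N} \<union> {real N..real N + 1}) g"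
      by (intro continuous_on_closed_Un Suc) auto
    also have "{0..real N} \<union> {real N..real N + 1} = {0..real (Suc N)}" by auto
    finally show ?case .
  qed simp
  show "continuous_on {0..} g"
    unfolding continuous_on_eq_continuous_within
  proof
    fix x :: real assume x: "x \<in> {0..}"
    obtain N where N: "x < real N" using reals_Archimedean2 by blast
    have "continuous (at x within {0..real N}) g"
      using fin[of N] x N by (auto simp: continuous_on_eq_continuous_within)
    moreover have "at x within {0..} = at x within {0..real N}"
      by (rule at_within_nhd[where S = "{..<real N}"]) (use N in auto)
    ultimately show "continuous (at x within {0..}) g" by simp
  qed
qed

definition pl_path :: "(nat \<Rightarrow> 'a::real_normed_vector) \<Rightarrow> real \<Rightarrow> 'a" where
  "pl_path e t = (1 - (t - real (nat \<lfloor>t\<rfloor>))) *\<^sub>R e (nat \<lfloor>t\<rfloor>) + (t - real (nat \<lfloor>t\<rfloor>)) *\<^sub>R e (Suc (nat \<lfloor>t\<rfloor>))"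

lemma continuous_on_pl_path: "continuous_on {0..} (pl_path e)"
  and pl_path_eq: "t \<in> {real n..real n + 1} \<Longrightarrow>
    pl_path e t = (1 - (t - real n)) *\<^sub>R e n + (t - real n) *\<^sub>R e (Suc n)"
proof -
  define f where "f n t = (1 - (t - real n)) *\<^sub>R e n + (t - real n) *\<^sub>R e (Suc n)" for n t
  have "continuous_on {real n..real n + 1} (f n)" for n
    unfolding f_def by (intro continuous_intros)
  moreover have "f (Suc n) (real n + 1) = f n (real n + 1)" for n by (simp add: f_def)
  ultimately have "continuous_on {0..} (\<lambda>t. f (nat \<lfloor>t\<rfloor>) t)"
    "t \<in> {real n..real n + 1} \<Longrightarrow> f (nat \<lfloor>t\<rfloor>) t = f n t" for t n
    by (rule continuous_on_glue)+
  then show "continuous_on {0..} (pl_path e)"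
    "t \<in> {real n..real n + 1} \<Longrightarrow> pl_path e t = (1 - (t - real n)) *\<^sub>R e n + (t - real n) *\<^sub>R e (Suc n)"
    by (simp_all add: f_def pl_path_def[abs_def])
qed

lemma pl_path_of_nat: "pl_path e (real n) = e n"
  using pl_path_eq[of "real n" n e] by simp

lemma nat_unit_interval:
  assumes "t \<ge> 0"
  obtains n where "t \<in> {real n..real n + 1}" "n = nat \<lfloor>t\<rfloor>"
  using assms that[of "nat \<lfloor>t\<rfloor>"] by (simp add: of_nat_nat)

lemma norm_linear_segment:
  assumes "linear f" "norm (f p) \<le> r" "norm (f q) \<le> r" "0 \<le> s" "s \<le> (1::real)"
  shows "norm (f ((1 - s) *\<^sub>R p + s *\<^sub>R q)) \<le> (r::real)"
proof -
  have "norm (f ((1 - s) *\<^sub>R p + s *\<^sub>R q)) \<le> (1 - s) * norm (f p) + s * norm (f q)"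
    using assms(4,5) norm_triangle_ineq[of "(1 - s) *\<^sub>R f p" "s *\<^sub>R f q"]
    by (simp add: linear_add[OF assms(1)] linear_scale[OF assms(1)])
  also have "\<dots> \<le> (1 - s) * r + s * r" using assms by (intro add_mono mult_left_mono) auto
  finally show ?thesis by (simp add: algebra_simps)
qed

lemma norm_pl_path_le:
  assumes "\<And>n. norm (e n) \<le> r" "t \<ge> 0"
  shows "norm (pl_path e t) \<le> r"
proof -
  obtain n where "t \<in> {real n..real n + 1}" using nat_unit_interval[OF assms(2)] by blast
  then show ?thesis
    using norm_linear_segment[OF linear_ident, of "e n" r "e (Suc n)" "t - real n"] assms(1)
    by (auto simp: pl_path_eq)
qed

lemma pl_path_tendsto:
  assumes "e \<longlonglongrightarrow> a"
  shows "(pl_path e \<longlongrightarrow> a) at_top"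
proof (rule tendstoI)
  fix \<epsilon> :: real assume \<epsilon>: "\<epsilon> > 0"
  then have "\<epsilon> / 2 > 0" by simp
  then have "\<forall>\<^sub>F n in sequentially. dist (e n) a < \<epsilon> / 2" by (rule tendstoD[OF assms])
  then obtain N where N: "\<And>n. n \<ge> N \<Longrightarrow> dist (e n) a < \<epsilon> / 2"
    by (auto simp: eventually_sequentially)
  have "dist (pl_path e t) a < \<epsilon>" if t: "t \<ge> real N" for t
  proof -
    have "t \<ge> 0" using t of_nat_0_le_iff[of N] by linarith
    then obtain n where n: "t \<in> {real n..real n + 1}" "n = nat \<lfloor>t\<rfloor>" by (rule nat_unit_interval)
    have "n \<ge> N" using n(2) t by (simp add: le_nat_floor)
    define s where "s = t - real n"
    have eq: "pl_path e t - a = (1 - s) *\<^sub>R (e n - a) + s *\<^sub>R (e (Suc n) - a)"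
      using pl_path_eq[OF n(1), of e] by (simp add: s_def algebra_simps)
    have "norm ((1 - s) *\<^sub>R (e n - a) + s *\<^sub>R (e (Suc n) - a)) \<le> \<epsilon> / 2"
      by (rule norm_linear_segment[OF linear_ident])
        (use N[of n] N[of "Suc n"] \<open>n \<ge> N\<close> n(1) in \<open>auto simp: s_def dist_norm\<close>)
    then have "norm (pl_path e t - a) \<le> \<epsilon> / 2" by (simp only: eq)
    then show ?thesis using \<epsilon> by (simp add: dist_norm)
  qed
  then show "\<forall>\<^sub>F t in at_top. dist (pl_path e t) a < \<epsilon>"
    using eventually_ge_at_top by (rule eventually_mono[rotated])
qed

lemma pl_path_mult:
  fixes e :: "nat \<Rightarrow> 'a::real_normed_algebra"
  shows "pl_path e t * a = pl_path (\<lambda>n. e n * a) t" "a * pl_path e t = pl_path (\<lambda>n. a * e n) t"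
  by (simp_all add: pl_path_def distrib_left distrib_right)

text \<open>\<open>approx_unit\<close> constrains every index, so the path is frozen at
  \<open>e 0\<close> for negative times.\<close>

lemma approx_unit_pl_path:
  assumes "approx_unit e sequentially"
  shows "approx_unit (\<lambda>t. pl_path e (max 0 t)) at_top"
proof -
  have e: "star (e n) = e n" "norm (e n) \<le> 1" "(\<lambda>n. e n * a) \<longlonglongrightarrow> a" "(\<lambda>n. a * e n) \<longlonglongrightarrow> a" for n a
    using assms by (auto simp: approx_unit_def)
  have m: "filterlim (\<lambda>t::real. max 0 t) at_top at_top"
    by (rule filterlim_at_top_mono[OF filterlim_ident]) simp
  have "((\<lambda>t. pl_path e (max 0 t) * a) \<longlongrightarrow> a) at_top" "((\<lambda>t. a * pl_path e (max 0 t)) \<longlongrightarrow> a) at_top" for a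
    unfolding pl_path_mult
    by (rule filterlim_compose[OF pl_path_tendsto m] | rule e)+
  then show ?thesis
    by (auto simp: approx_unit_def norm_pl_path_le e) (simp add: pl_path_def star_add star_scaleR e)
qed

text \<open>A continuous diagonal argument. Each \<open>n + max 0 (t - T n)\<close> is 1-Lipschitz
  and equals \<open>n\<close> up to time \<open>T n\<close>; their infimum is therefore continuous
  and cannot exceed \<open>n\<close> before condition \<open>n\<close> has become permanent.\<close>

lemma slow_path:
  fixes P :: "nat \<Rightarrow> real \<Rightarrow> bool"
  assumes "\<And>n. \<forall>\<^sub>F t in at_top. P n t"
  shows "\<exists>\<sigma> :: real \<Rightarrow> real. continuous_on UNIV \<sigma> \<and> (\<forall>t. \<sigma> t \<ge> 0)
    \<and> filterlim \<sigma> at_top at_top \<and> (\<forall>n t. \<sigma> t > real n \<longrightarrow> P n t)"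
proof -
  have "\<exists>T. \<forall>t\<ge>T. P n t" for n using assms[of n] by (simp add: eventually_at_top_linorder)
  then obtain T where T: "\<And>n t. t \<ge> T n \<Longrightarrow> P n t" by metis
  define h where "h n t = real n + max 0 (t - T n)" for n t
  define \<sigma> where "\<sigma> t = (INF n. h n t)" for t
  have h0: "h n t \<ge> 0" for n t by (simp add: h_def)
  have bdd: "bdd_below (range (\<lambda>n. h n t))" for t by (rule bdd_belowI2[where m = 0]) (rule h0)
  have le: "\<sigma> t \<le> h n t" for n t unfolding \<sigma>_def by (rule cINF_lower[OF bdd]) simp
  have lip: "\<sigma> t \<le> \<sigma> s + \<bar>t - s\<bar>" for s t
  proof -
    have "\<sigma> t - \<bar>t - s\<bar> \<le> \<sigma> s"
      unfolding \<sigma>_def[of s]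
    proof (rule cINF_greatest)
      fix n
      have "h n t \<le> h n s + \<bar>t - s\<bar>" by (auto simp: h_def max_def)
      then show "\<sigma> t - \<bar>t - s\<bar> \<le> h n s" using le[of t n] by linarith
    qed simp
    then show ?thesis by simp
  qed
  show ?thesis
  proof (intro exI[of _ \<sigma>] conjI allI impI)
    show "continuous_on UNIV \<sigma>"
      unfolding continuous_on_iff
    proof (intro ballI allI impI)
      fix x e :: real assume "e > 0"
      have "dist (\<sigma> y) (\<sigma> x) < e" if "dist y x < e" for y
        using that lip[of y x] lip[of x y] by (simp add: dist_real_def)
      with \<open>e > 0\<close> show "\<exists>d>0. \<forall>y\<in>UNIV. dist y x < d \<longrightarrow> dist (\<sigma> y) (\<sigma> x) < e" by blast
    qed
    show "\<sigma> t \<ge> 0" for t unfolding \<sigma>_def by (rule cINF_greatest) (auto simp: h0)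
    show "P n t" if "\<sigma> t > real n" for n t
    proof (rule T, rule ccontr)
      assume "\<not> T n \<le> t"
      then show False using that le[of t n] by (simp add: h_def)
    qed
    show "filterlim \<sigma> at_top at_top"
      unfolding filterlim_at_top
    proof
      fix Z :: real
      obtain N where N: "Z \<le> real N" using real_arch_simple by blast
      have "Z \<le> \<sigma> t" if t: "t \<ge> Max (insert 0 (T ` {..<N})) + \<bar>Z\<bar>" for t
        unfolding \<sigma>_def
      proof (rule cINF_greatest)
        fix n
        show "Z \<le> h n t"
        proof (cases "n < N")
          case True
          then have "T n \<le> Max (insert 0 (T ` {..<N}))" by (intro Max_ge) auto
          then show ?thesis using t by (simp add: h_def)
        next
          case False
          then have "Z \<le> real n" using N by linarith
          then show ?thesis by (simp add: h_def)
        qed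
      qed simp
      then show "\<forall>\<^sub>F t in at_top. Z \<le> \<sigma> t" by (auto simp: eventually_at_top_linorder)
    qed
  qed
qed

section \<open>Unitaries in the forced unitisation\<close>

lemma bounded_linear_unit_emb: "bounded_linear (unit_emb :: 'a::cstar_algebra \<Rightarrow> 'a unitization)"
  by (rule bounded_linear_intro[where K = 1]) (simp_all add: unit_emb_simps)

lemma dist_unit_emb [simp]: "dist (unit_emb x) (unit_emb y) = dist x y"
  by (simp add: dist_norm flip: unit_emb_simps)

lemma tendsto_unit_emb_iff: "((\<lambda>i. unit_emb (f i)) \<longlongrightarrow> unit_emb l) F \<longleftrightarrow> (f \<longlongrightarrow> l) F"
  by (simp add: tendsto_iff)

lemma continuous_on_unit_emb_iff: "continuous_on S (\<lambda>t. unit_emb (f t)) \<longleftrightarrow> continuous_on S f"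
  by (simp add: continuous_on_def tendsto_unit_emb_iff)

lemma unit_ext_unit_emb: "unit_ext f (unit_emb x) = unit_emb (f x)"
  by (simp add: unit_ext_def unit_emb_def)

lemma unitary_group_one_plus_iff: "w \<in> unitary_group_one_plus \<longleftrightarrow> unitary w \<and> scalar_part w = 1"
  by (auto simp: unitary_group_one_plus_def range_unit_emb_iff minus_unitization_def one_unitization_def)

lemma unitary_star: "unitary (star w) \<longleftrightarrow> unitary w"
  by (auto simp: unitary_def)

lemma star_unitary_group_one_plus: "w \<in> unitary_group_one_plus \<Longrightarrow> star w \<in> unitary_group_one_plus"
  unfolding unitary_group_one_plus_iff unitary_star by (simp add: star_unitization_def)

lemma unitary_mult:
  fixes u w :: "'a::unital_cstar_algebra"
  assumes "unitary u" "unitary w"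
  shows "unitary (u * w)"
  using assms unfolding unitary_def star_mult by (metis mult.assoc mult.left_neutral)

context stable_algebra
begin

text \<open>\<open>Q\<close> interpolates local units \<open>e n\<close> tensor a projection, and
  \<open>S\<close> interpolates \<open>e n\<close> tensor a shift far beyond those projections.
  Consecutive shifts have orthogonal ranges, so no mixed terms appear in
  \<open>star (S t) * S t\<close>.\<close>

lemma local_unit_path:
  fixes v :: "real \<Rightarrow> 'b"
  assumes "continuous_on UNIV v"
  shows "\<exists>Q S. continuous_on UNIV Q \<and> continuous_on UNIV S
    \<and> (\<forall>t. star (Q t) = Q t \<and> norm (Q t) \<le> 1 \<and> norm (S t) \<le> 1 \<and> Q t * S t * Q t = 0)
    \<and> ((\<lambda>t. Q t * v t - v t) \<longlongrightarrow> 0) at_top \<and> ((\<lambda>t. v t * Q t - v t) \<longlongrightarrow> 0) at_top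
    \<and> ((\<lambda>t. star (S t) * S t * v t - v t) \<longlongrightarrow> 0) at_top"
proof -
  \<comment> \<open>Index \<open>n\<close> is active on both unit intervals next to
    \<open>n\<close>; the adjoints are included to obtain \<open>v t * Q t \<approx> v t\<close> as
    well.\<close>
  define K where "K n = v ` {real n - 1..real n + 1} \<union> star ` v ` {real n - 1..real n + 1}" for n
  have cK: "compact (K n)" for n
    unfolding K_def
    by (intro compact_Un compact_continuous_image continuous_on_star continuous_on_id
        continuous_on_subset[OF assms]) auto
  \<comment> \<open>The estimate is halved because \<open>star (s n) * s n\<close> equals
    \<open>q n * q n\<close>, which incurs the error twice.\<close>
  define good where "good n p \<longleftrightarrow> star (fst p) = fst p \<and> norm (fst p) \<le> 1 \<and> (\<forall>m\<ge>snd p. \<forall>c\<in>K n.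
      norm (\<tau> (fst p) (proj m) * c - c) \<le> 1 / (real n + 1) / 2)" for n and p :: "'b \<times> nat"
  have "\<exists>p. good n p" for n
  proof -
    have "(0::real) < 1 / (real n + 1) / 2" by (simp add: add_nonneg_pos)
    from local_unit[OF cK this] show ?thesis by (auto simp: good_def)
  qed
  then obtain p where p: "\<And>n. good n (p n)" by metis
  define e where "e n = fst (p n)" for n
  define m where "m n = (\<Sum>i\<le>n. snd (p i))" for n
  \<comment> \<open>Summing up to \<open>Suc n\<close> pushes the shifted block beyond the
    projections of both active indices and leaves \<open>L n + m n \<le> L (Suc n)\<close>, so
    consecutive blocks are disjoint.\<close>
  define L where "L n = (\<Sum>i\<le>Suc n. m i)" for n
  have se: "star (e n) = e n" and ne: "norm (e n) \<le> 1" for n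
    using p[of n] by (simp_all add: good_def e_def)
  have mM: "m n \<ge> snd (p n)" for n unfolding m_def by (rule member_le_sum) auto
  have mmono: "mono m" by (rule monoI) (auto simp: m_def intro!: sum_mono2)
  have mL: "m i \<le> L j" if "i \<le> Suc j" for i j unfolding L_def by (rule member_le_sum) (use that in auto)
  have LL: "L n + m n \<le> L (Suc n)" for n
  proof -
    have "L (Suc n) = L n + m (Suc (Suc n))" by (simp add: L_def)
    then show ?thesis using monoD[OF mmono, of n "Suc (Suc n)"] by simp
  qed
  define q where "q n = \<tau> (e n) (proj (m n))" for n
  define s where "s n = \<tau> (e n) (shift (m n) (L n))" for n
  have sq: "star (q n) = q n" and nq: "norm (q n) \<le> 1" and ns: "norm (s n) \<le> 1" for n
    by (simp_all add: q_def s_def tau_star se star_proj tau_contraction ne norm_proj_le norm_shift_le)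
  have qsq: "q i * s j * q k = 0" if "i \<le> Suc j" for i j k
    by (simp add: q_def s_def tau_mult proj_mult_shift_eq_0[OF mL[OF that]] flip: mult.assoc)
  have ss: "star (s n) * s n = q n * q n" for n
    by (simp add: s_def q_def tau_star tau_mult se star_shift_mult_shift proj_mult_proj)
  have ss': "star (s n) * s (Suc n) = 0" for n
    by (simp add: s_def tau_star tau_mult star_shift_mult_shift_eq_0[OF LL])
  have ss'': "star (s (Suc n)) * s n = 0" for n
    using arg_cong[OF ss'[of n], of star] by (simp add: star_mult)
  have qv: "norm (q n * c - c) \<le> 1 / (real n + 1)" "norm (star (s n) * s n * c - c) \<le> 1 / (real n + 1)"
    if c: "c \<in> K n" for n c
  proof -
    define r where "r = 1 / (real n + 1)"
    have *: "norm (q n * c - c) \<le> r / 2"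
      using p[of n] mM[of n] c unfolding good_def q_def e_def r_def by blast
    then show "norm (q n * c - c) \<le> 1 / (real n + 1)"
      unfolding r_def[symmetric] using norm_ge_zero[of "q n * c - c"] by linarith
    have "star (s n) * s n * c - c = q n * (q n * c - c) + (q n * c - c)"
      by (simp add: ss algebra_simps)
    also have "norm \<dots> \<le> norm (q n * c - c) + norm (q n * c - c)"
      by (rule order_trans[OF norm_triangle_ineq add_right_mono[OF norm_mult_le(1)[OF nq]]])
    also have "\<dots> \<le> r" using * by linarith
    finally show "norm (star (s n) * s n * c - c) \<le> 1 / (real n + 1)" by (simp only: r_def)
  qed
  define Q where "Q t = pl_path q (max 0 t)" for t
  \<comment> \<open>Square roots as weights: with vanishing mixed terms,
    \<open>star (S t) * S t\<close> becomes an honest convex combination.\<close>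
  define f where "f n t = sqrt (1 - (t - real n)) *\<^sub>R s n + sqrt (t - real n) *\<^sub>R s (Suc n)" for n t
  define S where "S t = f (nat \<lfloor>max 0 t\<rfloor>) (max 0 t)" for t
  have fc: "continuous_on {real n..real n + 1} (f n)" for n
    unfolding f_def by (intro continuous_intros)
  have fm: "f (Suc n) (real n + 1) = f n (real n + 1)" for n by (simp add: f_def)
  have Sf: "S t = f n (max 0 t)" and Qf: "Q t = (1 - (max 0 t - real n)) *\<^sub>R q n + (max 0 t - real n) *\<^sub>R q (Suc n)"
    if "max 0 t \<in> {real n..real n + 1}" for t n
    unfolding S_def Q_def by (rule continuous_on_glue(2)[OF fc fm that], rule pl_path_eq[OF that])
  have SS: "star (S t) * S t = (1 - (max 0 t - real n)) *\<^sub>R (star (s n) * s n)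
      + (max 0 t - real n) *\<^sub>R (star (s (Suc n)) * s (Suc n))"
    if "max 0 t \<in> {real n..real n + 1}" for t n
  proof -
    define x where "x = max 0 t - real n"
    have x: "0 \<le> x" "x \<le> 1" using that by (auto simp: x_def)
    have "S t = sqrt (1 - x) *\<^sub>R s n + sqrt x *\<^sub>R s (Suc n)"
      unfolding Sf[OF that] f_def x_def ..
    then show ?thesis
      unfolding x_def[symmetric] using x
      by (simp add: star_add star_scaleR distrib_left distrib_right ss' ss'')
  qed
  have int: "\<exists>n. max 0 t \<in> {real n..real n + 1}" for t :: real
    using nat_unit_interval[OF max.cobounded1[of 0 t]] by blast
  have vK: "v t \<in> K n" "v t \<in> K (Suc n)" "star (v t) \<in> K n" "star (v t) \<in> K (Suc n)"
    if "t \<in> {real n..real n + 1}" for t n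
    using that by (auto simp: K_def)
  have max: "max 0 t \<in> {real n..real n + 1}" if "t \<in> {real n..real n + 1}" for t n
    using that by auto
  have inv: "((\<lambda>t::real. 1 / t) \<longlongrightarrow> 0) at_top"
    by (rule tendsto_divide_0[OF tendsto_const filterlim_at_top_imp_at_infinity[OF filterlim_ident]])
  have lim: "((\<lambda>t. g t) \<longlongrightarrow> 0) at_top"
    if g: "\<And>n t. t \<in> {real n..real n + 1} \<Longrightarrow> norm (g t) \<le> 1 / (real n + 1)" for g :: "real \<Rightarrow> 'b"
  proof (rule Lim_null_comparison[OF _ inv])
    have "norm (g t) \<le> 1 / t" if t: "t > 0" for t
    proof -
      obtain n where n: "t \<in> {real n..real n + 1}" using nat_unit_interval[OF less_imp_le[OF t]] by blast
      have "1 / (real n + 1) \<le> 1 / t" using n t by (simp add: frac_le)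
      then show ?thesis using g[OF n] by linarith
    qed
    then show "\<forall>\<^sub>F t in at_top. norm (g t) \<le> 1 / t"
      using eventually_gt_at_top by (rule eventually_mono[rotated])
  qed
  have le: "1 / (real (Suc n) + 1) \<le> 1 / (real n + 1)" for n by (simp add: frac_le)
  have Qest: "norm (Q t * c - c) \<le> 1 / (real n + 1)"
    if t: "t \<in> {real n..real n + 1}" and c: "c \<in> K n" "c \<in> K (Suc n)" for t n c
  proof -
    have eq: "Q t * c - c = (1 - (max 0 t - real n)) *\<^sub>R (q n * c - c) + (max 0 t - real n) *\<^sub>R (q (Suc n) * c - c)"
      unfolding Qf[OF max[OF t]] by (simp add: algebra_simps)
    show ?thesis
      unfolding eq
      by (rule norm_linear_segment[OF linear_ident]) (use t qv(1)[OF c(1)] qv(1)[OF c(2)] le[of n] in auto)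
  qed
  have sQ: "star (Q t) = Q t" for t
    by (simp add: Q_def pl_path_def star_add star_scaleR sq)
  show ?thesis
  proof (rule exI[of _ Q], rule exI[of _ S], intro conjI allI impI)
    have "continuous_on {0..} (\<lambda>t. f (nat \<lfloor>t\<rfloor>) t)" by (rule continuous_on_glue(1)[OF fc fm])
    then show "continuous_on UNIV Q" "continuous_on UNIV S"
      unfolding Q_def S_def
      by (auto intro!: continuous_on_compose2[OF continuous_on_pl_path] continuous_on_compose2[of "{0..}" _ UNIV "max 0"]
          continuous_intros)
    fix t
    show "star (Q t) = Q t" by (rule sQ)
    show "norm (Q t) \<le> 1" unfolding Q_def by (rule norm_pl_path_le[OF nq]) simp
    obtain n where t: "max 0 t \<in> {real n..real n + 1}" using int by blast
    have "norm (star (S t) * S t) \<le> 1"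
      unfolding SS[OF t]
      by (rule norm_linear_segment[OF linear_ident]) (use t ns in \<open>auto simp: cstar_identity power_le_one\<close>)
    then show "norm (S t) \<le> 1" by (simp add: cstar_identity power2_le_iff_abs_le abs_square_le_1)
    show "Q t * S t * Q t = 0"
      unfolding Qf[OF t] Sf[OF t] f_def by (simp add: distrib_left distrib_right qsq)
  next
    show "((\<lambda>t. Q t * v t - v t) \<longlongrightarrow> 0) at_top"
      by (rule lim) (rule Qest[OF _ vK(1,2)])
    show "((\<lambda>t. v t * Q t - v t) \<longlongrightarrow> 0) at_top"
    proof (rule lim)
      fix n t assume t: "t \<in> {real n..real n + 1}"
      have "norm (star (v t * Q t - v t)) \<le> 1 / (real n + 1)"
        using Qest[OF t vK(3,4)[OF t]] by (simp add: star_diff star_mult sQ)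
      then show "norm (v t * Q t - v t) \<le> 1 / (real n + 1)" by simp
    qed
    show "((\<lambda>t. star (S t) * S t * v t - v t) \<longlongrightarrow> 0) at_top"
    proof (rule lim)
      fix n t assume t: "t \<in> {real n..real n + 1}"
      have eq: "star (S t) * S t * v t - v t = (1 - (max 0 t - real n)) *\<^sub>R (star (s n) * s n * v t - v t)
          + (max 0 t - real n) *\<^sub>R (star (s (Suc n)) * s (Suc n) * v t - v t)"
        unfolding SS[OF max[OF t]] by (simp add: algebra_simps)
      show "norm (star (S t) * S t * v t - v t) \<le> 1 / (real n + 1)"
        unfolding eq
        by (rule norm_linear_segment[OF linear_ident]) (use t qv(2)[OF vK(1)[OF t]] qv(2)[OF vK(2)[OF t]] le[of n] in auto)
    qed
  qed
qed

text \<open>Compression by \<open>Q\<close> gives the exact orthogonality that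
  \<open>double_rotation\<close> asks for, and \<open>Q\<close> acts asymptotically as a unit on
  \<open>v\<close>, so nothing is lost in the limit. The filter \<open>F\<close> is kept general to
  cover both the full path and its integer samples.\<close>

lemma stable_unitaries:
  fixes v :: "real \<Rightarrow> 'b"
  assumes cont: "continuous_on UNIV v" and nv: "\<And>t. norm (v t) \<le> 1"
  shows "\<exists>u :: real \<Rightarrow> 'b unitization. continuous_on UNIV u \<and> (\<forall>t. u t \<in> unitary_group_one_plus)
    \<and> (\<forall>F c. F \<le> at_top \<longrightarrow> ((\<lambda>t. star (v t) * v t * c) \<longlongrightarrow> c) F
      \<longrightarrow> ((\<lambda>t. (u t - unit_emb (v t)) * unit_emb c) \<longlongrightarrow> 0) F)"
proof -
  obtain Q S where cQ: "continuous_on UNIV Q" and cS: "continuous_on UNIV S"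
    and QS: "\<forall>t. star (Q t) = Q t \<and> norm (Q t) \<le> 1 \<and> norm (S t) \<le> 1 \<and> Q t * S t * Q t = 0"
    and lims: "((\<lambda>t. Q t * v t - v t) \<longlongrightarrow> 0) at_top" "((\<lambda>t. v t * Q t - v t) \<longlongrightarrow> 0) at_top"
    "((\<lambda>t. star (S t) * S t * v t - v t) \<longlongrightarrow> 0) at_top"
    using local_unit_path[OF cont] by (elim exE conjE) (rule that)
  have Q: "star (Q t) = Q t" "norm (Q t) \<le> 1" and S: "norm (S t) \<le> 1" and QSQ: "Q t * S t * Q t = 0" for t
    using QS by simp_all
  \<comment> \<open>A continuous factor in \<open>[1/2, 1)\<close> tending to 1, which gives
    \<open>v'\<close> norm strictly below 1.\<close>
  define r where "r t = 1 - 1 / (max 0 t + 2)" for t :: real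
  have r: "0 \<le> r t" "r t < 1" for t by (auto simp: r_def divide_le_eq_1)
  have cr: "continuous_on UNIV r" unfolding r_def by (auto intro!: continuous_intros)
  have r1: "((\<lambda>t. r t - 1) \<longlongrightarrow> 0) at_top"
  proof -
    have "filterlim (\<lambda>t::real. max 0 t + 2) at_top at_top"
      by (rule filterlim_at_top_mono[OF filterlim_ident]) (rule always_eventually, simp add: max_def)
    then have "((\<lambda>t::real. 1 / (max 0 t + 2)) \<longlongrightarrow> 0) at_top"
      by (rule tendsto_divide_0[OF tendsto_const filterlim_at_top_imp_at_infinity])
    from tendsto_minus[OF this] show ?thesis by (simp add: r_def)
  qed
  define v' where "v' t = r t *\<^sub>R (Q t * v t * Q t)" for t
  have QvQ: "norm (Q t * v t * Q t) \<le> 1" for t by (intro norm_mult_le_1 Q nv)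
  have nv': "norm (v' t) < 1" for t
  proof -
    from QvQ have "r t * norm (Q t * v t * Q t) \<le> r t * 1" using r by (intro mult_left_mono) auto
    then show ?thesis using r[of t] by (simp add: v'_def)
  qed
  have sv': "star (v' t) = r t *\<^sub>R (Q t * star (v t) * Q t)" for t
    by (simp add: v'_def star_scaleR star_mult Q mult.assoc)
  have qsq: "Q t * (S t * (Q t * x)) = 0" for t x
    using QSQ[of t] by (metis mult.assoc mult_zero_left)
  have orth: "v' t * S t * v' t = 0" "star (v' t) * S t * v' t = 0" for t
    by (simp_all add: sv' mult.assoc) (simp_all add: v'_def mult.assoc qsq)
  have diff: "((\<lambda>t. v' t - v t) \<longlongrightarrow> 0) at_top"
  proof -
    have a: "((\<lambda>t. (Q t * v t - v t) * Q t) \<longlongrightarrow> 0) at_top"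
      by (rule tendsto_0_mult_bounded(1)[OF lims(1), where C = 1]) (use Q in auto)
    have b: "((\<lambda>t. (r t - 1) *\<^sub>R (Q t * v t * Q t)) \<longlongrightarrow> 0) at_top"
    proof (rule Lim_null_comparison[OF _ tendsto_norm_zero[OF r1]])
      have "norm ((r t - 1) *\<^sub>R (Q t * v t * Q t)) \<le> norm (r t - 1)" for t
      proof -
        from QvQ have "\<bar>r t - 1\<bar> * norm (Q t * v t * Q t) \<le> \<bar>r t - 1\<bar> * 1" by (intro mult_left_mono) auto
        then show ?thesis by simp
      qed
      then show "\<forall>\<^sub>F t in at_top. norm ((r t - 1) *\<^sub>R (Q t * v t * Q t)) \<le> norm (r t - 1)" by simp
    qed
    have eq: "v' t - v t = (r t - 1) *\<^sub>R (Q t * v t * Q t) + ((Q t * v t - v t) * Q t + (v t * Q t - v t))" for t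
      by (simp add: v'_def algebra_simps)
    show ?thesis unfolding eq using tendsto_add[OF b tendsto_add[OF a lims(2)]] by simp
  qed
  have SS: "((\<lambda>t. star (S t) * S t * v' t - v' t) \<longlongrightarrow> 0) at_top"
  proof -
    have "((\<lambda>t. star (S t) * S t * (v' t - v t)) \<longlongrightarrow> 0) at_top"
      by (rule tendsto_0_mult_bounded(2)[OF diff, where C = 1]) (use S in \<open>auto simp: cstar_identity power_le_one\<close>)
    from tendsto_diff[OF tendsto_add[OF this lims(3)] diff] show ?thesis by (simp add: algebra_simps)
  qed
  define V where "V t = unit_emb (v' t)" for t
  define T where "T t = unit_emb (S t)" for t
  have VT: "norm (V t) < 1" "norm (T t) \<le> 1" "V t * T t * V t = 0" "star (V t) * T t * V t = 0" for t
    using nv' S orth[of t] by (simp_all add: V_def T_def unit_emb_simps(7) flip: unit_emb_simps(3,4))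
  have TT: "((\<lambda>t. star (T t) * T t * V t - V t) \<longlongrightarrow> 0) at_top"
    using bounded_linear.tendsto_zero[OF bounded_linear_unit_emb SS] by (simp add: V_def T_def unit_emb_simps)
  define z1 where "z1 t = T t * V t" for t
  define z2 where "z2 t = V t * star (V t) * star (T t)" for t
  define u where "u t = rotation (z2 t) * rotation (z1 t)" for t
  note dr = double_rotation[OF VT]
  \<comment> \<open>These four facts do not involve \<open>c\<close>; the value 0 makes the
    remaining hypothesis of \<open>double_rotation\<close> trivial.\<close>
  have z: "z1 t * z1 t = 0" "norm (z1 t) < 1" "z2 t * z2 t = 0" "norm (z2 t) < 1" for t
    unfolding z1_def z2_def by (rule dr(1-4)[OF TT, of 0]; simp)+
  have cV: "continuous_on UNIV V" and cT: "continuous_on UNIV T"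
    unfolding V_def T_def continuous_on_unit_emb_iff v'_def
    by (intro continuous_intros cont cQ cS cr)+
  show ?thesis
  proof (intro exI[of _ u] conjI allI impI)
    show "continuous_on UNIV u"
      unfolding u_def
      by (intro continuous_on_mult continuous_on_rotation z)
        (auto simp: z1_def z2_def intro!: continuous_intros cV cT)
    have "scalar_part (z1 t) = 0" "scalar_part (z2 t) = 0" for t
      by (simp_all add: z1_def z2_def V_def T_def unit_emb_def times_unitization_def)
    then have "scalar_part (u t) = 1" for t
      unfolding u_def using z by (simp add: times_unitization_def scalar_part_rotation)
    moreover have "unitary (u t)" for t
      unfolding u_def by (intro unitary_mult unitary_rotation z)
    ultimately show "u t \<in> unitary_group_one_plus" for t
      by (simp add: unitary_group_one_plus_iff)
    fix F c assume F: "F \<le> at_top" and c: "((\<lambda>t. star (v t) * v t * c) \<longlongrightarrow> c) F"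
    note mono = tendsto_mono[OF F]
    have dc: "((\<lambda>t. (v' t - v t) * c) \<longlongrightarrow> 0) F"
      by (rule tendsto_0_mult_bounded(1)[OF mono[OF diff], where C = "norm c"]) simp
    have sd: "((\<lambda>t. star (v' t - v t)) \<longlongrightarrow> 0) F" using tendsto_star[OF mono[OF diff]] by simp
    have n1: "norm (v t * c) \<le> norm c" for t by (rule norm_mult_le(1)[OF nv])
    have "((\<lambda>t. star (v' t) * ((v' t - v t) * c)) \<longlongrightarrow> 0) F"
      by (rule tendsto_0_mult_bounded(2)[OF dc, where C = 1]) (simp add: nv' less_imp_le)
    moreover have "((\<lambda>t. star (v' t - v t) * (v t * c)) \<longlongrightarrow> 0) F"
      by (rule tendsto_0_mult_bounded(1)[OF sd, where C = "norm c"]) (use n1 in auto)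
    ultimately have "((\<lambda>t. star (v' t) * ((v' t - v t) * c) + star (v' t - v t) * (v t * c)
        + star (v t) * v t * c) \<longlongrightarrow> 0 + 0 + c) F"
      by (intro tendsto_add c)
    then have "((\<lambda>t. star (v' t) * v' t * c) \<longlongrightarrow> c) F" by (simp add: star_diff algebra_simps)
    then have "((\<lambda>t. star (V t) * V t * unit_emb c) \<longlongrightarrow> unit_emb c) F"
      by (simp add: V_def tendsto_unit_emb_iff flip: unit_emb_simps(3,4))
    from dr(5)[OF mono[OF TT] this]
    have "((\<lambda>t. (u t - V t) * unit_emb c) \<longlongrightarrow> 0) F" by (simp add: u_def z1_def z2_def)
    moreover have "((\<lambda>t. unit_emb ((v' t - v t) * c)) \<longlongrightarrow> 0) F"
      by (rule bounded_linear.tendsto_zero[OF bounded_linear_unit_emb dc])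
    ultimately have "((\<lambda>t. (u t - V t) * unit_emb c + unit_emb ((v' t - v t) * c)) \<longlongrightarrow> 0 + 0) F"
      by (rule tendsto_add)
    then show "((\<lambda>t. (u t - unit_emb (v t)) * unit_emb c) \<longlongrightarrow> 0) F"
      by (simp add: V_def unit_emb_simps algebra_simps)
  qed
qed

end

text \<open>Linear interpolation turns the sequence into a contractive path. The hypothesis on
  \<open>c\<close> concerns integer times only, so the path result is applied along
  \<open>filtermap real sequentially\<close>.\<close>

lemma stable_unitary_sequence:
  fixes v :: "nat \<Rightarrow> 'b::cstar_algebra"
  assumes "stable_cstar TYPE('b)" "\<And>n. norm (v n) \<le> 1"
  shows "\<exists>u :: nat \<Rightarrow> 'b unitization. (\<forall>n. unitary (u n)) \<and> (\<forall>c. (\<lambda>n. star (v n) * v n * c) \<longlonglongrightarrow> c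
    \<longrightarrow> (\<lambda>n. (u n - unit_emb (v n)) * unit_emb c) \<longlonglongrightarrow> 0)"
proof -
  obtain \<tau> :: "'b \<Rightarrow> compact_op \<Rightarrow> 'b" where "cstar_tensor \<tau>" using assms(1) by (auto simp: stable_cstar_def)
  then interpret stable_algebra \<tau> by unfold_locales
  define V where "V t = pl_path v (max 0 t)" for t
  have cV: "continuous_on UNIV V"
    unfolding V_def by (rule continuous_on_compose2[OF continuous_on_pl_path]) (auto intro!: continuous_intros)
  have nV: "norm (V t) \<le> 1" for t unfolding V_def by (rule norm_pl_path_le[OF assms(2)]) simp
  have V: "V (real n) = v n" for n by (simp add: V_def pl_path_of_nat)
  obtain u where u1: "\<forall>t. u t \<in> unitary_group_one_plus"
    and u2: "\<forall>F c. F \<le> at_top \<longrightarrow> ((\<lambda>t. star (V t) * V t * c) \<longlongrightarrow> c) F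
      \<longrightarrow> ((\<lambda>t. (u t - unit_emb (V t)) * unit_emb c) \<longlongrightarrow> 0) F"
    using stable_unitaries[OF cV nV] by (elim exE conjE) (rule that)
  have F: "filtermap real sequentially \<le> at_top"
    using filterlim_real_sequentially by (simp add: filterlim_def)
  show ?thesis
  proof (intro exI[of _ "\<lambda>n. u (real n)"] conjI allI impI)
    show "unitary (u (real n))" for n using u1 by (simp add: unitary_group_one_plus_iff)
    show "(\<lambda>n. (u (real n) - unit_emb (v n)) * unit_emb c) \<longlonglongrightarrow> 0" if "(\<lambda>n. star (v n) * v n * c) \<longlonglongrightarrow> c" for c
      using u2[rule_format, OF F, of c] that by (simp add: filterlim_filtermap V)
  qed
qed

text \<open>Invertible \<open>x n\<close> near \<open>v n\<close> have polar forms
  \<open>u n * s n\<close> with \<open>s * s = star x * x \<approx> star v * v\<close>. On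
  \<open>c\<close> this gives \<open>s * s * c \<approx> c\<close>, then
  \<open>s * c \<approx> c\<close>, and finally
  \<open>u * c \<approx> u * s * c = x * c \<approx> v * c\<close>.\<close>

lemma almost_stable_rank_one_unitary_sequence:
  fixes v :: "nat \<Rightarrow> 'b::cstar_algebra"
  assumes "almost_stable_rank_one TYPE('b)" "\<And>n. norm (v n) \<le> 1"
  shows "\<exists>u :: nat \<Rightarrow> 'b unitization. (\<forall>n. unitary (u n)) \<and> (\<forall>c. (\<lambda>n. star (v n) * v n * c) \<longlonglongrightarrow> c
    \<longrightarrow> (\<lambda>n. (u n - unit_emb (v n)) * unit_emb c) \<longlonglongrightarrow> 0)"
proof -
  have "\<exists>x\<in>general_linear. dist x (unit_emb (v n)) < 1 / (real n + 1)" for n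
  proof -
    have "unit_emb (v n) \<in> closure general_linear"
      using assms(1) unfolding almost_stable_rank_one_def by blast
    moreover have "(0::real) < 1 / (real n + 1)" by (simp add: add_nonneg_pos)
    ultimately show ?thesis unfolding closure_approachable by blast
  qed
  then obtain x where x: "\<And>n. x n \<in> general_linear" "\<And>n. dist (x n) (unit_emb (v n)) < 1 / (real n + 1)"
    by metis
  have "\<exists>u s. unitary u \<and> x n = u * s \<and> nonneg s \<and> s * s = star (x n) * x n" for n
    using polar_decomposition[OF x(1)[of n]] by metis
  then obtain u s where us: "\<And>n. unitary (u n)" "\<And>n. x n = u n * s n" "\<And>n. nonneg (s n)"
    "\<And>n. s n * s n = star (x n) * x n" by metis
  define V where "V n = unit_emb (v n)" for n
  have xV: "(\<lambda>n. x n - V n) \<longlonglongrightarrow> 0"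
    by (rule LIMSEQ_if_norm_less_inverse[of 0]) (use x(2) in \<open>simp add: V_def dist_norm\<close>)
  have nV: "norm (V n) \<le> 1" for n by (simp add: V_def assms(2))
  have nx: "norm (x n) \<le> 2" for n
  proof -
    have "1 / (real n + 1) \<le> 1" by simp
    then have "norm (x n - V n) \<le> 1" using x(2)[of n] unfolding V_def dist_norm by linarith
    then show ?thesis using nV[of n] norm_triangle_sub[of "x n" "V n"] by linarith
  qed
  show ?thesis
  proof (intro exI[of _ u] conjI allI impI)
    show "unitary (u n)" for n by (rule us)
    fix c assume c: "(\<lambda>n. star (v n) * v n * c) \<longlonglongrightarrow> c"
    define C where "C = unit_emb c"
    have VC: "(\<lambda>n. star (V n) * V n * C - C) \<longlonglongrightarrow> 0"
      using c by (intro LIM_zero) (simp add: V_def C_def tendsto_unit_emb_iff flip: unit_emb_simps(3,4))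
    have xVC: "(\<lambda>n. (x n - V n) * C) \<longlonglongrightarrow> 0"
      by (rule tendsto_0_mult_bounded(1)[OF xV, where C = "norm C"]) simp
    have sxV: "(\<lambda>n. star (x n - V n)) \<longlonglongrightarrow> 0" using tendsto_star[OF xV] by simp
    have nVC: "norm (V n * C) \<le> norm C" for n by (rule norm_mult_le(1)[OF nV])
    have "(\<lambda>n. star (x n) * ((x n - V n) * C)) \<longlonglongrightarrow> 0"
      by (rule tendsto_0_mult_bounded(2)[OF xVC, where C = 2]) (use nx in auto)
    moreover have "(\<lambda>n. star (x n - V n) * (V n * C)) \<longlonglongrightarrow> 0"
      by (rule tendsto_0_mult_bounded(1)[OF sxV, where C = "norm C"]) (use nVC in auto)
    ultimately have "(\<lambda>n. star (x n) * ((x n - V n) * C) + star (x n - V n) * (V n * C)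
        + (star (V n) * V n * C - C)) \<longlonglongrightarrow> 0 + 0 + 0"
      by (intro tendsto_add VC)
    then have ssC: "(\<lambda>n. s n * s n * C - C) \<longlonglongrightarrow> 0" by (simp add: us(4) star_diff algebra_simps)
    have "norm (s n * C - C) \<le> norm (s n * s n * C - C)" for n
    proof -
      have eq: "(s n * C - C) + s n * (s n * C - C) = s n * s n * C - C" by (simp add: algebra_simps)
      show ?thesis using norm_le_add_nonneg[OF us(3), of "s n * C - C" n] unfolding eq .
    qed
    then have "(\<lambda>n. s n * C - C) \<longlonglongrightarrow> 0"
      by (intro Lim_null_comparison[OF _ tendsto_norm_zero[OF ssC]]) simp
    then have "(\<lambda>n. u n * (s n * C - C)) \<longlonglongrightarrow> 0"
      by (rule tendsto_0_mult_bounded(2)[where C = 1]) (simp add: norm_unitary us)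
    from tendsto_diff[OF xVC this]
    show "(\<lambda>n. (u n - unit_emb (v n)) * unit_emb c) \<longlonglongrightarrow> 0"
      by (simp add: us(2) V_def C_def algebra_simps)
  qed
qed

section \<open>The two equivalences\<close>

locale coherent_pair = covariant_pair \<alpha> \<beta> \<phi> \<psi>
  for \<alpha> :: "'g::{group_add, countable} \<Rightarrow> 'a::cstar_algebra \<Rightarrow> 'a"
    and \<beta> :: "'g \<Rightarrow> 'b::cstar_algebra \<Rightarrow> 'b" and \<phi> \<psi> +
  assumes beta_0: "\<beta> 0 x = x"
    and separable: "separable_space (euclidean :: 'a topology)"
begin

lemma covariant_map_unit_ext:
  assumes "covariant_map \<alpha> \<beta> \<theta>"
  shows "covariant_map \<alpha> (\<lambda>g. unit_ext (\<beta> g)) (\<lambda>g a. unit_emb (\<theta> g a))"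
proof -
  interpret chi: covariant_map \<alpha> \<beta> \<theta> by fact
  show ?thesis
  proof
    show "star_automorphism (\<alpha> g)" for g by (rule chi.\<alpha>)
    show "star_hom (unit_ext (\<beta> g))" for g by (rule star_hom_unit_ext[OF chi.\<beta>])
    show "clinear (\<lambda>a. unit_emb (\<theta> g a))" for g by (simp add: clinear_def chi.phi_lin unit_emb_simps)
    show "star (unit_emb (\<theta> g a)) * unit_emb (\<theta> g b) = unit_emb (\<theta> 0 (star a * b))" for g a b
      by (simp add: chi.star_mult_phi flip: unit_emb_simps)
    show "unit_emb (\<theta> g (a * b)) = unit_emb (\<theta> g a) * unit_emb (\<theta> 0 b)" for g a b
      by (simp add: chi.phi_mult flip: unit_emb_simps)
    show "unit_emb (\<theta> g (\<alpha> g a * b)) = unit_ext (\<beta> g) (unit_emb (\<theta> 0 a)) * unit_emb (\<theta> g b)" for g a b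
      by (simp add: chi.phi_alpha_mult unit_ext_unit_emb flip: unit_emb_simps)
  qed
qed

sublocale emb: unital_covariant_pair \<alpha> "\<lambda>g. unit_ext (\<beta> g)" "\<lambda>g a. unit_emb (\<phi> g a)" "\<lambda>g a. unit_emb (\<psi> g a)"
proof -
  interpret p: covariant_map \<alpha> "\<lambda>g. unit_ext (\<beta> g)" "\<lambda>g a. unit_emb (\<phi> g a)"
    by (rule covariant_map_unit_ext[OF phi.covariant_map_axioms])
  interpret q: covariant_map \<alpha> "\<lambda>g. unit_ext (\<beta> g)" "\<lambda>g a. unit_emb (\<psi> g a)"
    by (rule covariant_map_unit_ext[OF psi.covariant_map_axioms])
  show "unital_covariant_pair \<alpha> (\<lambda>g. unit_ext (\<beta> g)) (\<lambda>g a. unit_emb (\<phi> g a)) (\<lambda>g a. unit_emb (\<psi> g a))"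
  proof
    show "unit_ext (\<beta> g) 1 = 1" for g
      using clinearD(4)[of "\<beta> g"] phi.\<beta>[of g] by (simp add: star_hom_def unit_ext_def one_unitization_def)
  qed
qed

section \<open>From unitary to Murray--von Neumann equivalence\<close>

lemma MvN_family:
  assumes e: "approx_unit e F" and u: "\<And>i. u i \<in> unitary_group_one_plus"
    and conv: "\<And>g a. ((\<lambda>i. unit_ext (\<beta> g) (u i) * unit_emb (\<phi> g a) * star (u i)) \<longlongrightarrow> unit_emb (\<psi> g a)) F"
  defines "v \<equiv> \<lambda>i. unit_lmul (star (u i)) (\<psi> 0 (e i))"
  shows "((\<lambda>i. \<beta> g (star (v i)) * \<phi> g a * v i) \<longlongrightarrow> \<psi> g a) F"
    and "((\<lambda>i. \<beta> g (v i) * \<psi> g a * star (v i)) \<longlongrightarrow> \<phi> g a) F"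
proof -
  have uu: "unitary (u i)" for i using u by (simp add: unitary_group_one_plus_iff)
  have v: "unit_emb (v i) = star (u i) * unit_emb (\<psi> 0 (e i))" for i
    by (simp add: v_def unit_emb_unit_lmul)
  note * = emb.MvN_from_unitary[OF e uu conv v, of g a]
  from *(1) show "((\<lambda>i. \<beta> g (star (v i)) * \<phi> g a * v i) \<longlongrightarrow> \<psi> g a) F"
    by (simp add: unit_ext_unit_emb tendsto_unit_emb_iff flip: unit_emb_simps)
  from *(2) show "((\<lambda>i. \<beta> g (v i) * \<psi> g a * star (v i)) \<longlongrightarrow> \<phi> g a) F"
    by (simp add: unit_ext_unit_emb tendsto_unit_emb_iff flip: unit_emb_simps)
qed

lemma approx_MvN_if_unitary:
  assumes "proper_approx_unitary_equiv \<beta> \<phi> \<psi>"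
  shows "approx_MvN_equiv \<beta> \<phi> \<psi>"
proof -
  obtain u where u: "range u \<subseteq> unitary_group_one_plus"
    "\<And>g a. (\<lambda>n. unit_ext (\<beta> g) (u n) * unit_emb (\<phi> g a) * star (u n)) \<longlonglongrightarrow> unit_emb (\<psi> g a)"
    using assms by (auto simp: proper_approx_unitary_equiv_def)
  obtain e :: "nat \<Rightarrow> 'a" where e: "approx_unit e sequentially"
    using separable_approx_unit[OF separable] by blast
  define v where "v i = unit_lmul (star (u i)) (\<psi> 0 (e i))" for i
  have ui: "u i \<in> unitary_group_one_plus" for i using u(1) by blast
  note fam = MvN_family[OF e ui u(2), folded v_def]
  show ?thesis
    unfolding approx_MvN_equiv_def
  proof (intro allI impI)
    fix \<epsilon> :: real and K :: "'g set" and F :: "'a set"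
    assume \<epsilon>: "\<epsilon> > 0" and fin: "finite K" "finite F"
    define good where "good g a n \<longleftrightarrow> norm (\<beta> g (star (v n)) * \<phi> g a * v n - \<psi> g a) < \<epsilon>
      \<and> norm (\<beta> g (v n) * \<psi> g a * star (v n) - \<phi> g a) < \<epsilon>" for g a n
    have "\<forall>\<^sub>F n in sequentially. good g a n" for g a
      unfolding good_def
      using tendstoD[OF fam(1) \<epsilon>, of g a] tendstoD[OF fam(2) \<epsilon>, of g a] unfolding dist_norm
      by (rule eventually_conj)
    then have "\<forall>\<^sub>F n in sequentially. \<forall>g\<in>K. \<forall>a\<in>F. good g a n"
      using fin by (simp add: eventually_ball_finite_distrib)
    then obtain n where "\<forall>g\<in>K. \<forall>a\<in>F. good g a n"
      using eventually_happens trivial_limit_sequentially by blast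
    then show "\<exists>v. \<forall>g\<in>K. \<forall>a\<in>F. norm (\<beta> g (star v) * \<phi> g a * v - \<psi> g a) < \<epsilon>
        \<and> norm (\<beta> g v * \<psi> g a * star v - \<phi> g a) < \<epsilon>"
      unfolding good_def by blast
  qed
qed

lemma asymp_MvN_if_unitary:
  assumes "proper_asymp_unitary_equiv \<beta> \<phi> \<psi>"
  shows "asymp_MvN_equiv \<beta> \<phi> \<psi>"
proof -
  obtain w :: "real \<Rightarrow> 'b unitization" where w0: "continuous_on {0..} w" "w ` {0..} \<subseteq> unitary_group_one_plus"
    "\<forall>g a. ((\<lambda>t. unit_ext (\<beta> g) (w t) * unit_emb (\<phi> g a) * star (w t)) \<longlongrightarrow> unit_emb (\<psi> g a)) at_top"
    using assms unfolding proper_asymp_unitary_equiv_def by blast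
  note w = w0(1,2) w0(3)[rule_format]
  obtain e0 :: "nat \<Rightarrow> 'a" where "approx_unit e0 sequentially"
    using separable_approx_unit[OF separable] by blast
  from approx_unit_pl_path[OF this] have e: "approx_unit (\<lambda>t. pl_path e0 (max 0 t)) at_top" .
  define u where "u t = w (max 0 t)" for t
  have u: "u t \<in> unitary_group_one_plus" for t using w(2) by (auto simp: u_def)
  have conv: "((\<lambda>t. unit_ext (\<beta> g) (u t) * unit_emb (\<phi> g a) * star (u t)) \<longlongrightarrow> unit_emb (\<psi> g a)) at_top" for g a
    by (rule Lim_transform_eventually[OF w(3)])
      (use eventually_ge_at_top[of 0] in \<open>eventually_elim, simp add: u_def\<close>)
  define v where "v t = unit_lmul (star (u t)) (\<psi> 0 (pl_path e0 (max 0 t)))" for t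
  have "continuous_on {0..} (\<lambda>t. star (w t) * unit_emb (\<psi> 0 (pl_path e0 t)))"
    by (intro continuous_on_mult continuous_on_star w(1)
        bounded_linear.continuous_on[OF bounded_linear_unit_emb]
        bounded_linear.continuous_on[OF psi.bounded_linear_phi] continuous_on_pl_path)
  then have "continuous_on {0..} (\<lambda>t. unit_emb (v t))"
    by (rule continuous_on_eq) (simp add: v_def unit_emb_unit_lmul u_def)
  then have "continuous_on {0..} v" by (simp only: continuous_on_unit_emb_iff)
  then show ?thesis
    unfolding asymp_MvN_equiv_def
    using MvN_family[OF e u conv, folded v_def] by blast
qed

section \<open>Contractive conjugators from Murray--von Neumann equivalence\<close>

lemma contractive_sequence:
  assumes "approx_MvN_equiv \<beta> \<phi> \<psi>"
  shows "\<exists>w :: nat \<Rightarrow> 'b. (\<forall>n. norm (w n) \<le> 1) \<and> (\<forall>a. (\<lambda>n. star (w n) * \<phi> 0 a * w n) \<longlonglongrightarrow> \<psi> 0 a)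
    \<and> (\<forall>g a. (\<lambda>n. \<beta> g (w n) * \<psi> g a * star (w n)) \<longlonglongrightarrow> \<phi> g a)"
proof -
  obtain e :: "nat \<Rightarrow> 'a" where e: "approx_unit e sequentially"
    using separable_approx_unit[OF separable] by blast
  obtain x :: "nat \<Rightarrow> 'a" where x: "closure (range x) = UNIV"
    using separable_dense_sequence[OF separable] by blast
  \<comment> \<open>The neutral element is inserted because its code under \<open>to_nat\<close> may
    be large, while it has to be tested at every stage.\<close>
  define K where "K n = insert (0::'g) {g. to_nat g \<le> n}" for n
  \<comment> \<open>Exactly the test elements of \<open>contractive_conjugators\<close>; finiteness
    at stage \<open>n\<close> allows those that depend on \<open>e n\<close>.\<close>
  define Y where "Y n = x ` {..n} \<union> (\<lambda>(g, k). \<alpha> g (e n) * x k * e n) ` (K n \<times> {..n}) \<union> {e n * e n}" for n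
  have "finite ((to_nat :: 'g \<Rightarrow> nat) -` {..n})" for n by (rule finite_vimageI) auto
  then have fK: "finite (K n)" for n by (simp add: K_def vimage_def)
  then have fY: "finite (Y n)" for n by (simp add: Y_def)
  have "\<exists>v. \<forall>g\<in>K n. \<forall>a\<in>Y n. norm (\<beta> g (star v) * \<phi> g a * v - \<psi> g a) < 1 / (real n + 1)
      \<and> norm (\<beta> g v * \<psi> g a * star v - \<phi> g a) < 1 / (real n + 1)" for n
  proof -
    have "(0::real) < 1 / (real n + 1)" by (simp add: add_nonneg_pos)
    then show ?thesis using assms fK fY unfolding approx_MvN_equiv_def by blast
  qed
  then obtain v where v0: "\<And>n. \<forall>g\<in>K n. \<forall>a\<in>Y n. norm (\<beta> g (star (v n)) * \<phi> g a * v n - \<psi> g a) < 1 / (real n + 1)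
      \<and> norm (\<beta> g (v n) * \<psi> g a * star (v n) - \<phi> g a) < 1 / (real n + 1)"
    by metis
  have v1: "\<And>n g a. g \<in> K n \<Longrightarrow> a \<in> Y n \<Longrightarrow> norm (\<beta> g (star (v n)) * \<phi> g a * v n - \<psi> g a) < 1 / (real n + 1)"
    and v2: "\<And>n g a. g \<in> K n \<Longrightarrow> a \<in> Y n \<Longrightarrow> norm (\<beta> g (v n) * \<psi> g a * star (v n) - \<phi> g a) < 1 / (real n + 1)"
    using v0 by simp_all
  define w where "w n = (1 / max 1 (norm (v n * \<psi> 0 (e n)))) *\<^sub>R (v n * \<psi> 0 (e n))" for n
  have c1: "(\<lambda>n. star (v n) * \<phi> 0 a * v n) \<longlonglongrightarrow> \<psi> 0 a" if a: "a \<in> range x" for a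
  proof (rule LIM_zero_cancel)
    obtain k where k: "a = x k" using a by blast
    show "(\<lambda>n. star (v n) * \<phi> 0 a * v n - \<psi> 0 a) \<longlonglongrightarrow> 0"
    proof (rule LIMSEQ_if_norm_less_inverse[where N = k])
      fix n assume "n \<ge> k"
      then have "0 \<in> K n" "a \<in> Y n" by (auto simp: K_def Y_def k)
      from v1[OF this] show "norm (star (v n) * \<phi> 0 a * v n - \<psi> 0 a) < 1 / (real n + 1)" by (simp add: beta_0)
    qed
  qed
  have c2: "(\<lambda>n. \<beta> g (v n) * \<psi> g (\<alpha> g (e n) * a * e n) * star (v n) - \<phi> g (\<alpha> g (e n) * a * e n)) \<longlonglongrightarrow> 0"
    if a: "a \<in> range x" for g a
  proof -
    obtain k where k: "a = x k" using a by blast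
    show ?thesis
    proof (rule LIMSEQ_if_norm_less_inverse[where N = "max k (to_nat g)"])
      fix n assume "n \<ge> max k (to_nat g)"
      then have "g \<in> K n" "\<alpha> g (e n) * a * e n \<in> Y n" by (auto simp: K_def Y_def k)
      from v2[OF this] show "norm (\<beta> g (v n) * \<psi> g (\<alpha> g (e n) * a * e n) * star (v n)
        - \<phi> g (\<alpha> g (e n) * a * e n)) < 1 / (real n + 1)" .
    qed
  qed
  have c3: "(\<lambda>n. v n * \<psi> 0 (e n * e n) * star (v n) - \<phi> 0 (e n * e n)) \<longlonglongrightarrow> 0"
  proof (rule LIMSEQ_if_norm_less_inverse[where N = 0])
    fix n :: nat
    have "0 \<in> K n" "e n * e n \<in> Y n" by (auto simp: K_def Y_def)
    from v2[OF this] show "norm (v n * \<psi> 0 (e n * e n) * star (v n) - \<phi> 0 (e n * e n)) < 1 / (real n + 1)"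
      by (simp add: beta_0)
  qed
  note cc = contractive_conjugators[OF e x c1 c2 c3 w_def]
  show ?thesis by (intro exI[of _ w] conjI allI cc)
qed

text \<open>Along a path \<open>v\<close> the convergence is only pointwise, so the approximate unit is followed slowly
  enough for its current segment to be under control.\<close>

lemma contractive_path:
  assumes "asymp_MvN_equiv \<beta> \<phi> \<psi>"
  shows "\<exists>w :: real \<Rightarrow> 'b. continuous_on UNIV w \<and> (\<forall>t. norm (w t) \<le> 1)
    \<and> (\<forall>a. ((\<lambda>t. star (w t) * \<phi> 0 a * w t) \<longlongrightarrow> \<psi> 0 a) at_top)
    \<and> (\<forall>g a. ((\<lambda>t. \<beta> g (w t) * \<psi> g a * star (w t)) \<longlongrightarrow> \<phi> g a) at_top)"
proof -
  obtain v0 :: "real \<Rightarrow> 'b" where v00: "continuous_on {0..} v0"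
    "\<forall>g a. ((\<lambda>t. \<beta> g (star (v0 t)) * \<phi> g a * v0 t) \<longlongrightarrow> \<psi> g a) at_top
      \<and> ((\<lambda>t. \<beta> g (v0 t) * \<psi> g a * star (v0 t)) \<longlongrightarrow> \<phi> g a) at_top"
    using assms unfolding asymp_MvN_equiv_def by blast
  have v0: "continuous_on {0..} v0"
    "\<And>g a. ((\<lambda>t. \<beta> g (star (v0 t)) * \<phi> g a * v0 t) \<longlongrightarrow> \<psi> g a) at_top"
    "\<And>g a. ((\<lambda>t. \<beta> g (v0 t) * \<psi> g a * star (v0 t)) \<longlongrightarrow> \<phi> g a) at_top"
    using v00 by simp_all
  define v where "v t = v0 (max 0 t)" for t
  have cv: "continuous_on UNIV v"
    unfolding v_def by (rule continuous_on_compose2[OF v0(1)]) (auto intro!: continuous_intros)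
  have ev: "\<forall>\<^sub>F t in at_top. v t = v0 t"
    using eventually_ge_at_top[of 0] by eventually_elim (simp add: v_def)
  have v1: "((\<lambda>t. \<beta> g (star (v t)) * \<phi> g a * v t) \<longlongrightarrow> \<psi> g a) at_top" for g a
    by (rule Lim_transform_eventually[OF v0(2)]) (use ev in \<open>eventually_elim, simp\<close>)
  have v2: "((\<lambda>t. \<beta> g (v t) * \<psi> g a * star (v t)) \<longlongrightarrow> \<phi> g a) at_top" for g a
    by (rule Lim_transform_eventually[OF v0(3)]) (use ev in \<open>eventually_elim, simp\<close>)
  obtain e :: "nat \<Rightarrow> 'a" where e: "approx_unit e sequentially"
    using separable_approx_unit[OF separable] by blast
  obtain x :: "nat \<Rightarrow> 'a" where x: "closure (range x) = UNIV"
    using separable_dense_sequence[OF separable] by blast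
  define K where "K n = {g::'g. to_nat g \<le> n}" for n
  have "finite ((to_nat :: 'g \<Rightarrow> nat) -` {..n})" for n by (rule finite_vimageI) auto
  then have fK: "finite (K n)" for n by (simp add: K_def vimage_def)
  define D where "D g t y = \<beta> g (v t) * \<psi> g y * star (v t) - \<phi> g y" for g t y
  have D0: "((\<lambda>t. D g t y) \<longlongrightarrow> 0) at_top" for g y
    unfolding D_def using v2 by (rule LIM_zero)
  have Dlin: "D g t (y + z) = D g t y + D g t z" "D g t (r *\<^sub>R y) = r *\<^sub>R D g t y" for g t y z r
    by (simp_all add: D_def phi.phi_lin psi.phi_lin algebra_simps)
  have alin: "\<alpha> g (y + z) = \<alpha> g y + \<alpha> g z" "\<alpha> g (r *\<^sub>R y) = r *\<^sub>R \<alpha> g y" for g y z r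
    using phi.\<alpha>[of g] by (auto simp: star_automorphism_def clinearD)
  \<comment> \<open>On the segment from \<open>n + 1\<close> to \<open>n + 2\<close> the path
    \<open>E\<close> combines \<open>e (n + 1)\<close> and \<open>e (n + 2)\<close>, so all products
    of the two endpoints have to be under control.\<close>
  define P where "P n t \<longleftrightarrow> (\<forall>i\<in>{..n + 2}. \<forall>j\<in>{..n + 2}. norm (D 0 t (e i * e j)) < 1 / (real n + 1)
      \<and> (\<forall>k\<in>{..n}. \<forall>g\<in>K n. norm (D g t (\<alpha> g (e i) * x k * e j)) < 1 / (real n + 1)))" for n t
  have "\<forall>\<^sub>F t in at_top. norm (D g t y) < 1 / (real n + 1)" for n g y
  proof -
    have "(0::real) < 1 / (real n + 1)" by (simp add: add_nonneg_pos)
    from tendstoD[OF D0 this] show ?thesis by (simp add: dist_norm)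
  qed
  then have "\<forall>\<^sub>F t in at_top. P n t" for n
    unfolding P_def by (intro eventually_ball_finite ballI eventually_conj fK finite_atMost)
  from slow_path[of P, OF this]
  obtain \<sigma> where \<sigma>1: "continuous_on UNIV \<sigma>" "\<forall>t. \<sigma> t \<ge> 0" and \<sigma>2: "filterlim \<sigma> at_top at_top"
    "\<forall>n t. \<sigma> t > real n \<longrightarrow> P n t"
    by (elim exE conjE) (rule that)
  note \<sigma> = \<sigma>1(1) \<sigma>1(2)[rule_format] \<sigma>2(1) \<sigma>2(2)[rule_format]
  define E where "E t = pl_path e (\<sigma> t)" for t
  have cE: "continuous_on UNIV E"
    unfolding E_def by (rule continuous_on_compose2[OF continuous_on_pl_path \<sigma>(1)]) (use \<sigma>(2) in auto)
  have aE: "approx_unit E at_top"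
  proof -
    have E: "E t = pl_path e (max 0 (\<sigma> t))" for t using \<sigma>(2)[of t] by (simp add: E_def)
    from approx_unit_pl_path[OF e] show ?thesis
      unfolding approx_unit_def E
      using filterlim_compose[OF _ \<sigma>(3)] by blast
  qed
  \<comment> \<open>The interval starts at \<open>Suc n\<close>, not \<open>n\<close>, to have
    \<open>\<sigma> t > real n\<close> and hence \<open>P n t\<close>; linearity in each factor
    carries the bound from the endpoints to the segment.\<close>
  have est: "norm (D 0 t (E t * E t)) \<le> 1 / real (Suc n)"
    "k \<le> n \<Longrightarrow> g \<in> K n \<Longrightarrow> norm (D g t (\<alpha> g (E t) * x k * E t)) \<le> 1 / real (Suc n)"
    if n: "\<sigma> t \<in> {real (Suc n)..real (Suc n) + 1}" for n t k g
  proof -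
    have P: "P n t" using n by (intro \<sigma>(4)) auto
    define s where "s = \<sigma> t - real (Suc n)"
    have s: "0 \<le> s" "s \<le> 1" using n by (auto simp: s_def)
    have E: "E t = (1 - s) *\<^sub>R e (Suc n) + s *\<^sub>R e (Suc (Suc n))"
      unfolding E_def s_def by (rule pl_path_eq[OF n])
    have seg: "norm (h (E t) (E t)) \<le> 1 / real (Suc n)"
      if h: "\<And>i j. i \<le> n + 2 \<Longrightarrow> j \<le> n + 2 \<Longrightarrow> norm (h (e i) (e j)) < 1 / (real n + 1)"
        and l: "\<And>y. linear (h y)" "\<And>z. linear (\<lambda>y. h y z)" for h :: "'a \<Rightarrow> 'a \<Rightarrow> 'b"
    proof -
      have hb: "norm (h (e i) (e j)) \<le> 1 / real (Suc n)" if "i \<le> n + 2" "j \<le> n + 2" for i j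
        using h[OF that] by (simp add: add.commute)
      have "norm (h (e i) (E t)) \<le> 1 / real (Suc n)" if "i \<le> n + 2" for i
        unfolding E by (rule norm_linear_segment[OF l(1)]) (use hb that s in auto)
      then show ?thesis
        by (subst (1) E) (rule norm_linear_segment[OF l(2)]; use s in auto)
    qed
    show "norm (D 0 t (E t * E t)) \<le> 1 / real (Suc n)"
      by (rule seg[of "\<lambda>y z. D 0 t (y * z)"])
        (use P in \<open>auto simp: P_def linear_iff Dlin distrib_left distrib_right\<close>)
    show "norm (D g t (\<alpha> g (E t) * x k * E t)) \<le> 1 / real (Suc n)" if "k \<le> n" "g \<in> K n"
      by (rule seg[of "\<lambda>y z. D g t (\<alpha> g y * x k * z)"])
        (use P that in \<open>auto simp: P_def linear_iff Dlin alin distrib_left distrib_right\<close>)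
  qed
  \<comment> \<open>The shift by 1 matches the segments: for \<open>\<sigma> t\<close> between
    \<open>n + 1\<close> and \<open>n + 2\<close>, the estimate \<open>1 / real (Suc n)\<close> is
    at most \<open>1 / (\<sigma> t - 1)\<close>.\<close>
  have inv: "((\<lambda>t. 1 / (\<sigma> t - 1)) \<longlongrightarrow> 0) at_top"
  proof -
    have "filterlim (\<lambda>s::real. - 1 + s) at_top at_top"
      by (rule filterlim_tendsto_add_at_top[OF tendsto_const filterlim_ident])
    from filterlim_compose[OF this \<sigma>(3)] have "filterlim (\<lambda>t. \<sigma> t - 1) at_top at_top" by simp
    then show ?thesis by (rule tendsto_divide_0[OF tendsto_const filterlim_at_top_imp_at_infinity])
  qed
  have lim: "(f \<longlongrightarrow> 0) at_top"
    if f: "\<And>n t. n \<ge> N \<Longrightarrow> \<sigma> t \<in> {real (Suc n)..real (Suc n) + 1} \<Longrightarrow> norm (f t) \<le> 1 / real (Suc n)"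
    for f :: "real \<Rightarrow> 'b" and N
  proof (rule Lim_null_comparison[OF _ inv])
    have "norm (f t) \<le> 1 / (\<sigma> t - 1)" if t: "\<sigma> t \<ge> real (N + 2)" for t
    proof -
      obtain m where m: "\<sigma> t \<in> {real m..real m + 1}" using nat_unit_interval[OF \<sigma>(2)] by blast
      then have "real (N + 1) \<le> real m" using t by auto
      then have "m \<ge> N + 1" by linarith
      then obtain n where n: "m = Suc n" "n \<ge> N" by (metis Suc_eq_plus1 Suc_le_D Suc_le_mono)
      have "1 / real (Suc n) \<le> 1 / (\<sigma> t - 1)" using m t n by (intro frac_le) auto
      then show ?thesis using f[OF n(2), of t] m n(1) by simp
    qed
    moreover have "\<forall>\<^sub>F t in at_top. \<sigma> t \<ge> real (N + 2)" using \<sigma>(3) by (simp add: filterlim_at_top)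
    ultimately show "\<forall>\<^sub>F t in at_top. norm (f t) \<le> 1 / (\<sigma> t - 1)" by (rule eventually_mono[rotated])
  qed
  define w where "w t = (1 / max 1 (norm (v t * \<psi> 0 (E t)))) *\<^sub>R (v t * \<psi> 0 (E t))" for t
  have c1: "((\<lambda>t. star (v t) * \<phi> 0 a * v t) \<longlongrightarrow> \<psi> 0 a) at_top" for a
    using v1[of 0 a] by (simp add: beta_0)
  have c2: "((\<lambda>t. \<beta> g (v t) * \<psi> g (\<alpha> g (E t) * a * E t) * star (v t) - \<phi> g (\<alpha> g (E t) * a * E t)) \<longlongrightarrow> 0) at_top"
    if a: "a \<in> range x" for g a
  proof -
    obtain k where k: "a = x k" using a by blast
    have "((\<lambda>t. D g t (\<alpha> g (E t) * x k * E t)) \<longlongrightarrow> 0) at_top"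
      by (rule lim[where N = "max k (to_nat g)"], rule est(2)) (auto simp: K_def)
    then show ?thesis by (simp add: D_def k)
  qed
  have "((\<lambda>t. D 0 t (E t * E t)) \<longlongrightarrow> 0) at_top"
    by (rule lim[where N = 0], rule est(1))
  then have c3: "((\<lambda>t. v t * \<psi> 0 (E t * E t) * star (v t) - \<phi> 0 (E t * E t)) \<longlongrightarrow> 0) at_top"
    by (simp add: D_def beta_0)
  note cc = contractive_conjugators[OF aE x c1 c2 c3 w_def]
  have "continuous_on UNIV w"
    unfolding w_def
    by (intro continuous_intros cv bounded_linear.continuous_on[OF psi.bounded_linear_phi] cE) auto
  then show ?thesis by (intro exI[of _ w] conjI allI cc)
qed

section \<open>From Murray--von Neumann to proper unitary equivalence\<close>

lemma proper_approx_if_MvN: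
  assumes "stable_cstar TYPE('b) \<or> almost_stable_rank_one TYPE('b)"
    and "approx_MvN_equiv \<beta> \<phi> \<psi>"
  shows "proper_approx_unitary_equiv \<beta> \<phi> \<psi>"
proof -
  from contractive_sequence[OF assms(2)]
  obtain v :: "nat \<Rightarrow> 'b" where v0: "\<forall>n. norm (v n) \<le> 1"
    "\<forall>a. (\<lambda>n. star (v n) * \<phi> 0 a * v n) \<longlonglongrightarrow> \<psi> 0 a"
    "\<forall>g a. (\<lambda>n. \<beta> g (v n) * \<psi> g a * star (v n)) \<longlonglongrightarrow> \<phi> g a"
    by (elim exE conjE) (rule that)
  note v = v0[rule_format]
  have vv: "(\<lambda>n. star (v n) * v n * \<psi> 0 a) \<longlonglongrightarrow> \<psi> 0 a" for a
    by (rule star_mult_self_tendsto[OF v(1,2)]) (use v(3)[of 0] in \<open>simp add: beta_0\<close>)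
  have "\<exists>u :: nat \<Rightarrow> 'b unitization. (\<forall>n. unitary (u n)) \<and> (\<forall>c. (\<lambda>n. star (v n) * v n * c) \<longlonglongrightarrow> c
    \<longrightarrow> (\<lambda>n. (u n - unit_emb (v n)) * unit_emb c) \<longlonglongrightarrow> 0)"
    using assms(1) stable_unitary_sequence[of v, OF _ v(1)]
      almost_stable_rank_one_unitary_sequence[of v, OF _ v(1)] by (elim disjE)
  then obtain u :: "nat \<Rightarrow> 'b unitization" where u0: "\<forall>n. unitary (u n)"
    "\<forall>c. (\<lambda>n. star (v n) * v n * c) \<longlonglongrightarrow> c \<longrightarrow> (\<lambda>n. (u n - unit_emb (v n)) * unit_emb c) \<longlonglongrightarrow> 0"
    by (elim exE conjE) (rule that)
  note u = u0[rule_format]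
  have nv: "norm (unit_emb (v n)) \<le> 1" for n by (simp add: v(1))
  have conv: "(\<lambda>n. unit_ext (\<beta> g) (unit_emb (v n)) * unit_emb (\<psi> g a) * star (unit_emb (v n))) \<longlonglongrightarrow> unit_emb (\<phi> g a)" for g a
    using v(3) by (simp add: unit_ext_unit_emb tendsto_unit_emb_iff flip: unit_emb_simps)
  note lim = emb.unitary_conjugators[OF u(1) nv u(2)[OF vv] conv]
  \<comment> \<open>The scalar part of a unitary has modulus 1. Multiplying
    \<open>star (u n)\<close> by this phase makes its scalar part 1 and leaves the conjugation
    unchanged.\<close>
  define z where "z n = scalar_part (u n)" for n
  have z: "z n * cnj (z n) = 1" for n
    using u(1)[of n] unfolding unitary_def
    by (metis z_def one_unitization_def star_unitization_def times_unitization_def unitization.sel(2))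
  define w where "w n = z n *\<^sub>C star (u n)" for n
  have "w n \<in> unitary_group_one_plus" for n
  proof -
    have "scalar_part (w n) = 1"
      using z[of n] by (simp add: w_def scaleC_unitization_def star_unitization_def z_def)
    moreover have "unitary (w n)"
      using u(1)[of n] z[of n]
      by (simp add: unitary_def w_def star_scaleC scaleC_scaleC scaleC_one mult.commute)
    ultimately show ?thesis by (simp add: unitary_group_one_plus_iff)
  qed
  moreover have "unit_ext (\<beta> g) (w n) * unit_emb (\<phi> g a) * star (w n)
      = unit_ext (\<beta> g) (star (u n)) * unit_emb (\<phi> g a) * u n" for g a n
  proof -
    have "unit_ext (\<beta> g) (w n) = z n *\<^sub>C unit_ext (\<beta> g) (star (u n))"
      using star_hom_unit_ext[OF phi.\<beta>[of g]] unfolding w_def star_hom_def by (simp add: clinearD)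
    then show ?thesis
      using z[of n] by (simp add: w_def star_scaleC scaleC_scaleC scaleC_one mult.commute)
  qed
  ultimately show ?thesis
    unfolding proper_approx_unitary_equiv_def using lim by (intro exI[of _ w]) auto
qed

lemma proper_asymp_if_MvN:
  assumes "stable_cstar TYPE('b)" and "asymp_MvN_equiv \<beta> \<phi> \<psi>"
  shows "proper_asymp_unitary_equiv \<beta> \<phi> \<psi>"
proof -
  obtain \<tau> :: "'b \<Rightarrow> compact_op \<Rightarrow> 'b" where "cstar_tensor \<tau>"
    using assms(1) by (auto simp: stable_cstar_def)
  then interpret stable: stable_algebra \<tau> by unfold_locales
  from contractive_path[OF assms(2)]
  obtain v :: "real \<Rightarrow> 'b" where v0: "continuous_on UNIV v" "\<forall>t. norm (v t) \<le> 1"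
    "\<forall>a. ((\<lambda>t. star (v t) * \<phi> 0 a * v t) \<longlongrightarrow> \<psi> 0 a) at_top"
    "\<forall>g a. ((\<lambda>t. \<beta> g (v t) * \<psi> g a * star (v t)) \<longlongrightarrow> \<phi> g a) at_top"
    by (elim exE conjE) (rule that)
  note v = v0(1) v0(2-4)[rule_format]
  have vv: "((\<lambda>t. star (v t) * v t * \<psi> 0 a) \<longlongrightarrow> \<psi> 0 a) at_top" for a
    by (rule star_mult_self_tendsto[OF v(2,3)]) (use v(4)[of 0] in \<open>simp add: beta_0\<close>)
  from stable.stable_unitaries[OF v(1,2)]
  obtain u :: "real \<Rightarrow> 'b unitization" where u0: "continuous_on UNIV u" "\<forall>t. u t \<in> unitary_group_one_plus"
    "\<forall>F c. F \<le> at_top \<longrightarrow> ((\<lambda>t. star (v t) * v t * c) \<longlongrightarrow> c) F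
      \<longrightarrow> ((\<lambda>t. (u t - unit_emb (v t)) * unit_emb c) \<longlongrightarrow> 0) F"
    by (elim exE conjE) (rule that)
  note u = u0(1) u0(2,3)[rule_format]
  have uu: "unitary (u t)" for t using u(2) by (simp add: unitary_group_one_plus_iff)
  have nv: "norm (unit_emb (v t)) \<le> 1" for t by (simp add: v(2))
  have conv: "((\<lambda>t. unit_ext (\<beta> g) (unit_emb (v t)) * unit_emb (\<psi> g a) * star (unit_emb (v t))) \<longlongrightarrow> unit_emb (\<phi> g a)) at_top" for g a
    using v(4) by (simp add: unit_ext_unit_emb tendsto_unit_emb_iff flip: unit_emb_simps)
  note lim = emb.unitary_conjugators[OF uu nv u(3)[OF order_refl vv] conv]
  have "continuous_on {0..} (\<lambda>t. star (u t))"
    by (intro continuous_on_star continuous_on_subset[OF u(1)]) simp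
  then show ?thesis
    unfolding proper_asymp_unitary_equiv_def
    using lim u(2) by (intro exI[of _ "\<lambda>t. star (u t)"]) (auto intro: star_unitary_group_one_plus)
qed

end

text \<open>The relation at the pair of neutral elements makes \<open>\<beta> 0\<close> idempotent,
  and an injective idempotent map is the identity.\<close>

lemma anomalous_action_0:
  assumes "anomalous_action \<beta> \<vv>"
  shows "\<beta> 0 x = x"
proof -
  have "\<beta> 0 \<circ> \<beta> 0 = Ad (\<vv> 0 0) \<circ> \<beta> (0 + 0)" "\<vv> 0 0 = 1"
    using assms by (simp_all add: anomalous_action_def)
  then have "\<beta> 0 (\<beta> 0 x) = \<beta> 0 x" by (simp add: Ad_def fun_eq_iff)
  moreover have "inj (\<beta> 0)" using assms by (auto simp: anomalous_action_def star_automorphism_def bij_is_inj)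
  ultimately show ?thesis by (simp add: inj_eq)
qed

text \<open>In the coherence relation, a neutral first group element gives multiplicativity and a
  neutral second one gives the identity with \<alpha>; in both cases the normalised multipliers are
  1.\<close>

lemma covariant_map_if_coherent:
  assumes \<alpha>: "anomalous_action \<alpha> \<uu>" and \<beta>: "anomalous_action \<beta> \<vv>"
    and \<phi>: "coherent_morphism \<alpha> \<uu> \<beta> \<vv> \<phi>"
  shows "covariant_map \<alpha> \<beta> \<phi>"
proof
  have u: "\<uu> g 0 = 1" "\<uu> 0 g = 1" "\<vv> g 0 = 1" "\<vv> 0 g = 1" for g
    using \<alpha> \<beta> by (auto simp: anomalous_action_def)
  have eq: "\<phi> (g + h) (star (\<uu> g h) \<rhd> (\<alpha> g a * b)) = star (\<vv> g h) \<rhd> (\<beta> g (\<phi> h a) * \<phi> g b)" for g h a b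
    using \<phi> by (simp add: coherent_morphism_def)
  show "star_automorphism (\<alpha> g)" "star_hom (\<beta> g)" for g
    using \<alpha> \<beta> by (auto simp: anomalous_action_def intro: star_automorphism_imp_star_hom)
  show "clinear (\<phi> g)" "star (\<phi> g a) * \<phi> g b = \<phi> 0 (star a * b)" for g a b
    using \<phi> by (simp_all add: coherent_morphism_def)
  show "\<phi> g (a * b) = \<phi> g a * \<phi> 0 b" for g a b
    using eq[of 0 g a b] by (simp add: u anomalous_action_0[OF \<alpha>] anomalous_action_0[OF \<beta>])
  show "\<phi> g (\<alpha> g a * b) = \<beta> g (\<phi> 0 a) * \<phi> g b" for g a b
    using eq[of g 0 a b] by (simp add: u)
qed

theorem proposition2p7:
  fixes \<alpha> :: "'g::{group_add, countable} \<Rightarrow> 'a::cstar_algebra \<Rightarrow> 'a"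
    and \<uu> :: "'g \<Rightarrow> 'g \<Rightarrow> 'a multiplier"
    and \<beta> :: "'g \<Rightarrow> 'b::cstar_algebra \<Rightarrow> 'b"
    and \<vv> :: "'g \<Rightarrow> 'g \<Rightarrow> 'b multiplier"
    and \<phi> \<psi> :: "'g \<Rightarrow> 'a \<Rightarrow> 'b"
  assumes "separable_space (euclidean :: 'a topology)"
    and "anomalous_action \<alpha> \<uu>" and "anomalous_action \<beta> \<vv>"
    and "same_anomaly \<alpha> \<uu> \<beta> \<vv>"
    and "coherent_morphism \<alpha> \<uu> \<beta> \<vv> \<phi>" and "coherent_morphism \<alpha> \<uu> \<beta> \<vv> \<psi>"
  shows "(stable_cstar TYPE('b) \<or> almost_stable_rank_one TYPE('b) \<longrightarrow>
            (approx_MvN_equiv \<beta> \<phi> \<psi> \<longleftrightarrow> proper_approx_unitary_equiv \<beta> \<phi> \<psi>))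
       \<and> (stable_cstar TYPE('b) \<longrightarrow>
            (asymp_MvN_equiv \<beta> \<phi> \<psi> \<longleftrightarrow> proper_asymp_unitary_equiv \<beta> \<phi> \<psi>))"
proof -
  interpret p: covariant_map \<alpha> \<beta> \<phi> by (rule covariant_map_if_coherent[OF assms(2,3,5)])
  interpret q: covariant_map \<alpha> \<beta> \<psi> by (rule covariant_map_if_coherent[OF assms(2,3,6)])
  interpret coherent_pair \<alpha> \<beta> \<phi> \<psi>
    by unfold_locales (rule anomalous_action_0[OF assms(3)], rule assms(1))
  show ?thesis
    using approx_MvN_if_unitary asymp_MvN_if_unitary proper_approx_if_MvN proper_asymp_if_MvN by blast
qed

end
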